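(* Let $D$ be a basic set in $\Sigma^+$ and $\phi\in E(D)$, and let $\xi_{D,\phi}$ be the associated supercharacter of $U=U_n(q)$. Then: (i) $\xi_{D,\phi}=(\lambda_D^{V_DR_D})^U$. (ii) For each $\chi\in \mathrm{Irr}(V_DR_D,\lambda_D)$, $\chi^U\in \mathrm{Irr}(\xi_{D,\phi})$; that is, the induced character $\chi^U$ is irreducible and is a constituent of $\xi_{D,\phi}$. (iii) If $\chi_1\neq\chi_2\in \mathrm{Irr}(V_DR_D,\lambda_D)$, then $\chi_1^U\neq\chi_2^U$.
   Context: Let $q$ be a power of a prime, $\mathbb{F}_q$ the field with $q$ elements, $n\ge 2$, and $U=U_n(q)$ the group of upper triangular $n\times n$ matrices over $\mathbb{F}_q$ with all diagonal entries $1$. Characters are complex characters of finite groups; $\mathrm{Irr}(G)$ is the set of irreducible characters of $G$; for a subgroup $H\le G$, $\xi^G$ denotes the character induced from a character $\xi$ of $H$, and $\chi|_H$ denotes restriction. For $\xi\in\mathrm{Irr}(H)$, $\mathrm{Irr}(G,\xi)$ is the set of irreducible constituents of $\xi^G$. Let $\alpha_1,\dots,\alpha_{n-1}$ be the simple roots of type $A_{n-1}$, $\alpha_{i,j}=\alpha_i+\alpha_{i+1}+\dots+\alpha_j$ for $1\le i\le j\le n-1$, so $\alpha_{i,i}=\alpha_i$, and $\Sigma^+=\{\alpha_{i,j}\}$ the set of positive roots. Thus the sum of two positive roots is a positive root exactly in the case $\alpha_{i,j}+\alpha_{j+1,k}=\alpha_{i,k}$. The root $\alpha_{i,j}$ lies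 on row $i$ and column $j+1$. The root subgroup is $X_{\alpha_{i,j}}=\{x_{\alpha_{i,j}}(c)=I_n+c\,e_{i,j+1}: c\in\mathbb{F}_q\}$, where $e_{i,j+1}$ is the matrix unit. Fix a nontrivial linear character $\varphi:\mathbb{F}_q\to\mathbb{C}^\times$; for $\alpha\in\Sigma^+$, $s\in\mathbb{F}_q$, let $\phi_{\alpha,s}(x_\alpha(d))=\varphi(ds)$, a linear character of $X_\alpha$. Put $arm(\alpha_{i,j})=\{\alpha_{i,k}: i\le k<j\}$ and $V_\alpha=\langle X_\beta:\beta\in\Sigma^+\setminus arm(\alpha)\rangle$. For $s\in\mathbb{F}_q^\times$ let $\lambda_{\alpha,s}$ be the linear character of $V_\alpha$ with $\lambda_{\alpha,s}|_{X_\alpha}=\phi_{\alpha,s}$ and $\lambda_{\alpha,s}|_{X_\beta}=1$ for all other $X_\beta\subset V_\alpha$, $\beta\ne\alpha$. A basic set $D$ is a nonempty subset of $\Sigma^+$ in which no two distinct roots are on the same row or on the same column. An element $\phi\in E(D)$ is a choice, for every $\alpha\in D$, of one character $\lambda_{\alpha,s}$ with $s=s_\alpha\in\mathbb{F}_q^\times$; write $\lambda_{\alpha,s}\in\phi$. The supercharacter is $\xi_{D,\phi}=\bigotimes_{\lambda_{\alpha,s}\in\phi}\lambda_{\alpha,s}^U$, and $\mathrm{Irr}(\xi_{D,\phi})$ is the set of its irreducible constituents. Put $V_D=\bigcap_{\alpha\in D}V_\alpha$, which is generated by all $X_\beta$ with $\beta\in\Sigma^+\setminus\bigcup_{\alpha\in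 D}arm(\alpha)$, and let $\lambda_D=\bigotimes_{\lambda_{\alpha,s}\in\phi}\lambda_{\alpha,s}|_{V_D}$, a linear character of $V_D$ (depending on $\phi$). Write $\alpha_{i,j}<_r\alpha_{l,k}$ if $j<k$ and $\alpha_{i,j}<_b\alpha_{l,k}$ if $i<l$; both are total orders on a basic set. Let $D=\{\tau_1,\dots,\tau_k\}$ with $\tau_1<_r\dots<_r\tau_k$. For $1\le i<j\le k$ with $\tau_i<_b\tau_j$, let $\gamma_{i,j}$ be the root on the row of $\tau_i$ such that $\gamma_{i,j}+\tau_j\in\Sigma^+$ (if $\tau_i$ is on row $m$ and $\tau_j$ on row $l$, then $\gamma_{i,j}=\alpha_{m,l-1}$). Let $\Gamma_D$ be the set of all these $\gamma_{i,j}$ and $R_D=\langle X_\gamma:\gamma\in\Gamma_D\rangle$. The group $R_D$ normalizes $V_D$, so $V_DR_D$ is a subgroup of $U$. *)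

theory Defs
  imports
    Complex_Main
    "HOL-Library.Multiset"
    "HOL-Library.FuncSet"
    "HOL-Algebra.Generated_Groups"
    "Jordan_Normal_Form.VS_Connect"
begin

section \<open>Complex characters of finite groups\<close>

text \<open>
  A class function, character or linear character of a group \<open>G\<close> is a total function that is
  \<open>0\<close> outside \<open>carrier G\<close>. With this normalisation two characters of \<open>G\<close> are equal iff they
  are equal as functions.
\<close>

definition GL :: "nat \<Rightarrow> complex mat monoid" where
  "GL d = units_of (ring_mat TYPE(complex) d ())"

definition representation :: "('g, 'b) monoid_scheme \<Rightarrow> nat \<Rightarrow> ('g \<Rightarrow> complex mat) \<Rightarrow> bool" where
  "representation G d \<rho> \<longleftrightarrow> \<rho> \<in> hom G (GL d)"

definition irreducible_representation ::
    "('g, 'b) monoid_scheme \<Rightarrow> nat \<Rightarrow> ('g \<Rightarrow> complex mat) \<Rightarrow> bool" where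
  "irreducible_representation G d \<rho> \<longleftrightarrow>
     representation G d \<rho> \<and> d > 0 \<and>
     (\<forall>W. VectorSpace.subspace class_ring W (module_vec TYPE(complex) d) \<and>
          (\<forall>g\<in>carrier G. \<forall>w\<in>W. \<rho> g *\<^sub>v w \<in> W)
          \<longrightarrow> W = {0\<^sub>v d} \<or> W = carrier_vec d)"

definition character_of ::
    "('g, 'b) monoid_scheme \<Rightarrow> nat \<Rightarrow> ('g \<Rightarrow> complex mat) \<Rightarrow> 'g \<Rightarrow> complex" where
  "character_of G d \<rho> g = (if g \<in> carrier G then (\<Sum>i<d. \<rho> g $$ (i, i)) else 0)"

definition Irr :: "('g, 'b) monoid_scheme \<Rightarrow> ('g \<Rightarrow> complex) set" where
  "Irr G = {character_of G d \<rho> | d \<rho>. irreducible_representation G d \<rho>}"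

text \<open>
  The irreducible constituents of a character \<open>\<psi>\<close> are the irreducible characters that occur in
  the (unique) decomposition of \<open>\<psi>\<close> into a sum, with multiplicities, of irreducible characters.
\<close>

definition Irr_constituents :: "('g, 'b) monoid_scheme \<Rightarrow> ('g \<Rightarrow> complex) \<Rightarrow> ('g \<Rightarrow> complex) set"
  where
  "Irr_constituents G \<psi> =
     {\<chi>. \<exists>M. set_mset M \<subseteq> Irr G \<and> \<psi> = (\<lambda>g. \<Sum>\<eta>\<in>#M. \<eta> g) \<and> \<chi> \<in># M}"

text \<open>\<open>\<xi>\<^sup>G\<close> for a function \<open>\<xi>\<close> on the subgroup with underlying set \<open>H\<close>.\<close>

definition induced ::
    "('g, 'b) monoid_scheme \<Rightarrow> 'g set \<Rightarrow> ('g \<Rightarrow> complex) \<Rightarrow> 'g \<Rightarrow> complex" where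
  "induced G H \<xi> g =
     (if g \<in> carrier G then
        (\<Sum>x\<in>carrier G. let y = x \<otimes>\<^bsub>G\<^esub> g \<otimes>\<^bsub>G\<^esub> inv\<^bsub>G\<^esub> x in if y \<in> H then \<xi> y else 0) / of_nat (card H)
      else 0)"

definition Irr_over ::
    "('g, 'b) monoid_scheme \<Rightarrow> 'g set \<Rightarrow> ('g \<Rightarrow> complex) \<Rightarrow> ('g \<Rightarrow> complex) set" where
  "Irr_over G H \<xi> = Irr_constituents G (induced G H \<xi>)"

definition linear_character :: "('g, 'b) monoid_scheme \<Rightarrow> ('g \<Rightarrow> complex) \<Rightarrow> bool" where
  "linear_character G \<mu> \<longleftrightarrow>
     (\<forall>g\<in>carrier G. \<mu> g \<noteq> 0) \<and>
     (\<forall>g\<in>carrier G. \<forall>h\<in>carrier G. \<mu> (g \<otimes>\<^bsub>G\<^esub> h) = \<mu> g * \<mu> h) \<and>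
     (\<forall>g. g \<notin> carrier G \<longrightarrow> \<mu> g = 0)"

section \<open>The unitriangular group and its root subgroups\<close>

text \<open>
  The field with \<open>q\<close> elements is a type \<open>'q\<close> of sort \<open>{field, finite}\<close>. Matrix indices of type
  \<open>'q mat\<close> start at \<open>0\<close>.
\<close>

definition unitri :: "nat \<Rightarrow> 'q :: field mat monoid" where
  "unitri n =
     \<lparr>carrier = {A \<in> carrier_mat n n. upper_triangular A \<and> (\<forall>i<n. A $$ (i, i) = 1)},
      monoid.mult = (*),
      one = 1\<^sub>m n\<rparr>"

abbreviation unitri_subgroup :: "nat \<Rightarrow> 'q :: field mat set \<Rightarrow> 'q mat monoid" where
  "unitri_subgroup n H \<equiv> (unitri n)\<lparr>carrier := H\<rparr>"

text \<open>
  The pair \<open>(i, j)\<close> with \<open>1 \<le> i \<le> j \<le> n - 1\<close> stands for the positive root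
  \<open>\<alpha>\<^sub>i + \<dots> + \<alpha>\<^sub>j\<close>, which lies on row \<open>i\<close> and column \<open>j + 1\<close>.
\<close>

type_synonym root = "nat \<times> nat"

definition pos_roots :: "nat \<Rightarrow> root set" where
  "pos_roots n = {(i, j). 1 \<le> i \<and> i \<le> j \<and> j \<le> n - 1}"

definition row_of :: "root \<Rightarrow> nat" where
  "row_of \<alpha> = fst \<alpha>"

definition col_of :: "root \<Rightarrow> nat" where
  "col_of \<alpha> = snd \<alpha> + 1"

text \<open>The matrix \<open>I\<^sub>n + c e\<^sub>i\<^sub>,\<^sub>j\<^sub>+\<^sub>1\<close>; the shift by one passes to indices starting at \<open>0\<close>.\<close>

definition root_elt :: "nat \<Rightarrow> root \<Rightarrow> 'q :: field \<Rightarrow> 'q mat" where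
  "root_elt n \<alpha> c =
     1\<^sub>m n + c \<cdot>\<^sub>m mat n n (\<lambda>(k, l). if k = row_of \<alpha> - 1 \<and> l = col_of \<alpha> - 1 then 1 else 0)"

definition root_subgroup :: "nat \<Rightarrow> root \<Rightarrow> 'q :: field mat set" where
  "root_subgroup n \<alpha> = range (root_elt n \<alpha>)"

definition gen_by_roots :: "nat \<Rightarrow> root set \<Rightarrow> 'q :: field mat set" where
  "gen_by_roots n S = generate (unitri n) (\<Union>\<beta>\<in>S. root_subgroup n \<beta>)"

definition arm :: "root \<Rightarrow> root set" where
  "arm \<alpha> = {(i, k) | i k. i = fst \<alpha> \<and> i \<le> k \<and> k < snd \<alpha>}"

definition V_root :: "nat \<Rightarrow> root \<Rightarrow> 'q :: field mat set" where
  "V_root n \<alpha> = gen_by_roots n (pos_roots n - arm \<alpha>)"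

section \<open>Supercharacters\<close>

definition nontrivial_additive_character :: "('q :: field \<Rightarrow> complex) \<Rightarrow> bool" where
  "nontrivial_additive_character \<theta> \<longleftrightarrow>
     linear_character \<lparr>carrier = UNIV, monoid.mult = (+), one = 0\<rparr> \<theta> \<and> (\<exists>c. \<theta> c \<noteq> 1)"

text \<open>
  \<open>lam \<theta> n \<alpha> s\<close> is the linear character \<open>\<lambda>\<^sub>\<alpha>\<^sub>,\<^sub>s\<close> of \<open>V_root n \<alpha>\<close>, where \<open>\<theta>\<close> is the fixed
  nontrivial character of the additive group of the field.
\<close>

definition lam :: "('q :: field \<Rightarrow> complex) \<Rightarrow> nat \<Rightarrow> root \<Rightarrow> 'q \<Rightarrow> 'q mat \<Rightarrow> complex" where
  "lam \<theta> n \<alpha> s =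
     (THE \<mu>. linear_character (unitri_subgroup n (V_root n \<alpha>)) \<mu> \<and>
        (\<forall>d. \<mu> (root_elt n \<alpha> d) = \<theta> (d * s)) \<and>
        (\<forall>\<beta>\<in>pos_roots n. \<beta> \<noteq> \<alpha> \<and> root_subgroup n \<beta> \<subseteq> (V_root n \<alpha> :: 'q mat set) \<longrightarrow>
           (\<forall>g\<in>root_subgroup n \<beta>. \<mu> g = 1)))"

definition basic_set :: "nat \<Rightarrow> root set \<Rightarrow> bool" where
  "basic_set n D \<longleftrightarrow>
     D \<noteq> {} \<and> D \<subseteq> pos_roots n \<and>
     (\<forall>\<alpha>\<in>D. \<forall>\<beta>\<in>D. \<alpha> \<noteq> \<beta> \<longrightarrow> row_of \<alpha> \<noteq> row_of \<beta> \<and> col_of \<alpha> \<noteq> col_of \<beta>)"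

definition E_basic ::
    "('q :: field \<Rightarrow> complex) \<Rightarrow> nat \<Rightarrow> root set \<Rightarrow> (root \<Rightarrow> 'q mat \<Rightarrow> complex) set" where
  "E_basic \<theta> n D = (\<Pi>\<^sub>E \<alpha>\<in>D. {lam \<theta> n \<alpha> s | s. s \<noteq> 0})"

definition supercharacter ::
    "nat \<Rightarrow> root set \<Rightarrow> (root \<Rightarrow> 'q :: field mat \<Rightarrow> complex) \<Rightarrow> 'q mat \<Rightarrow> complex" where
  "supercharacter n D \<phi> g = (\<Prod>\<alpha>\<in>D. induced (unitri n) (V_root n \<alpha>) (\<phi> \<alpha>) g)"

definition V_basic :: "nat \<Rightarrow> root set \<Rightarrow> 'q :: field mat set" where
  "V_basic n D = (\<Inter>\<alpha>\<in>D. V_root n \<alpha>)"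

definition lam_basic ::
    "nat \<Rightarrow> root set \<Rightarrow> (root \<Rightarrow> 'q :: field mat \<Rightarrow> complex) \<Rightarrow> 'q mat \<Rightarrow> complex" where
  "lam_basic n D \<phi> g = (if g \<in> V_basic n D then \<Prod>\<alpha>\<in>D. \<phi> \<alpha> g else 0)"

definition less_r :: "root \<Rightarrow> root \<Rightarrow> bool" where
  "less_r \<alpha> \<beta> \<longleftrightarrow> snd \<alpha> < snd \<beta>"

definition less_b :: "root \<Rightarrow> root \<Rightarrow> bool" where
  "less_b \<alpha> \<beta> \<longleftrightarrow> fst \<alpha> < fst \<beta>"

text \<open>
  For \<open>\<sigma>\<close> on row \<open>m\<close> and \<open>\<tau>\<close> on row \<open>l\<close> with \<open>m < l\<close>, the root \<open>(m, l - 1)\<close> is the only one on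
  row \<open>m\<close> whose sum with \<open>\<tau>\<close> is a positive root. For \<open>D = {\<tau>\<^sub>1 <\<^sub>r \<dots> <\<^sub>r \<tau>\<^sub>k}\<close> the condition
  \<open>i < j\<close> on indices reads \<open>less_r \<tau>\<^sub>i \<tau>\<^sub>j\<close>.
\<close>

definition Gamma_basic :: "root set \<Rightarrow> root set" where
  "Gamma_basic D =
     {(row_of \<sigma>, row_of \<tau> - 1) | \<sigma> \<tau>. \<sigma> \<in> D \<and> \<tau> \<in> D \<and> less_r \<sigma> \<tau> \<and> less_b \<sigma> \<tau>}"

definition R_basic :: "nat \<Rightarrow> root set \<Rightarrow> 'q :: field mat set" where
  "R_basic n D = gen_by_roots n (Gamma_basic D)"

definition VR_basic :: "nat \<Rightarrow> root set \<Rightarrow> 'q :: field mat set" where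
  "VR_basic n D = V_basic n D <#>\<^bsub>unitri n\<^esub> R_basic n D"

end

theory Submission
  imports Defs
begin

text \<open>
  Write \<open>U\<close> for the unitriangular group, \<open>V\<close> for \<open>V_basic n D\<close>, \<open>\<lambda>\<close> for the linear character
  \<open>lam_basic n D \<phi>\<close> of \<open>V\<close>, and \<open>VR\<close> for the product of \<open>V\<close> with \<open>R_basic n D\<close>.

  The supercharacter is \<open>\<lambda>\<^sup>U\<close>. Each of its tensor factors is induced from the subgroup of matrices whose
  row through a root of \<open>D\<close> vanishes on the arm of that root. Since the roots of \<open>D\<close> lie on distinct
  rows, each such subgroup has a complement contained in all the others, and then the product of two
  induced characters is induced from the intersection (\<open>induced_mult_of_complemented\<close>). The identity
  (i) follows by transitivity of induction.

  For (ii) and (iii) the facts needed about \<open>V \<subseteq> VR \<subseteq> U\<close> are: \<open>VR\<close> normalises \<open>V\<close> and fixes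
  \<open>\<lambda>\<close>, and every \<open>g\<close> outside \<open>VR\<close> admits \<open>y \<in> V\<close> with \<open>g * y * inv g \<in> V\<close> and
  \<open>\<lambda> (g * y * inv g) \<noteq> \<lambda> y\<close> (\<open>separated_outside_VR\<close>). They make the following argument of Clifford
  and Mackey work. An irreducible representation of \<open>VR\<close> over \<open>\<lambda>\<close> restricts to \<open>V\<close> as a
  multiple of \<open>\<lambda>\<close> (\<open>Irr_over_acts_by_scalars\<close>). In the representation induced from it to \<open>U\<close> the
  projection onto the \<open>\<lambda>\<close>-isotypic part for \<open>V\<close> is exactly the projection onto the original module,
  because all other cosets of \<open>VR\<close> are killed by the separation of \<open>\<lambda>\<close> from its conjugates. Hence a
  nonzero invariant subspace meets, so contains, the original module, which generates everything
  (\<open>irreducible_representation_block_rep\<close>). Taking the trace of the same projection recovers the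
  original character from the induced one (\<open>character_recovered_from_induced\<close>), which gives (iii).

  The facts about \<open>V\<close> and \<open>VR\<close> become short once all groups are described by the positions at which
  their matrices may have nonzero entries (\<open>gen_by_roots_eq_pattern\<close>). The matrices \<open>X = v - 1\<close> with
  \<open>v \<in> V\<close> form a space that is closed under right multiplication by \<open>U\<close>, and \<open>\<lambda>\<close> reads off, in every row of \<open>D\<close>, the
  first entry after the arm, which right multiplication by \<open>U\<close> does not change. So conjugation of
  \<open>1 + X\<close> by \<open>g\<close> may be replaced by the linear map \<open>X \<mapsto> g X\<close> (\<open>conjugate_row\<close>), and the
  stabiliser of \<open>\<lambda>\<close> is computed row by row.
\<close>

section \<open>Matrix representations\<close>

lemma subspace_module_vec_iff:
  "VectorSpace.subspace class_ring W (module_vec TYPE(complex) d) \<longleftrightarrow>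
     W \<subseteq> carrier_vec d \<and> 0\<^sub>v d \<in> W \<and> (\<forall>v\<in>W. \<forall>w\<in>W. v + w \<in> W) \<and> (\<forall>c. \<forall>w\<in>W. c \<cdot>\<^sub>v w \<in> W)"
proof -
  interpret vec_space "TYPE(complex)" d .
  have "VectorSpace.subspace class_ring W (module_vec TYPE(complex) d) \<longleftrightarrow>
      submodule class_ring W (module_vec TYPE(complex) d)"
    unfolding VectorSpace.subspace_def using vec_vs by blast
  then show ?thesis
    unfolding submodule_def module_vec_simps class_ring_simps using vec_module by blast
qed

text \<open>
  Averages over a group enter the proofs only through this closure property; it is stated
  coordinatewise so that finite sums of vectors never have to be formed in the module.
\<close>

lemma subspace_linear_combination:
  assumes sub: "VectorSpace.subspace class_ring W (module_vec TYPE(complex) d)"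
    and "finite S" and "\<And>s. s \<in> S \<Longrightarrow> w s \<in> W"
  shows "vec d (\<lambda>k. \<Sum>s\<in>S. c s * w s $ k) \<in> W"
  using assms(2,3)
proof (induction S rule: finite_induct)
  case empty
  have "vec d (\<lambda>k. \<Sum>s\<in>{}. c s * w s $ k) = 0\<^sub>v d"
    by auto
  then show ?case
    using sub[unfolded subspace_module_vec_iff] by simp
next
  case (insert s S)
  have s: "w s \<in> W" and "w s \<in> carrier_vec d"
    using insert.prems sub[unfolded subspace_module_vec_iff] by auto
  then have "vec d (\<lambda>k. \<Sum>s\<in>insert s S. c s * w s $ k)
      = c s \<cdot>\<^sub>v w s + vec d (\<lambda>k. \<Sum>s\<in>S. c s * w s $ k)"
    using insert.hyps by (intro eq_vecI) (simp_all add: carrier_vecD)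
  then show ?case
    using insert.IH insert.prems s sub[unfolded subspace_module_vec_iff] by simp
qed

lemma (in group) representation_iff:
  "representation G d \<rho> \<longleftrightarrow>
     (\<forall>g\<in>carrier G. \<rho> g \<in> carrier_mat d d) \<and>
     (\<forall>g\<in>carrier G. \<forall>h\<in>carrier G. \<rho> (g \<otimes> h) = \<rho> g * \<rho> h) \<and>
     \<rho> \<one> = 1\<^sub>m d"
proof -
  let ?R = "ring_mat TYPE(complex) d ()"
  interpret M: monoid ?R
    by (rule ring.is_monoid[OF ring_mat])
  have GLg: "group (GL d)"
    unfolding GL_def by (rule M.units_group)
  have sim: "carrier (GL d) = Units ?R" "mult (GL d) = (*)" "one (GL d) = 1\<^sub>m d"
    by (auto simp: GL_def units_of_def ring_mat_simps)
  show ?thesis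
  proof
    assume "representation G d \<rho>"
    then have h: "\<rho> \<in> hom G (GL d)"
      by (simp add: representation_def)
    then interpret group_hom G "GL d" \<rho>
      using GLg by (simp add: group_hom_def group_hom_axioms_def)
    have "Units ?R \<subseteq> carrier_mat d d"
      using M.Units_closed by (auto simp: ring_mat_simps)
    then show "(\<forall>g\<in>carrier G. \<rho> g \<in> carrier_mat d d) \<and>
     (\<forall>g\<in>carrier G. \<forall>h\<in>carrier G. \<rho> (g \<otimes> h) = \<rho> g * \<rho> h) \<and>
     \<rho> \<one> = 1\<^sub>m d"
      using hom_closed hom_mult hom_one by (auto simp: sim)
  next
    assume r: "(\<forall>g\<in>carrier G. \<rho> g \<in> carrier_mat d d) \<and>
     (\<forall>g\<in>carrier G. \<forall>h\<in>carrier G. \<rho> (g \<otimes> h) = \<rho> g * \<rho> h) \<and> \<rho> \<one> = 1\<^sub>m d"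
    have "\<rho> g \<in> Units ?R" if "g \<in> carrier G" for g
    proof -
      have "\<rho> g * \<rho> (inv g) = 1\<^sub>m d" "\<rho> (inv g) * \<rho> g = 1\<^sub>m d"
        using r that by (metis inv_closed r_inv, metis inv_closed l_inv)
      then show ?thesis
        using r that by (auto simp: Units_def ring_mat_simps)
    qed
    then show "representation G d \<rho>"
      unfolding representation_def using r by (auto simp: hom_def sim)
  qed
qed

section \<open>Induction of functions on subgroups\<close>

definition extend_zero :: "'g set \<Rightarrow> ('g \<Rightarrow> complex) \<Rightarrow> 'g \<Rightarrow> complex" where
  "extend_zero H \<xi> y = (if y \<in> H then \<xi> y else 0)"

lemma induced_eq:
  "induced G H \<xi> g =
     (if g \<in> carrier G
      then (\<Sum>x\<in>carrier G. extend_zero H \<xi> (x \<otimes>\<^bsub>G\<^esub> g \<otimes>\<^bsub>G\<^esub> inv\<^bsub>G\<^esub> x)) / of_nat (card H) else 0)"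
  by (simp add: induced_def extend_zero_def Let_def)

lemma induced_cong:
  assumes "\<And>y. y \<in> H \<Longrightarrow> \<mu> y = \<nu> y"
  shows "induced G H \<mu> = induced G H \<nu>"
proof -
  have "extend_zero H \<mu> = extend_zero H \<nu>"
    using assms by (auto simp: extend_zero_def)
  then show ?thesis by (simp add: induced_eq fun_eq_iff)
qed

context group
begin

lemma subgroup_mult_iff:
  assumes "subgroup H G" "h \<in> H" "x \<in> carrier G"
  shows "h \<otimes> x \<in> H \<longleftrightarrow> x \<in> H" "x \<otimes> h \<in> H \<longleftrightarrow> x \<in> H"
proof -
  have h: "h \<in> carrier G" "inv h \<in> H"
    using assms by (auto intro: subgroup.mem_carrier subgroup.m_inv_closed)
  have "x = inv h \<otimes> (h \<otimes> x)" "x = (x \<otimes> h) \<otimes> inv h"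
    using assms h by (auto simp: m_assoc[symmetric]) (simp add: m_assoc)
  then show "h \<otimes> x \<in> H \<longleftrightarrow> x \<in> H" "x \<otimes> h \<in> H \<longleftrightarrow> x \<in> H"
    using assms h subgroup.m_closed by metis+
qed

lemma sum_left_translate:
  assumes "subgroup H G" "a \<in> H"
  shows "(\<Sum>x\<in>H. f (a \<otimes> x)) = (\<Sum>x\<in>H. f x)"
proof (rule sum.reindex_bij_witness[of _ "\<lambda>x. inv a \<otimes> x" "\<lambda>x. a \<otimes> x"])
  note mem = subgroup.mem_carrier[OF assms(1)]
  have "a \<in> carrier G" "inv a \<in> H"
    using assms mem by (auto intro: subgroup.m_inv_closed)
  then show "inv a \<otimes> (a \<otimes> x) = x" "a \<otimes> (inv a \<otimes> x) = x" if "x \<in> H" for x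
    using mem[OF that] by (simp_all add: m_assoc[symmetric])
  show "a \<otimes> x \<in> H" "inv a \<otimes> x \<in> H" if "x \<in> H" for x
    using that assms \<open>inv a \<in> H\<close> subgroup.m_closed by metis+
qed auto

lemma sum_right_translate:
  assumes "subgroup H G" "a \<in> H"
  shows "(\<Sum>x\<in>H. f (x \<otimes> a)) = (\<Sum>x\<in>H. f x)"
proof (rule sum.reindex_bij_witness[of _ "\<lambda>x. x \<otimes> inv a" "\<lambda>x. x \<otimes> a"])
  note mem = subgroup.mem_carrier[OF assms(1)]
  have "a \<in> carrier G" "inv a \<in> H"
    using assms mem by (auto intro: subgroup.m_inv_closed)
  then show "x \<otimes> a \<otimes> inv a = x" "x \<otimes> inv a \<otimes> a = x" if "x \<in> H" for x
    using mem[OF that] by (simp_all add: m_assoc)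
  show "x \<otimes> a \<in> H" "x \<otimes> inv a \<in> H" if "x \<in> H" for x
    using that assms \<open>inv a \<in> H\<close> subgroup.m_closed by metis+
qed auto

lemma induced_restrict_carrier:
  assumes "subgroup H G" "h \<in> H"
  shows "induced (G\<lparr>carrier := H\<rparr>) V \<xi> h =
     (\<Sum>x\<in>H. extend_zero V \<xi> (x \<otimes> h \<otimes> inv x)) / of_nat (card V)"
proof -
  have "(\<Sum>x\<in>H. extend_zero V \<xi> (x \<otimes> h \<otimes> inv\<^bsub>G\<lparr>carrier := H\<rparr>\<^esub> x))
      = (\<Sum>x\<in>H. extend_zero V \<xi> (x \<otimes> h \<otimes> inv x))"
    using assms by (intro sum.cong) (auto simp: m_inv_consistent)
  then show ?thesis
    using assms by (simp add: induced_eq)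
qed

text \<open>
  If a conjugate of \<open>g\<close> lies outside \<open>H\<close>, so do all its conjugates by elements of \<open>H\<close>, and these miss
  \<open>V\<close>. Hence the sum over \<open>H\<close> hidden in the inner induction may be absorbed into the sum over \<open>G\<close>.
\<close>

lemma induced_transitive:
  assumes H: "subgroup H G" and fin: "finite (carrier G)" and "V \<subseteq> H"
  shows "induced G H (induced (G\<lparr>carrier := H\<rparr>) V \<xi>) = induced G V \<xi>"
proof
  fix g
  let ?\<xi> = "extend_zero V \<xi>"
  have finH: "finite H" and cardH: "card H \<noteq> 0"
    using finite_subset[OF subgroup.subset[OF H] fin] subgroup.finite_imp_card_positive[OF H fin]
    by auto
  show "induced G H (induced (G\<lparr>carrier := H\<rparr>) V \<xi>) g = induced G V \<xi> g"
  proof (cases "g \<in> carrier G")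
    case True
    have 1: "extend_zero H (induced (G\<lparr>carrier := H\<rparr>) V \<xi>) y
        = (\<Sum>h\<in>H. ?\<xi> (h \<otimes> y \<otimes> inv h)) / of_nat (card V)" if y: "y \<in> carrier G" for y
    proof (cases "y \<in> H")
      case True
      then show ?thesis
        by (simp add: extend_zero_def[of H] induced_restrict_carrier[OF H])
    next
      case False
      have "h \<otimes> y \<otimes> inv h \<notin> V" if "h \<in> H" for h
        using that y False \<open>V \<subseteq> H\<close> subgroup.mem_carrier[OF H that]
          subgroup.m_inv_closed[OF H that]
        by (auto simp: subgroup_mult_iff[OF H])
      then have "(\<Sum>h\<in>H. ?\<xi> (h \<otimes> y \<otimes> inv h)) = 0"
        by (intro sum.neutral) (auto simp: extend_zero_def)
      with False show ?thesis
        by (simp add: extend_zero_def[of H])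
    qed
    have "(\<Sum>x\<in>carrier G. extend_zero H (induced (G\<lparr>carrier := H\<rparr>) V \<xi>) (x \<otimes> g \<otimes> inv x))
        = (\<Sum>x\<in>carrier G. (\<Sum>h\<in>H. ?\<xi> (h \<otimes> (x \<otimes> g \<otimes> inv x) \<otimes> inv h)) / of_nat (card V))"
      using True by (intro sum.cong) (auto simp: 1)
    also have "\<dots> = (\<Sum>h\<in>H. \<Sum>x\<in>carrier G. ?\<xi> (h \<otimes> (x \<otimes> g \<otimes> inv x) \<otimes> inv h)) / of_nat (card V)"
      by (simp add: sum_divide_distrib[symmetric] sum.swap[of _ H])
    also have "(\<Sum>h\<in>H. \<Sum>x\<in>carrier G. ?\<xi> (h \<otimes> (x \<otimes> g \<otimes> inv x) \<otimes> inv h))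
        = (\<Sum>h\<in>H. \<Sum>x\<in>carrier G. ?\<xi> (x \<otimes> g \<otimes> inv x))"
    proof (rule sum.cong[OF refl])
      fix h assume h: "h \<in> H"
      then have hG: "h \<in> carrier G" using H subgroup.mem_carrier by metis
      have "(\<Sum>x\<in>carrier G. ?\<xi> (h \<otimes> (x \<otimes> g \<otimes> inv x) \<otimes> inv h))
          = (\<Sum>x\<in>carrier G. ?\<xi> ((h \<otimes> x) \<otimes> g \<otimes> inv (h \<otimes> x)))"
        using hG True by (intro sum.cong) (auto simp: inv_mult_group m_assoc)
      also have "\<dots> = (\<Sum>x\<in>carrier G. ?\<xi> (x \<otimes> g \<otimes> inv x))"
        by (rule sum_left_translate[OF subgroup_self hG])
      finally show "(\<Sum>x\<in>carrier G. ?\<xi> (h \<otimes> (x \<otimes> g \<otimes> inv x) \<otimes> inv h))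
          = (\<Sum>x\<in>carrier G. ?\<xi> (x \<otimes> g \<otimes> inv x))" .
    qed
    finally show ?thesis
      using True cardH by (simp add: induced_eq[of G])
  qed (simp add: induced_eq)
qed

lemma sum_over_transversal:
  fixes F :: "'a \<Rightarrow> complex"
  assumes H: "subgroup H G" and tG: "\<And>i. i \<in> I \<Longrightarrow> t i \<in> carrier G"
    and cover: "\<And>x. x \<in> carrier G \<Longrightarrow> \<exists>!i. i \<in> I \<and> x \<otimes> inv (t i) \<in> H"
  shows "(\<Sum>x\<in>carrier G. F x) = (\<Sum>h\<in>H. \<Sum>i\<in>I. F (h \<otimes> t i))"
proof -
  have HG: "h \<in> carrier G" if "h \<in> H" for h using that H subgroup.mem_carrier by metis
  define c where "c x = (THE i. i \<in> I \<and> x \<otimes> inv (t i) \<in> H)" for x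
  have c: "c x \<in> I" "x \<otimes> inv (t (c x)) \<in> H" if "x \<in> carrier G" for x
    using theI'[OF cover[OF that]] unfolding c_def by auto
  have c_eq: "c (h \<otimes> t i) = i" if "h \<in> H" "i \<in> I" for h i
  proof -
    have "h \<otimes> t i \<otimes> inv (t i) = h" using that HG tG by (simp add: m_assoc)
    then show ?thesis
      using c[of "h \<otimes> t i"] cover[of "h \<otimes> t i"] that HG tG by (metis m_closed)
  qed
  have "(\<Sum>x\<in>carrier G. F x) = (\<Sum>(h, i)\<in>H \<times> I. F (h \<otimes> t i))"
    by (rule sum.reindex_bij_witness[of _ "\<lambda>(h, i). h \<otimes> t i" "\<lambda>x. (x \<otimes> inv (t (c x)), c x)"])
      (use c c_eq HG tG in \<open>auto simp: m_assoc\<close>)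
  then show ?thesis by (simp add: sum.cartesian_product)
qed

text \<open>
  A function invariant under \<open>H\<close> on the left and one invariant under \<open>K\<close> are independent random
  variables on \<open>G\<close> as soon as \<open>K\<close> contains a transversal \<open>A\<close> of the right cosets of \<open>H\<close>: averaging over
  \<open>a \<in> A\<close> the translates by \<open>a\<close> of the product leaves \<open>f'\<close> fixed and turns \<open>f\<close> into its mean.
\<close>

lemma sum_product_of_complemented:
  fixes f f' :: "'a \<Rightarrow> complex"
  assumes H: "subgroup H G" and K: "subgroup K G" and A: "A \<subseteq> K"
    and fin: "finite (carrier G)"
    and cover: "\<And>x. x \<in> carrier G \<Longrightarrow> \<exists>!a. a \<in> A \<and> x \<otimes> inv a \<in> H"
    and f: "\<And>h x. h \<in> H \<Longrightarrow> x \<in> carrier G \<Longrightarrow> f (h \<otimes> x) = f x"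
    and f': "\<And>k x. k \<in> K \<Longrightarrow> x \<in> carrier G \<Longrightarrow> f' (k \<otimes> x) = f' x"
  shows "of_nat (card (carrier G)) * (\<Sum>x\<in>carrier G. f x * f' x)
     = (\<Sum>x\<in>carrier G. f x) * (\<Sum>x\<in>carrier G. f' x)"
proof -
  have AG: "A \<subseteq> carrier G" using A K subgroup.subset by blast
  have reg: "(\<Sum>x\<in>carrier G. F x) = (\<Sum>h\<in>H. \<Sum>a\<in>A. F (h \<otimes> a))" for F :: "'a \<Rightarrow> complex"
    by (rule sum_over_transversal[OF H _ cover]) (use AG in auto)
  have reg': "(\<Sum>x\<in>carrier G. f x) = of_nat (card H) * (\<Sum>a\<in>A. f (a \<otimes> w))"
    if w: "w \<in> carrier G" for w
  proof -
    have "(\<Sum>x\<in>carrier G. f x) = (\<Sum>x\<in>carrier G. f (x \<otimes> w))"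
      by (rule sum_right_translate[OF subgroup_self w, symmetric])
    also have "\<dots> = (\<Sum>h\<in>H. \<Sum>a\<in>A. f (h \<otimes> a \<otimes> w))"
      by (rule reg)
    also have "\<dots> = (\<Sum>h\<in>H. \<Sum>a\<in>A. f (a \<otimes> w))"
      using w AG subgroup.mem_carrier[OF H] by (intro sum.cong refl) (simp add: m_assoc f subsetD)
    finally show ?thesis by simp
  qed
  have cardG: "(of_nat (card (carrier G)) :: complex) = of_nat (card H) * of_nat (card A)"
    using reg[of "\<lambda>_. 1"] by simp
  have "of_nat (card (carrier G)) * (\<Sum>x\<in>carrier G. f x * f' x)
     = of_nat (card H) * (\<Sum>a\<in>A. \<Sum>x\<in>carrier G. f x * f' x)"
    by (simp add: cardG)
  also have "(\<Sum>a\<in>A. \<Sum>x\<in>carrier G. f x * f' x) = (\<Sum>a\<in>A. \<Sum>x\<in>carrier G. f (a \<otimes> x) * f' x)"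
  proof (rule sum.cong[OF refl])
    fix a assume a: "a \<in> A"
    then have aG: "a \<in> carrier G" using AG by blast
    have "(\<Sum>x\<in>carrier G. f x * f' x) = (\<Sum>x\<in>carrier G. f (a \<otimes> x) * f' (a \<otimes> x))"
      by (rule sum_left_translate[OF subgroup_self aG, symmetric])
    also have "\<dots> = (\<Sum>x\<in>carrier G. f (a \<otimes> x) * f' x)"
      using a A by (intro sum.cong refl) (simp add: f' subsetD)
    finally show "(\<Sum>x\<in>carrier G. f x * f' x) = (\<Sum>x\<in>carrier G. f (a \<otimes> x) * f' x)" .
  qed
  also have "of_nat (card H) * \<dots> = (\<Sum>x\<in>carrier G. (of_nat (card H) * (\<Sum>a\<in>A. f (a \<otimes> x))) * f' x)"
    by (subst sum.swap) (simp add: sum_distrib_left sum_distrib_right mult.assoc)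
  also have "\<dots> = (\<Sum>x\<in>carrier G. f x) * (\<Sum>x\<in>carrier G. f' x)"
    unfolding sum_distrib_left[of "\<Sum>x\<in>carrier G. f x"]
    by (intro sum.cong refl) (simp add: reg')
  finally show ?thesis .
qed

text \<open>
  The product formula for induced characters when \<open>H K = G\<close>. Independence is used twice: for the two
  sums of conjugates, and for the indicator functions of \<open>H\<close> and \<open>K\<close>, where it says that
  \<open>|G| |H \<inter> K| = |H| |K|\<close>.
\<close>

lemma induced_mult_of_complemented:
  assumes H: "subgroup H G" and K: "subgroup K G" and A: "A \<subseteq> K"
    and fin: "finite (carrier G)"
    and cover: "\<And>x. x \<in> carrier G \<Longrightarrow> \<exists>!a. a \<in> A \<and> x \<otimes> inv a \<in> H"
    and \<mu>: "\<And>h y. h \<in> H \<Longrightarrow> y \<in> H \<Longrightarrow> \<mu> (h \<otimes> y \<otimes> inv h) = \<mu> y"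
    and \<nu>: "\<And>h y. h \<in> K \<Longrightarrow> y \<in> K \<Longrightarrow> \<nu> (h \<otimes> y \<otimes> inv h) = \<nu> y"
  shows "induced G H \<mu> g * induced G K \<nu> g = induced G (H \<inter> K) (\<lambda>y. \<mu> y * \<nu> y) g"
proof (cases "g \<in> carrier G")
  case True
  note sum_product = sum_product_of_complemented[OF H K A fin cover]
  have inv1: "extend_zero S \<xi> ((h \<otimes> x) \<otimes> g \<otimes> inv (h \<otimes> x)) = extend_zero S \<xi> (x \<otimes> g \<otimes> inv x)"
    if S: "subgroup S G" and \<xi>: "\<And>h y. h \<in> S \<Longrightarrow> y \<in> S \<Longrightarrow> \<xi> (h \<otimes> y \<otimes> inv h) = \<xi> y"
      and h: "h \<in> S" and x: "x \<in> carrier G" for S \<xi> h x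
  proof -
    have e: "(h \<otimes> x) \<otimes> g \<otimes> inv (h \<otimes> x) = h \<otimes> (x \<otimes> g \<otimes> inv x) \<otimes> inv h"
      using subgroup.mem_carrier[OF S h] x True by (simp add: inv_mult_group m_assoc)
    show ?thesis
      unfolding e using x True h subgroup.mem_carrier[OF S h] subgroup.m_inv_closed[OF S h]
      by (auto simp: extend_zero_def \<xi> subgroup_mult_iff[OF S])
  qed
  let ?f = "\<lambda>x. extend_zero H \<mu> (x \<otimes> g \<otimes> inv x)" and ?f' = "\<lambda>x. extend_zero K \<nu> (x \<otimes> g \<otimes> inv x)"
  have main: "of_nat (card (carrier G)) * (\<Sum>x\<in>carrier G. ?f x * ?f' x)
     = (\<Sum>x\<in>carrier G. ?f x) * (\<Sum>x\<in>carrier G. ?f' x)"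
    by (rule sum_product) (auto intro: inv1 H K \<mu> \<nu>)
  have sub: "H \<subseteq> carrier G" "K \<subseteq> carrier G" using H K subgroup.subset by auto
  have "of_nat (card (carrier G)) * (\<Sum>x\<in>carrier G. extend_zero H (\<lambda>_. 1) x * extend_zero K (\<lambda>_. 1) x)
     = (\<Sum>x\<in>carrier G. extend_zero H (\<lambda>_. 1) x) * (\<Sum>x\<in>carrier G. extend_zero K (\<lambda>_. 1) x)"
    by (rule sum_product) (auto simp: extend_zero_def subgroup_mult_iff H K)
  also have "(\<Sum>x\<in>carrier G. extend_zero H (\<lambda>_. 1) x * extend_zero K (\<lambda>_. 1) x)
      = of_nat (card (H \<inter> K))"
  proof -
    have "(\<Sum>x\<in>carrier G. extend_zero H (\<lambda>_. 1) x * extend_zero K (\<lambda>_. 1) x)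
        = (\<Sum>x\<in>H \<inter> K. 1)"
      using fin sub by (intro sum.mono_neutral_cong_right) (auto simp: extend_zero_def)
    then show ?thesis by simp
  qed
  also have "(\<Sum>x\<in>carrier G. extend_zero H (\<lambda>_. 1) x) = of_nat (card H)"
    using fin sub by (simp add: extend_zero_def sum.If_cases Int_absorb1)
  also have "(\<Sum>x\<in>carrier G. extend_zero K (\<lambda>_. 1) x) = of_nat (card K)"
    using fin sub by (simp add: extend_zero_def sum.If_cases Int_absorb1)
  finally have cards: "of_nat (card (carrier G)) * of_nat (card (H \<inter> K))
      = (of_nat (card H) * of_nat (card K) :: complex)" .
  have prod: "extend_zero (H \<inter> K) (\<lambda>y. \<mu> y * \<nu> y) y = extend_zero H \<mu> y * extend_zero K \<nu> y" for y
    by (simp add: extend_zero_def)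
  have pos: "card (carrier G) \<noteq> 0" "card H \<noteq> 0" "card K \<noteq> 0"
    using fin H K subgroup.finite_imp_card_positive by (auto simp: subgroup_def) 
  then have pos2: "(of_nat (card (H \<inter> K)) :: complex) \<noteq> 0"
    using cards by (metis mult_eq_0_iff of_nat_eq_0_iff)
  have "induced G H \<mu> g * induced G K \<nu> g
      = (\<Sum>x\<in>carrier G. ?f x) * (\<Sum>x\<in>carrier G. ?f' x) / (of_nat (card H) * of_nat (card K))"
    using True by (simp add: induced_eq)
  also have "\<dots> = (\<Sum>x\<in>carrier G. ?f x * ?f' x) / of_nat (card (H \<inter> K))"
    unfolding main[symmetric] cards[symmetric] using pos pos2 by simp
  finally show ?thesis
    using True by (simp add: induced_eq prod)
qed (simp add: induced_eq)

end

section \<open>The induced representation in block form\<close>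

lemma index_mult_mat_sum:
  assumes "A \<in> carrier_mat n m" "B \<in> carrier_mat m p" "i < n" "j < p"
  shows "(A * B) $$ (i, j) = (\<Sum>k<m. A $$ (i, k) * B $$ (k, j))"
  using assms by (auto simp: scalar_prod_def lessThan_atLeast0 intro!: sum.cong)

lemma index_mult_mat_vec_sum:
  assumes "A \<in> carrier_mat n m" "w \<in> carrier_vec m" "i < n"
  shows "(A *\<^sub>v w) $ i = (\<Sum>k<m. A $$ (i, k) * w $ k)"
  using assms by (auto simp: scalar_prod_def lessThan_atLeast0 intro!: sum.cong)

lemma sum_blocks:
  fixes f :: "nat \<Rightarrow> 'a :: comm_monoid_add"
  shows "(\<Sum>k<m * d. f k) = (\<Sum>i<m. \<Sum>a<d. f (i * d + a))"
proof (induction m)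
  case (Suc m)
  have split: "(\<Sum>k<N + e. f k) = (\<Sum>k<N. f k) + (\<Sum>a<e. f (N + a))" for N e
    by (induction e) (simp_all add: add.assoc)
  have "(\<Sum>k<Suc m * d. f k) = (\<Sum>k<m * d + d. f k)"
    by (simp add: add.commute)
  also note split
  finally show ?case
    using Suc by simp
qed simp

lemma block_index_less:
  assumes "i < m" "a < (d :: nat)"
  shows "i * d + a < m * d"
proof -
  have "i * d + a < Suc i * d" using assms by simp
  also have "\<dots> \<le> m * d" using assms by (intro mult_right_mono) auto
  finally show ?thesis .
qed

lemma block_indexE:
  assumes "k < m * (d :: nat)"
  obtains i a where "i < m" "a < d" "k = i * d + a"
proof (rule that[of "k div d" "k mod d"])
  have "d > 0" using assms by (cases d) auto
  then show "k mod d < d" by simp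
  show "k div d < m" using assms by (simp add: less_mult_imp_div_less)
qed simp

lemma eq_mat_by_action:
  fixes A B :: "complex mat"
  assumes A: "A \<in> carrier_mat n m" and B: "B \<in> carrier_mat n m"
    and eq: "\<And>u. u \<in> carrier_vec m \<Longrightarrow> A *\<^sub>v u = B *\<^sub>v u"
  shows "A = B"
proof (rule eq_matI)
  fix i j assume ij: "i < dim_row B" "j < dim_col B"
  have e: "(C *\<^sub>v unit_vec m j) $ i = C $$ (i, j)" if "C \<in> carrier_mat n m" for C :: "complex mat"
    using that ij B by (subst index_mult_mat_vec_sum[OF that]) (auto simp: unit_vec_def if_distrib cong: if_cong)
  show "A $$ (i, j) = B $$ (i, j)"
    using e[OF A] e[OF B] eq[of "unit_vec m j"] by simp
qed (use A B in auto)

context group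
begin

lemma character_of_conjugate:
  assumes \<rho>: "representation G d \<rho>" and h: "h \<in> carrier G" and y: "y \<in> carrier G"
  shows "character_of G d \<rho> (h \<otimes> y \<otimes> inv h) = character_of G d \<rho> y"
proof -
  note r = \<rho>[unfolded representation_iff]
  have swap: "(\<Sum>i<d. (\<rho> (a \<otimes> b)) $$ (i, i)) = (\<Sum>i<d. (\<rho> (b \<otimes> a)) $$ (i, i))"
    if "a \<in> carrier G" "b \<in> carrier G" for a b
  proof -
    have e: "(\<Sum>i<d. (\<rho> (a \<otimes> b)) $$ (i, i)) = (\<Sum>i<d. \<Sum>k<d. \<rho> a $$ (i, k) * \<rho> b $$ (k, i))"
      if "a \<in> carrier G" "b \<in> carrier G" for a b
      using r that by (intro sum.cong refl) (simp add: index_mult_mat_sum[of _ d d _ d])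
    show ?thesis
      unfolding e[OF that] e[OF that(2,1)] by (subst sum.swap) (simp add: mult.commute)
  qed
  have "inv h \<otimes> (h \<otimes> y) = y"
    using h y by (simp add: m_assoc[symmetric])
  then show ?thesis
    using swap[of "h \<otimes> y" "inv h"] h y by (simp add: character_of_def)
qed

text \<open>
  The trivial coset is represented by \<open>\<one>\<close> and comes first, so that the original module will be the
  leading block of the induced one.
\<close>

lemma transversal_exists:
  assumes H: "subgroup H G" and fin: "finite (carrier G)"
  obtains t :: "nat \<Rightarrow> 'a" and m where "m > 0" "t 0 = \<one>" "\<And>i. i < m \<Longrightarrow> t i \<in> carrier G"
    "\<And>x. x \<in> carrier G \<Longrightarrow> \<exists>!i. i < m \<and> x \<otimes> inv (t i) \<in> H"
proof -
  define r where "r x = (if x \<in> H then \<one> else (SOME y. y \<in> carrier G \<and> x \<otimes> inv y \<in> H))" for x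
  have one: "\<one> \<in> H" using H subgroup.one_closed by blast
  have r: "r x \<in> carrier G \<and> x \<otimes> inv (r x) \<in> H" if x: "x \<in> carrier G" for x
  proof (cases "x \<in> H")
    case False
    have "\<exists>y. y \<in> carrier G \<and> x \<otimes> inv y \<in> H"
      using x one by (intro exI[of _ x]) simp
    from someI_ex[OF this] show ?thesis using False by (simp add: r_def)
  qed (use x in \<open>simp add: r_def\<close>)
  have r_eq: "r x = r y" if x: "x \<in> carrier G" and y: "y \<in> carrier G" and xy: "x \<otimes> inv y \<in> H" for x y
  proof -
    have e: "x \<otimes> inv z = (x \<otimes> inv y) \<otimes> (y \<otimes> inv z)" if "z \<in> carrier G" for z
      using that x y by (simp add: m_assoc[symmetric]) (simp add: m_assoc)
    have "x \<otimes> inv z \<in> H \<longleftrightarrow> y \<otimes> inv z \<in> H" if "z \<in> carrier G" for z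
      using that x y xy e[OF that] subgroup_mult_iff(1)[OF H xy, of "y \<otimes> inv z"] by simp
    moreover from this[of \<one>] have "x \<in> H \<longleftrightarrow> y \<in> H" using x y by simp
    ultimately show ?thesis by (auto simp: r_def intro!: arg_cong[where f = Eps])
  qed
  have rr: "r (r x) = r x" if "x \<in> carrier G" for x
    using r_eq[of x "r x"] r[OF that] that by simp
  have "r \<one> = \<one>" using one by (simp add: r_def)
  define T where "T = r ` carrier G"
  have "\<one> \<in> T" using \<open>r \<one> = \<one>\<close> by (force simp: T_def)
  obtain xs where xs: "set xs = T - {\<one>}" "distinct xs"
    using finite_distinct_list[of "T - {\<one>}"] fin by (auto simp: T_def)
  define ys where "ys = \<one> # xs"
  have ys: "set ys = T" "distinct ys" using xs \<open>\<one> \<in> T\<close> by (auto simp: ys_def)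
  have ysG: "ys ! i \<in> carrier G" "r (ys ! i) = ys ! i" if "i < length ys" for i
    using nth_mem[OF that] r rr by (auto simp: ys T_def)
  show thesis
  proof (rule that[of "length ys" "\<lambda>i. ys ! i"])
    fix x assume x: "x \<in> carrier G"
    then have "r x \<in> set ys" by (simp add: ys T_def)
    then obtain i where i: "i < length ys" "ys ! i = r x" by (auto simp: in_set_conv_nth)
    show "\<exists>!i. i < length ys \<and> x \<otimes> inv (ys ! i) \<in> H"
    proof (rule ex1I[of _ i])
      show "i < length ys \<and> x \<otimes> inv (ys ! i) \<in> H" using i r[OF x] by simp
      fix j assume j: "j < length ys \<and> x \<otimes> inv (ys ! j) \<in> H"
      then have "r x = ys ! j" using r_eq[OF x] ysG by metis
      then show "j = i" using i j ys(2) nth_eq_iff_index_eq by metis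
    qed
  qed (use ysG in \<open>auto simp: ys_def\<close>)
qed

end

locale subgroup_of_finite_group = group G for G :: "('a, 'b) monoid_scheme" (structure) +
  fixes H :: "'a set"
  assumes fin: "finite (carrier G)" and H: "subgroup H G"
begin

abbreviation GH where "GH \<equiv> G\<lparr>carrier := H\<rparr>"

lemma GH_group: "group GH"
  using H by (simp add: subgroup_imp_group)

lemma HG: "h \<in> H \<Longrightarrow> h \<in> carrier G"
  using H subgroup.mem_carrier by metis

lemma inv_GH: "h \<in> H \<Longrightarrow> inv\<^bsub>GH\<^esub> h = inv h"
  using m_inv_consistent[OF H] by simp

lemma card_H: "card H > 0"
  by (rule subgroup.finite_imp_card_positive[OF H fin])

end

locale block_induction = subgroup_of_finite_group G H
  for G :: "('a, 'b) monoid_scheme" (structure) and H :: "'a set" +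
  fixes m :: nat and t :: "nat \<Rightarrow> 'a" and d :: nat and \<rho> :: "'a \<Rightarrow> complex mat"
  assumes m_pos: "m > 0" and t0: "t 0 = \<one>" and tG: "\<And>i. i < m \<Longrightarrow> t i \<in> carrier G"
    and cover: "\<And>x. x \<in> carrier G \<Longrightarrow> \<exists>!i. i < m \<and> x \<otimes> inv (t i) \<in> H"
    and rep: "representation (G\<lparr>carrier := H\<rparr>) d \<rho>"
begin

lemma rep_props:
  shows "\<And>h. h \<in> H \<Longrightarrow> \<rho> h \<in> carrier_mat d d"
    and "\<And>g h. g \<in> H \<Longrightarrow> h \<in> H \<Longrightarrow> \<rho> (g \<otimes> h) = \<rho> g * \<rho> h"
    and "\<rho> \<one> = 1\<^sub>m d"
  using rep group.representation_iff[OF GH_group] by auto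

definition entry :: "nat \<Rightarrow> nat \<Rightarrow> 'a \<Rightarrow> complex" where
  "entry a b = extend_zero H (\<lambda>h. \<rho> h $$ (a, b))"

text \<open>
  The \<open>d \<times> d\<close> block at \<open>(i, j)\<close> is \<open>\<rho> (t i \<otimes> g \<otimes> inv (t j))\<close>, or zero if the argument is outside \<open>H\<close>. This
  is right translation by \<open>g\<close> on the functions \<open>f\<close> on \<open>G\<close> with \<open>f (h \<otimes> x) = \<rho> h (f x)\<close>, where \<open>f\<close> is given
  by the list of its values at \<open>t 0, \<dots>, t (m - 1)\<close>.
\<close>

definition block_rep :: "'a \<Rightarrow> complex mat" where
  "block_rep g = mat (m * d) (m * d)
     (\<lambda>(k, l). entry (k mod d) (l mod d) (t (k div d) \<otimes> g \<otimes> inv (t (l div d))))"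

lemma block_rep_carrier [simp]: "block_rep g \<in> carrier_mat (m * d) (m * d)"
  by (simp add: block_rep_def)

lemma block_rep_index:
  assumes "i < m" "a < d" "j < m" "b < d"
  shows "block_rep g $$ (i * d + a, j * d + b) = entry a b (t i \<otimes> g \<otimes> inv (t j))"
  using assms by (simp add: block_rep_def block_index_less)

lemma block_rep_action:
  assumes "w \<in> carrier_vec (m * d)" "i < m" "a < d"
  shows "(block_rep g *\<^sub>v w) $ (i * d + a)
     = (\<Sum>j<m. \<Sum>b<d. entry a b (t i \<otimes> g \<otimes> inv (t j)) * w $ (j * d + b))"
  using assms
  by (subst index_mult_mat_vec_sum[OF block_rep_carrier])
    (simp_all add: block_index_less sum_blocks block_rep_index)

lemma coset_unique:
  assumes "i < m" "j < m" "t i \<otimes> inv (t j) \<in> H"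
  shows "i = j"
proof -
  have "t i \<otimes> inv (t i) \<in> H"
    using tG[OF assms(1)] H subgroup.one_closed by (metis r_inv)
  then show ?thesis
    using cover[OF tG[OF assms(1)]] assms by metis
qed

lemma entry_one:
  assumes "a < d" "b < d"
  shows "entry a b \<one> = (if a = b then 1 else 0)"
  using assms H subgroup.one_closed[OF H] by (simp add: entry_def extend_zero_def rep_props)

lemma entry_transversal:
  assumes "i < m" "j < m" "a < d" "b < d"
  shows "entry a b (t i \<otimes> inv (t j)) = (if i = j \<and> a = b then 1 else 0)"
proof (cases "i = j")
  case True
  then show ?thesis using assms tG by (simp add: entry_one)
next
  case False
  then have "t i \<otimes> inv (t j) \<notin> H" using coset_unique assms by blast
  then show ?thesis using False by (simp add: entry_def extend_zero_def)
qed

lemma entry_mult: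
  assumes "x \<in> H" "y \<in> carrier G" "a < d" "b < d"
  shows "entry a b (x \<otimes> y) = (\<Sum>c<d. entry a c x * entry c b y)"
proof (cases "y \<in> H")
  case True
  then have "x \<otimes> y \<in> H" using assms subgroup.m_closed[OF H] by blast
  with True assms show ?thesis
    by (simp add: entry_def extend_zero_def rep_props index_mult_mat_sum[of _ d d _ d])
next
  case False
  then show ?thesis
    using assms by (simp add: entry_def extend_zero_def subgroup_mult_iff[OF H])
qed

text \<open>
  Multiplicativity of the block matrices in terms of coefficients: of the \<open>m\<close> middle indices exactly
  one contributes, the one whose coset contains \<open>x\<close>.
\<close>

lemma entry_sum_transversal:
  assumes x: "x \<in> carrier G" and z: "z \<in> carrier G" and ab: "a < d" "b < d"
  shows "(\<Sum>j<m. \<Sum>c<d. entry a c (x \<otimes> inv (t j)) * entry c b (t j \<otimes> z)) = entry a b (x \<otimes> z)"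
proof -
  obtain j where j: "j < m" "x \<otimes> inv (t j) \<in> H"
    and uniq: "\<And>i. i < m \<Longrightarrow> x \<otimes> inv (t i) \<in> H \<Longrightarrow> i = j"
    using cover[OF x] by metis
  have "entry a c (x \<otimes> inv (t i)) = 0" if "i \<in> {..<m} - {j}" for i c
    using uniq[of i] that by (auto simp: entry_def extend_zero_def)
  then have "(\<Sum>i<m. \<Sum>c<d. entry a c (x \<otimes> inv (t i)) * entry c b (t i \<otimes> z))
      = (\<Sum>i\<in>{j}. \<Sum>c<d. entry a c (x \<otimes> inv (t i)) * entry c b (t i \<otimes> z))"
    using j by (intro sum.mono_neutral_right) simp_all
  also have "\<dots> = entry a b (x \<otimes> inv (t j) \<otimes> (t j \<otimes> z))"
    using j x z tG ab by (simp add: entry_mult)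
  also have "x \<otimes> inv (t j) \<otimes> (t j \<otimes> z) = x \<otimes> z"
    using j x z tG by (simp add: m_assoc) (simp add: m_assoc[symmetric])
  finally show ?thesis .
qed

lemma block_rep_representation: "representation G (m * d) block_rep"
  unfolding representation_iff
proof (intro conjI ballI)
  fix g h assume g: "g \<in> carrier G" and h: "h \<in> carrier G"
  show "block_rep (g \<otimes> h) = block_rep g * block_rep h"
  proof (rule eq_matI)
    fix k l assume "k < dim_row (block_rep g * block_rep h)" "l < dim_col (block_rep g * block_rep h)"
    then have kl: "k < m * d" "l < m * d" by (auto simp: block_rep_def)
    obtain i a where i: "i < m" "a < d" "k = i * d + a" using kl by (elim block_indexE)
    obtain j b where j: "j < m" "b < d" "l = j * d + b" using kl by (elim block_indexE)
    have "(block_rep g * block_rep h) $$ (k, l)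
       = (\<Sum>i'<m. \<Sum>c<d. entry a c ((t i \<otimes> g) \<otimes> inv (t i')) * entry c b (t i' \<otimes> (h \<otimes> inv (t j))))"
      using kl i j g h tG
      by (subst index_mult_mat_sum[OF block_rep_carrier block_rep_carrier])
        (simp_all add: sum_blocks block_rep_index m_assoc)
    also have "\<dots> = entry a b (t i \<otimes> g \<otimes> (h \<otimes> inv (t j)))"
      using i j g h tG by (intro entry_sum_transversal) auto
    also have "\<dots> = block_rep (g \<otimes> h) $$ (k, l)"
      using i j g h tG by (simp add: block_rep_index m_assoc)
    finally show "block_rep (g \<otimes> h) $$ (k, l) = (block_rep g * block_rep h) $$ (k, l)" ..
  qed (simp_all add: block_rep_def)
next
  show "block_rep \<one> = 1\<^sub>m (m * d)"
  proof (rule eq_matI)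
    fix k l assume "k < dim_row (1\<^sub>m (m * d) :: complex mat)" "l < dim_col (1\<^sub>m (m * d) :: complex mat)"
    then have kl: "k < m * d" "l < m * d" by auto
    obtain i a where i: "i < m" "a < d" "k = i * d + a" using kl by (elim block_indexE)
    obtain j b where j: "j < m" "b < d" "l = j * d + b" using kl by (elim block_indexE)
    have "i * d + a = j * d + b \<longleftrightarrow> i = j \<and> a = b"
    proof
      assume e: "i * d + a = j * d + b"
      have "i = (i * d + a) div d" "j = (j * d + b) div d" using i j by auto
      with e show "i = j \<and> a = b" by simp
    qed simp
    then show "block_rep \<one> $$ (k, l) = 1\<^sub>m (m * d) $$ (k, l)"
      using i j kl tG by (simp add: block_rep_index entry_transversal)
  qed (simp_all add: block_rep_def)
qed simp

text \<open>
  The trace collects one value per coset, while the formula for induced class functions runs over all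
  of \<open>G\<close>. The character of \<open>\<rho>\<close> is a class function, so each coset contributes \<open>card H\<close> equal terms there.
\<close>

lemma character_of_block_rep:
  "character_of G (m * d) block_rep = induced G H (character_of GH d \<rho>)"
proof
  fix g
  let ?\<chi> = "extend_zero H (character_of GH d \<rho>)"
  show "character_of G (m * d) block_rep g = induced G H (character_of GH d \<rho>) g"
  proof (cases "g \<in> carrier G")
    case True
    have tr: "(\<Sum>a<d. entry a a y) = ?\<chi> y" for y
      by (simp add: entry_def extend_zero_def character_of_def)
    have conj: "?\<chi> ((h \<otimes> x) \<otimes> g \<otimes> inv (h \<otimes> x)) = ?\<chi> (x \<otimes> g \<otimes> inv x)"
      if h: "h \<in> H" and x: "x \<in> carrier G" for h x
    proof -
      let ?y = "x \<otimes> g \<otimes> inv x"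
      have e: "(h \<otimes> x) \<otimes> g \<otimes> inv (h \<otimes> x) = h \<otimes> ?y \<otimes> inv h"
        using HG[OF h] x True by (simp add: inv_mult_group m_assoc)
      have "character_of GH d \<rho> (h \<otimes> ?y \<otimes> inv h) = character_of GH d \<rho> ?y" if "?y \<in> H"
        using group.character_of_conjugate[OF GH_group rep, of h ?y] h that
        by (simp add: inv_GH)
      then show ?thesis
        unfolding e using x True h HG[OF h] subgroup.m_inv_closed[OF H h]
        by (auto simp: extend_zero_def subgroup_mult_iff[OF H])
    qed
    have "(\<Sum>x\<in>carrier G. ?\<chi> (x \<otimes> g \<otimes> inv x))
        = (\<Sum>h\<in>H. \<Sum>i<m. ?\<chi> ((h \<otimes> t i) \<otimes> g \<otimes> inv (h \<otimes> t i)))"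
      using tG cover by (intro sum_over_transversal[OF H]) auto
    also have "\<dots> = of_nat (card H) * (\<Sum>i<m. ?\<chi> (t i \<otimes> g \<otimes> inv (t i)))"
      using tG by (simp add: conj)
    finally have 1: "(\<Sum>x\<in>carrier G. ?\<chi> (x \<otimes> g \<otimes> inv x))
        = of_nat (card H) * (\<Sum>i<m. ?\<chi> (t i \<otimes> g \<otimes> inv (t i)))" .
    have "induced G H (character_of GH d \<rho>) g = (\<Sum>i<m. ?\<chi> (t i \<otimes> g \<otimes> inv (t i)))"
      using True card_H by (simp add: induced_eq 1)
    also have "\<dots> = character_of G (m * d) block_rep g"
      using True by (simp add: character_of_def sum_blocks block_rep_index tr)
    finally show ?thesis ..
  qed (simp add: character_of_def induced_eq)
qed

end

section \<open>A criterion for irreducible induction\<close>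

text \<open>
  The subgroup \<open>V\<close> need not be normal in \<open>G\<close>. The last assumption is the hypothesis of Mackey's criterion:
  for \<open>g\<close> outside \<open>H\<close> the character \<open>lam\<close> and its conjugate by \<open>g\<close> disagree somewhere on the part of \<open>V\<close>
  where both are defined. So \<open>H\<close> plays the role of the stabiliser of \<open>lam\<close> in Clifford theory.
\<close>

locale separated_linear_character = subgroup_of_finite_group G H
  for G :: "('a, 'b) monoid_scheme" (structure) and H :: "'a set" +
  fixes V :: "'a set" and lam :: "'a \<Rightarrow> complex"
  assumes V: "subgroup V G" and VH: "V \<subseteq> H"
    and lam_mult: "\<And>u v. u \<in> V \<Longrightarrow> v \<in> V \<Longrightarrow> lam (u \<otimes> v) = lam u * lam v"
    and lam_nonzero: "\<And>v. v \<in> V \<Longrightarrow> lam v \<noteq> 0"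
    and V_normal: "\<And>h v. h \<in> H \<Longrightarrow> v \<in> V \<Longrightarrow> h \<otimes> v \<otimes> inv h \<in> V"
    and lam_invariant: "\<And>h v. h \<in> H \<Longrightarrow> v \<in> V \<Longrightarrow> lam (h \<otimes> v \<otimes> inv h) = lam v"
    and separated: "\<And>g. g \<in> carrier G \<Longrightarrow> g \<notin> H \<Longrightarrow>
      \<exists>v\<in>V. g \<otimes> v \<otimes> inv g \<in> V \<and> lam (g \<otimes> v \<otimes> inv g) \<noteq> lam v"
begin

lemma VG: "v \<in> V \<Longrightarrow> v \<in> carrier G"
  using V subgroup.mem_carrier by metis

lemma finite_V: "finite V" and card_V: "card V > 0"
  using finite_subset[OF subgroup.subset[OF V] fin] subgroup.finite_imp_card_positive[OF V fin] by auto

lemma lam_one: "lam \<one> = 1"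
  using lam_mult[of \<one> \<one>] lam_nonzero[of \<one>] subgroup.one_closed[OF V] by simp

lemma sum_V_conjugate:
  assumes h: "h \<in> H"
  shows "(\<Sum>v\<in>V. f (h \<otimes> v \<otimes> inv h)) = (\<Sum>v\<in>V. f v)"
proof (rule sum.reindex_bij_witness[of _ "\<lambda>v. inv h \<otimes> v \<otimes> h" "\<lambda>v. h \<otimes> v \<otimes> inv h"])
  have hG: "h \<in> carrier G" and ih: "inv h \<in> H"
    using h HG subgroup.m_inv_closed[OF H] by auto
  show "inv h \<otimes> (h \<otimes> v \<otimes> inv h) \<otimes> h = v" "h \<otimes> (inv h \<otimes> v \<otimes> h) \<otimes> inv h = v" if "v \<in> V" for v
  proof -
    have "inv h \<otimes> (h \<otimes> v \<otimes> inv h) \<otimes> h = (inv h \<otimes> h) \<otimes> v \<otimes> (inv h \<otimes> h)"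
      "h \<otimes> (inv h \<otimes> v \<otimes> h) \<otimes> inv h = (h \<otimes> inv h) \<otimes> v \<otimes> (h \<otimes> inv h)"
      using hG VG[OF that] by (simp_all only: m_assoc inv_closed m_closed)
    then show "inv h \<otimes> (h \<otimes> v \<otimes> inv h) \<otimes> h = v" "h \<otimes> (inv h \<otimes> v \<otimes> h) \<otimes> inv h = v"
      using hG VG[OF that] by simp_all
  qed
  show "h \<otimes> v \<otimes> inv h \<in> V" "inv h \<otimes> v \<otimes> h \<in> V" if "v \<in> V" for v
    using V_normal[OF h that] V_normal[OF ih that] hG by simp_all
qed simp

text \<open>
  The projection onto the \<open>lam\<close>-part for \<open>V\<close> annihilates whatever is supported on a coset other than
  \<open>H\<close>. Replacing \<open>v\<close> by \<open>u \<otimes> v\<close>, where \<open>u\<close> separates \<open>lam\<close> from its conjugate by \<open>x\<close>, multiplies the sum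
  by \<open>lam (x \<otimes> u \<otimes> inv x) / lam u \<noteq> 1\<close>, but does not change it. The lemma is stated for scalar functions
  in order to apply to matrix coefficients as well as to characters.
\<close>

lemma twisted_sum_outside:
  assumes F: "\<And>z y. z \<in> V \<Longrightarrow> y \<in> H \<Longrightarrow> F (z \<otimes> y) = lam z * F y"
    and x: "x \<in> carrier G" "x \<notin> H" and w: "w \<in> carrier G"
  shows "(\<Sum>v\<in>V. inverse (lam v) * extend_zero H F (x \<otimes> v \<otimes> w)) = 0" (is "?S = 0")
proof -
  obtain u where u: "u \<in> V" "x \<otimes> u \<otimes> inv x \<in> V" "lam (x \<otimes> u \<otimes> inv x) \<noteq> lam u"
    using separated[OF x] by blast
  let ?z = "x \<otimes> u \<otimes> inv x"
  have "?S = (\<Sum>v\<in>V. inverse (lam (u \<otimes> v)) * extend_zero H F (x \<otimes> (u \<otimes> v) \<otimes> w))"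
    by (rule sum_left_translate[OF V u(1), symmetric])
  also have "\<dots> = (\<Sum>v\<in>V. (inverse (lam u) * lam ?z) * (inverse (lam v) * extend_zero H F (x \<otimes> v \<otimes> w)))"
  proof (rule sum.cong[OF refl])
    fix v assume v: "v \<in> V"
    have xvw: "x \<otimes> v \<otimes> w \<in> carrier G" and zH: "?z \<in> H" using x w VG[OF v] u VH by auto
    have "inv x \<otimes> (x \<otimes> (v \<otimes> w)) = v \<otimes> w"
      using x w VG[OF v] by (simp add: m_assoc[symmetric])
    then have e: "x \<otimes> (u \<otimes> v) \<otimes> w = ?z \<otimes> (x \<otimes> v \<otimes> w)"
      using x w VG[OF v] VG[OF u(1)] by (simp add: m_assoc)
    have "extend_zero H F (x \<otimes> (u \<otimes> v) \<otimes> w) = lam ?z * extend_zero H F (x \<otimes> v \<otimes> w)"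
      unfolding e using F[OF u(2)] by (simp add: extend_zero_def subgroup_mult_iff[OF H zH xvw])
    then show "inverse (lam (u \<otimes> v)) * extend_zero H F (x \<otimes> (u \<otimes> v) \<otimes> w)
        = (inverse (lam u) * lam ?z) * (inverse (lam v) * extend_zero H F (x \<otimes> v \<otimes> w))"
      using lam_mult[OF u(1) v] by simp
  qed
  also have "\<dots> = (inverse (lam u) * lam ?z) * ?S"
    by (simp add: sum_distrib_left)
  finally have "?S * (1 - inverse (lam u) * lam ?z) = 0"
    by (simp add: algebra_simps)
  moreover have "inverse (lam u) * lam ?z \<noteq> 1"
    using u(3) lam_nonzero[OF u(1)] by (simp add: field_simps)
  ultimately show ?thesis by simp
qed

text \<open>
  On the coset \<open>H\<close> itself the projection acts as the identity, since \<open>lam\<close> is invariant there.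
\<close>

lemma twisted_sum_inside:
  assumes F: "\<And>z y. z \<in> V \<Longrightarrow> y \<in> H \<Longrightarrow> F (z \<otimes> y) = lam z * F y"
    and x: "x \<in> H" and w: "w \<in> carrier G"
  shows "(\<Sum>v\<in>V. inverse (lam v) * extend_zero H F (x \<otimes> v \<otimes> w))
    = of_nat (card V) * extend_zero H F (x \<otimes> w)"
proof -
  have "inverse (lam v) * extend_zero H F (x \<otimes> v \<otimes> w) = extend_zero H F (x \<otimes> w)" if v: "v \<in> V" for v
  proof -
    let ?z = "x \<otimes> v \<otimes> inv x"
    have xw: "x \<otimes> w \<in> carrier G" and z: "?z \<in> V" and zH: "?z \<in> H"
      using HG[OF x] w V_normal[OF x v] VH by auto
    have "inv x \<otimes> (x \<otimes> w) = w"
      using HG[OF x] w by (simp add: m_assoc[symmetric])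
    then have e: "x \<otimes> v \<otimes> w = ?z \<otimes> (x \<otimes> w)"
      using HG[OF x] w VG[OF v] by (simp add: m_assoc)
    have "extend_zero H F (x \<otimes> v \<otimes> w) = lam ?z * extend_zero H F (x \<otimes> w)"
      unfolding e using F[OF z] by (simp add: extend_zero_def subgroup_mult_iff[OF H zH xw])
    then show ?thesis
      using lam_invariant[OF x v] lam_nonzero[OF v] by simp
  qed
  then show ?thesis by simp
qed

text \<open>
  The sum \<open>P\<close> of the matrices \<open>\<rho> v / lam v\<close> commutes with \<open>\<rho>\<close>, because \<open>H\<close> normalises \<open>V\<close> and fixes \<open>lam\<close>. So
  its range is invariant, and irreducibility leaves two cases. If the range is zero, the trace of \<open>P\<close>
  vanishes. If it is everything, \<open>V\<close> acts by \<open>lam\<close>, since it does so on the range of \<open>P\<close>.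
\<close>

lemma irreducible_scalar_or_orthogonal:
  assumes irr: "irreducible_representation GH d \<rho>"
  shows "(\<forall>v\<in>V. \<rho> v = lam v \<cdot>\<^sub>m 1\<^sub>m d) \<or>
     (\<Sum>v\<in>V. inverse (lam v) * character_of GH d \<rho> v) = 0"
proof -
  have rep: "representation GH d \<rho>" and d: "d > 0"
    using irr by (auto simp: irreducible_representation_def)
  have \<rho>c: "\<rho> h \<in> carrier_mat d d" if "h \<in> H" for h
    using rep that by (simp add: group.representation_iff[OF GH_group])
  have \<rho>m: "\<rho> (g \<otimes> h) = \<rho> g * \<rho> h" if "g \<in> H" "h \<in> H" for g h
    using rep that by (simp add: group.representation_iff[OF GH_group])
  have vH: "v \<in> H" if "v \<in> V" for v using that VH by blast
  define P where "P = mat d d (\<lambda>(a, b). \<Sum>v\<in>V. inverse (lam v) * \<rho> v $$ (a, b))"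
  have Pc: "P \<in> carrier_mat d d" by (simp add: P_def)
  have left: "(\<rho> h * P) $$ (a, b) = (\<Sum>v\<in>V. inverse (lam v) * \<rho> (h \<otimes> v) $$ (a, b))"
    if h: "h \<in> H" and ab: "a < d" "b < d" for h a b
  proof -
    have "(\<rho> h * P) $$ (a, b) = (\<Sum>k<d. \<Sum>v\<in>V. \<rho> h $$ (a, k) * (inverse (lam v) * \<rho> v $$ (k, b)))"
      using ab by (subst index_mult_mat_sum[OF \<rho>c[OF h] Pc]) (simp_all add: P_def sum_distrib_left)
    also have "\<dots> = (\<Sum>v\<in>V. \<Sum>k<d. \<rho> h $$ (a, k) * (inverse (lam v) * \<rho> v $$ (k, b)))"
      by (rule sum.swap)
    also have "\<dots> = (\<Sum>v\<in>V. inverse (lam v) * \<rho> (h \<otimes> v) $$ (a, b))"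
      using ab h vH \<rho>c
      by (intro sum.cong refl)
        (simp add: \<rho>m index_mult_mat_sum[of _ d d _ d] sum_distrib_left mult.left_commute)
    finally show ?thesis .
  qed
  have right: "(P * \<rho> h) $$ (a, b) = (\<Sum>v\<in>V. inverse (lam v) * \<rho> (v \<otimes> h) $$ (a, b))"
    if h: "h \<in> H" and ab: "a < d" "b < d" for h a b
  proof -
    have "(P * \<rho> h) $$ (a, b) = (\<Sum>k<d. \<Sum>v\<in>V. inverse (lam v) * \<rho> v $$ (a, k) * \<rho> h $$ (k, b))"
      using ab by (subst index_mult_mat_sum[OF Pc \<rho>c[OF h]]) (simp_all add: P_def sum_distrib_right)
    also have "\<dots> = (\<Sum>v\<in>V. \<Sum>k<d. inverse (lam v) * \<rho> v $$ (a, k) * \<rho> h $$ (k, b))"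
      by (rule sum.swap)
    also have "\<dots> = (\<Sum>v\<in>V. inverse (lam v) * \<rho> (v \<otimes> h) $$ (a, b))"
      using ab h vH \<rho>c
      by (intro sum.cong refl)
        (simp add: \<rho>m index_mult_mat_sum[of _ d d _ d] sum_distrib_left mult.assoc)
    finally show ?thesis .
  qed
  have commute: "\<rho> h * P = P * \<rho> h" if h: "h \<in> H" for h
  proof (rule eq_matI)
    fix a b assume "a < dim_row (P * \<rho> h)" "b < dim_col (P * \<rho> h)"
    then have ab: "a < d" "b < d" using Pc \<rho>c[OF h] by auto
    have "(\<Sum>v\<in>V. inverse (lam v) * \<rho> (v \<otimes> h) $$ (a, b))
        = (\<Sum>v\<in>V. inverse (lam (h \<otimes> v \<otimes> inv h)) * \<rho> (h \<otimes> v \<otimes> inv h \<otimes> h) $$ (a, b))"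
      by (rule sum_V_conjugate[OF h, symmetric])
    also have "\<dots> = (\<Sum>v\<in>V. inverse (lam v) * \<rho> (h \<otimes> v) $$ (a, b))"
    proof (rule sum.cong[OF refl])
      fix v assume v: "v \<in> V"
      have "h \<otimes> v \<otimes> inv h \<otimes> h = h \<otimes> v"
        using HG[OF h] VG[OF v] by (simp add: m_assoc)
      then show "inverse (lam (h \<otimes> v \<otimes> inv h)) * \<rho> (h \<otimes> v \<otimes> inv h \<otimes> h) $$ (a, b)
          = inverse (lam v) * \<rho> (h \<otimes> v) $$ (a, b)"
        by (simp add: lam_invariant[OF h v])
    qed
    finally show "(\<rho> h * P) $$ (a, b) = (P * \<rho> h) $$ (a, b)"
      using h ab by (simp add: left right)
  qed (use Pc \<rho>c[OF h] in auto)
  have eigen: "\<rho> u * P = lam u \<cdot>\<^sub>m P" if u: "u \<in> V" for u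
  proof (rule eq_matI)
    fix a b assume "a < dim_row (lam u \<cdot>\<^sub>m P)" "b < dim_col (lam u \<cdot>\<^sub>m P)"
    then have ab: "a < d" "b < d" using Pc by auto
    have "(\<rho> u * P) $$ (a, b) = (\<Sum>v\<in>V. inverse (lam v) * \<rho> (u \<otimes> v) $$ (a, b))"
      using u vH ab by (simp add: left)
    also have "\<dots> = (\<Sum>v\<in>V. lam u * inverse (lam (u \<otimes> v)) * \<rho> (u \<otimes> v) $$ (a, b))"
      using u lam_nonzero[OF u] by (intro sum.cong refl) (simp add: lam_mult)
    also have "\<dots> = (\<Sum>v\<in>V. lam u * inverse (lam v) * \<rho> v $$ (a, b))"
      by (rule sum_left_translate[OF V u])
    also have "\<dots> = (lam u \<cdot>\<^sub>m P) $$ (a, b)"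
      using ab by (simp add: P_def sum_distrib_left mult.assoc)
    finally show "(\<rho> u * P) $$ (a, b) = (lam u \<cdot>\<^sub>m P) $$ (a, b)" .
  qed (use Pc \<rho>c[OF vH[OF u]] in auto)
  define W where "W = {P *\<^sub>v u | u. u \<in> carrier_vec d}"
  have "VectorSpace.subspace class_ring W (module_vec TYPE(complex) d)"
    unfolding subspace_module_vec_iff
  proof (intro conjI ballI allI)
    show "W \<subseteq> carrier_vec d" using Pc by (auto simp: W_def)
    have "P *\<^sub>v 0\<^sub>v d = 0\<^sub>v d" using Pc by auto
    then show "0\<^sub>v d \<in> W" unfolding W_def mem_Collect_eq by (metis zero_carrier_vec)
    show "v + w \<in> W" if vw: "v \<in> W" "w \<in> W" for v w
    proof -
      obtain v' w' where "v = P *\<^sub>v v'" "w = P *\<^sub>v w'" "v' \<in> carrier_vec d" "w' \<in> carrier_vec d"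
        using vw by (auto simp: W_def)
      then have "v + w = P *\<^sub>v (v' + w')" "v' + w' \<in> carrier_vec d"
        using Pc by (auto simp: mult_add_distrib_mat_vec)
      then show ?thesis unfolding W_def by blast
    qed
    show "c \<cdot>\<^sub>v w \<in> W" if w: "w \<in> W" for c w
    proof -
      obtain w' where "w = P *\<^sub>v w'" "w' \<in> carrier_vec d"
        using w by (auto simp: W_def)
      then have "c \<cdot>\<^sub>v w = P *\<^sub>v (c \<cdot>\<^sub>v w')" "c \<cdot>\<^sub>v w' \<in> carrier_vec d"
        using Pc by (auto simp: mult_mat_vec)
      then show ?thesis unfolding W_def by blast
    qed
  qed
  moreover have "\<rho> h *\<^sub>v w \<in> W" if h: "h \<in> H" and w: "w \<in> W" for h w
  proof -
    obtain u where u: "u \<in> carrier_vec d" "w = P *\<^sub>v u"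
      using w by (auto simp: W_def)
    have "\<rho> h *\<^sub>v w = (\<rho> h * P) *\<^sub>v u"
      using u \<rho>c[OF h] Pc by (simp add: assoc_mult_mat_vec)
    also have "\<dots> = P *\<^sub>v (\<rho> h *\<^sub>v u)"
      unfolding commute[OF h] using u \<rho>c[OF h] Pc by (simp add: assoc_mult_mat_vec)
    finally show ?thesis
      using u \<rho>c[OF h] unfolding W_def by (auto intro: mult_mat_vec_carrier)
  qed
  ultimately have "W = {0\<^sub>v d} \<or> W = carrier_vec d"
    using irr unfolding irreducible_representation_def by simp
  then show ?thesis
  proof
    assume W: "W = {0\<^sub>v d}"
    have "P = 0\<^sub>m d d"
    proof (rule eq_mat_by_action[OF Pc])
      fix u :: "complex vec" assume u: "u \<in> carrier_vec d"
      then have "P *\<^sub>v u \<in> W" by (auto simp: W_def)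
      then show "P *\<^sub>v u = 0\<^sub>m d d *\<^sub>v u" using W u by auto
    qed simp
    then have "(\<Sum>a<d. P $$ (a, a)) = 0" by simp
    moreover have "(\<Sum>a<d. P $$ (a, a)) = (\<Sum>v\<in>V. inverse (lam v) * character_of GH d \<rho> v)"
      using vH by (simp add: P_def sum.swap[of _ "{..<d}"] character_of_def sum_distrib_left)
    ultimately show ?thesis by simp
  next
    assume W: "W = carrier_vec d"
    have smult_act: "(c \<cdot>\<^sub>m A) *\<^sub>v u = c \<cdot>\<^sub>v (A *\<^sub>v u)"
      if "A \<in> carrier_mat d d" "u \<in> carrier_vec d" for c :: complex and A u
      using that by (intro eq_vecI) (auto simp: smult_scalar_prod_distrib[of _ d])
    have "\<rho> v = lam v \<cdot>\<^sub>m 1\<^sub>m d" if v: "v \<in> V" for v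
    proof (rule eq_mat_by_action)
      fix w :: "complex vec" assume w: "w \<in> carrier_vec d"
      then obtain u where u: "u \<in> carrier_vec d" "w = P *\<^sub>v u"
        using W by (auto simp: W_def)
      have "\<rho> v *\<^sub>v w = (\<rho> v * P) *\<^sub>v u"
        using u \<rho>c[OF vH[OF v]] Pc by (simp add: assoc_mult_mat_vec)
      also have "\<dots> = lam v \<cdot>\<^sub>v w"
        using u Pc by (simp add: eigen[OF v] smult_act)
      also have "\<dots> = (lam v \<cdot>\<^sub>m 1\<^sub>m d) *\<^sub>v w"
        using w by (simp add: smult_act)
      finally show "\<rho> v *\<^sub>v w = (lam v \<cdot>\<^sub>m 1\<^sub>m d) *\<^sub>v w" .
    qed (use \<rho>c[OF vH[OF v]] in auto)
    then show ?thesis by blast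
  qed
qed

text \<open>
  A constituent in the second case of the previous dichotomy has to be excluded. The
  functional \<open>c\<close> takes the value \<open>card V * d\<close> or \<open>0\<close> on an irreducible character of degree \<open>d\<close>, whereas on
  the induced character it takes the value \<open>card V\<close> times the degree. Comparing the two totals over
  all constituents, none of them can have the value \<open>0\<close>.
\<close>

lemma Irr_over_acts_by_scalars:
  assumes "\<chi> \<in> Irr_over GH V lam"
  obtains d \<rho> where "irreducible_representation GH d \<rho>" "\<chi> = character_of GH d \<rho>"
    "\<And>v. v \<in> V \<Longrightarrow> \<rho> v = lam v \<cdot>\<^sub>m 1\<^sub>m d"
proof -
  obtain M where M: "set_mset M \<subseteq> Irr GH" "induced GH V lam = (\<lambda>g. \<Sum>\<eta>\<in>#M. \<eta> g)" "\<chi> \<in># M"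
    using assms by (auto simp: Irr_over_def Irr_constituents_def)
  define c where "c \<eta> = (\<Sum>v\<in>V. inverse (lam v) * \<eta> v)" for \<eta>
  have one: "\<one> \<in> H" "\<one> \<in> V" using H V subgroup.one_closed by auto
  have scalar: "c (character_of GH d \<rho>) = of_nat (card V) * of_nat d"
    if "\<forall>v\<in>V. \<rho> v = lam v \<cdot>\<^sub>m 1\<^sub>m d" for d \<rho>
  proof -
    have "inverse (lam v) * character_of GH d \<rho> v = of_nat d" if "v \<in> V" for v
      using \<open>\<forall>v\<in>V. \<rho> v = lam v \<cdot>\<^sub>m 1\<^sub>m d\<close> that VH lam_nonzero[OF that]
      by (auto simp: character_of_def)
    then show ?thesis by (simp add: c_def)
  qed
  have deg: "character_of GH d \<rho> \<one> = of_nat d" if "irreducible_representation GH d \<rho>" for d \<rho>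
    using that one group.representation_iff[OF GH_group]
    by (simp add: character_of_def irreducible_representation_def)
  have le: "Re (c \<eta>) \<le> Re (of_nat (card V) * \<eta> \<one>)" if \<eta>: "\<eta> \<in> Irr GH" for \<eta>
  proof -
    obtain d \<rho> where r: "irreducible_representation GH d \<rho>" "\<eta> = character_of GH d \<rho>"
      using \<eta> by (auto simp: Irr_def)
    have "c \<eta> = of_nat (card V) * of_nat d \<or> c \<eta> = 0"
      using irreducible_scalar_or_orthogonal[OF r(1)] scalar[of \<rho> d]
      unfolding r(2) c_def by blast
    then show ?thesis
      using deg[OF r(1)] by (auto simp: r(2))
  qed
  have conj: "induced GH V lam u = of_nat (card H) / of_nat (card V) * lam u" if u: "u \<in> V" for u
  proof -
    have "(\<Sum>x\<in>H. extend_zero V lam (x \<otimes> u \<otimes> inv x)) = of_nat (card H) * lam u"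
      using u by (simp add: extend_zero_def V_normal lam_invariant)
    then show ?thesis
      using u VH by (simp add: induced_restrict_carrier[OF H] subsetD)
  qed
  have "(\<Sum>\<eta>\<in>#M. c \<eta>) = c (\<lambda>g. \<Sum>\<eta>\<in>#M. \<eta> g)"
    unfolding c_def by (induction M) (simp_all add: sum.distrib distrib_left)
  also have "\<dots> = of_nat (card H)"
  proof -
    have "inverse (lam v) * induced GH V lam v = of_nat (card H) / of_nat (card V)" if "v \<in> V" for v
      using lam_nonzero[OF that] by (simp add: conj[OF that])
    then show ?thesis
      unfolding M(2)[symmetric] c_def using card_V by simp
  qed
  also have "\<dots> = of_nat (card V) * (\<Sum>\<eta>\<in>#M. \<eta> \<one>)"
    using fun_cong[OF M(2), of \<one>] conj[OF one(2)] card_V by (simp add: lam_one field_simps)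
  finally have total: "(\<Sum>\<eta>\<in>#M. c \<eta>) = (\<Sum>\<eta>\<in>#M. of_nat (card V) * \<eta> \<one>)"
    by (simp add: sum_mset_distrib_left image_mset.compositionality comp_def)
  obtain N where N: "M = add_mset \<chi> N" using M(3) by (meson multi_member_split)
  have "Re (\<Sum>\<eta>\<in>#N. c \<eta>) \<le> Re (\<Sum>\<eta>\<in>#N. of_nat (card V) * \<eta> \<one>)"
    using M(1) unfolding N by (induction N) (use le in \<open>auto intro!: add_mono\<close>)
  with total have ge: "Re (c \<chi>) \<ge> Re (of_nat (card V) * \<chi> \<one>)"
    unfolding N by (simp add: complex_eq_iff)
  obtain d \<rho> where r: "irreducible_representation GH d \<rho>" "\<chi> = character_of GH d \<rho>"
    using M by (auto simp: Irr_def)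
  have "d > 0" using r by (simp add: irreducible_representation_def)
  then have "real (card V) * real d > 0" using card_V by simp
  then have "c \<chi> \<noteq> 0"
    using ge deg[OF r(1)] r(2) by auto
  then have "\<forall>v\<in>V. \<rho> v = lam v \<cdot>\<^sub>m 1\<^sub>m d"
    using irreducible_scalar_or_orthogonal[OF r(1)] r(2) by (auto simp: c_def)
  then show thesis using that r by blast
qed

end

text \<open>
  Let \<open>\<kappa>\<close> be weights on \<open>V\<close> whose weighted sum of the operators \<open>block_rep v\<close> is, up to the factor \<open>card V\<close>,
  the projection onto the leading block; this is what the assumptions \<open>outside\<close> and \<open>inside\<close> say in
  terms of coefficients. Given an invariant subspace with a nonzero vector, a translate of that vector
  has a nonzero leading block, and projecting it gives a nonzero vector of the original module. By
  irreducibility of \<open>\<rho>\<close> the subspace contains the original module, whose translates span everything.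
\<close>

lemma (in block_induction) irreducible_representation_block_rep:
  assumes irr: "irreducible_representation GH d \<rho>"
    and sub: "V \<subseteq> carrier G" and V: "finite V" "card V > 0"
    and outside: "\<And>x a b w. x \<in> carrier G \<Longrightarrow> x \<notin> H \<Longrightarrow> w \<in> carrier G \<Longrightarrow> a < d \<Longrightarrow> b < d \<Longrightarrow>
      (\<Sum>v\<in>V. \<kappa> v * entry a b (x \<otimes> v \<otimes> w)) = 0"
    and inside: "\<And>a b w. w \<in> carrier G \<Longrightarrow> a < d \<Longrightarrow> b < d \<Longrightarrow>
      (\<Sum>v\<in>V. \<kappa> v * entry a b (v \<otimes> w)) = of_nat (card V) * entry a b w"
  shows "irreducible_representation G (m * d) block_rep"
proof -
  have d: "d > 0"
    and minimal: "\<And>W. VectorSpace.subspace class_ring W (module_vec TYPE(complex) d) \<Longrightarrow>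
      (\<And>h w. h \<in> H \<Longrightarrow> w \<in> W \<Longrightarrow> \<rho> h *\<^sub>v w \<in> W) \<Longrightarrow> W = {0\<^sub>v d} \<or> W = carrier_vec d"
    using irr by (auto simp: irreducible_representation_def)
  define emb where "emb u = vec (m * d) (\<lambda>k. if k < d then u $ k else (0 :: complex))" for u
  have emb_carrier: "emb u \<in> carrier_vec (m * d)" for u by (simp add: emb_def)
  have emb_index: "emb u $ (i * d + a) = (if i = 0 then u $ a else 0)" if "i < m" "a < d" for u i a
  proof -
    have "i * d + a < d \<longleftrightarrow> i = 0" using that by (cases i) auto
    then show ?thesis using that by (simp add: emb_def block_index_less)
  qed
  have vec_eqI: "v = w" if "v \<in> carrier_vec (m * d)" "w \<in> carrier_vec (m * d)"
    "\<And>i a. i < m \<Longrightarrow> a < d \<Longrightarrow> v $ (i * d + a) = w $ (i * d + a)" for v w :: "complex vec"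
  proof (rule eq_vecI)
    fix k assume "k < dim_vec w"
    then have "k < m * d" using that by simp
    then obtain i a where "i < m" "a < d" "k = i * d + a" by (elim block_indexE)
    then show "v $ k = w $ k" using that by blast
  qed (use that in simp)
  have emb_action: "(block_rep g *\<^sub>v emb u) $ (i * d + a) = (\<Sum>b<d. entry a b (t i \<otimes> g) * u $ b)"
    if "i < m" "a < d" "g \<in> carrier G" for g u i a
  proof -
    have "(block_rep g *\<^sub>v emb u) $ (i * d + a)
       = (\<Sum>j<m. \<Sum>b<d. entry a b (t i \<otimes> g \<otimes> inv (t j)) * (if j = 0 then u $ b else 0))"
      using that by (simp add: block_rep_action emb_carrier emb_index)
    also have "\<dots> = (\<Sum>j<m. if j = 0 then \<Sum>b<d. entry a b (t i \<otimes> g \<otimes> inv (t j)) * u $ b else 0)"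
      by (intro sum.cong refl) simp
    also have "\<dots> = (\<Sum>b<d. entry a b (t i \<otimes> g) * u $ b)"
      using that m_pos tG by (simp add: t0)
    finally show ?thesis .
  qed
  have whole: "W = {0\<^sub>v (m * d)} \<or> W = carrier_vec (m * d)"
    if W: "VectorSpace.subspace class_ring W (module_vec TYPE(complex) (m * d))"
      and stable: "\<And>g w. g \<in> carrier G \<Longrightarrow> w \<in> W \<Longrightarrow> block_rep g *\<^sub>v w \<in> W" for W
  proof (rule disjCI)
    assume "W \<noteq> carrier_vec (m * d)"
    note Wp = W[unfolded subspace_module_vec_iff]
    have Wc: "w \<in> carrier_vec (m * d)" if "w \<in> W" for w using Wp that by blast
    have emb_add: "emb (u + v) = emb u + emb v" if "u \<in> carrier_vec d" "v \<in> carrier_vec d" for u v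
      using that by (intro vec_eqI) (auto simp: emb_carrier emb_index block_index_less emb_def)
    have emb_smult: "emb (c \<cdot>\<^sub>v u) = c \<cdot>\<^sub>v emb u" if "u \<in> carrier_vec d" for u c
      using that by (intro vec_eqI) (auto simp: emb_carrier emb_index block_index_less emb_def)
    have project: "emb (vec d (\<lambda>a. w $ a)) \<in> W" if w: "w \<in> W" for w
    proof -
      have wc: "w \<in> carrier_vec (m * d)" using Wc[OF w] .
      have "vec (m * d) (\<lambda>k. \<Sum>v\<in>V. (\<kappa> v / of_nat (card V)) * (block_rep v *\<^sub>v w) $ k) \<in> W" (is "?p \<in> W")
        using V sub stable w by (intro subspace_linear_combination[OF W]) auto
      also have "?p = emb (vec d (\<lambda>a. w $ a))"
      proof (rule vec_eqI)
        fix i a assume ia: "i < m" "a < d"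
        have "?p $ (i * d + a) = (\<Sum>v\<in>V. (\<kappa> v / of_nat (card V)) *
            (\<Sum>j<m. \<Sum>b<d. entry a b (t i \<otimes> v \<otimes> inv (t j)) * w $ (j * d + b)))"
          using ia by (simp add: block_index_less block_rep_action[OF wc])
        also have "\<dots> = (\<Sum>v\<in>V. \<Sum>j<m. \<Sum>b<d.
            (\<kappa> v / of_nat (card V)) * (entry a b (t i \<otimes> v \<otimes> inv (t j)) * w $ (j * d + b)))"
          by (simp add: sum_distrib_left)
        also have "\<dots> = (\<Sum>j<m. \<Sum>v\<in>V. \<Sum>b<d.
            (\<kappa> v / of_nat (card V)) * (entry a b (t i \<otimes> v \<otimes> inv (t j)) * w $ (j * d + b)))"
          by (rule sum.swap)
        also have "\<dots> = (\<Sum>j<m. \<Sum>b<d. \<Sum>v\<in>V.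
            (\<kappa> v / of_nat (card V)) * (entry a b (t i \<otimes> v \<otimes> inv (t j)) * w $ (j * d + b)))"
          by (intro sum.cong refl sum.swap)
        also have "\<dots> = (\<Sum>j<m. \<Sum>b<d. (w $ (j * d + b) / of_nat (card V)) *
            (\<Sum>v\<in>V. \<kappa> v * entry a b (t i \<otimes> v \<otimes> inv (t j))))"
          by (simp add: sum_distrib_left mult_ac)
        also have "\<dots> = (\<Sum>j<m. \<Sum>b<d. w $ (j * d + b) *
            (if i = 0 \<and> j = 0 \<and> a = b then 1 else 0))"
        proof (intro sum.cong refl)
          fix j b assume "j \<in> {..<m}" "b \<in> {..<d}"
          then have jb: "j < m" "b < d" by auto
          have "(\<Sum>v\<in>V. \<kappa> v * entry a b (t i \<otimes> v \<otimes> inv (t j)))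
             = of_nat (card V) * (if i = 0 \<and> j = 0 \<and> a = b then 1 else 0)"
          proof (cases "i = 0")
            case True
            have "(\<Sum>v\<in>V. \<kappa> v * entry a b (t i \<otimes> v \<otimes> inv (t j)))
                = (\<Sum>v\<in>V. \<kappa> v * entry a b (v \<otimes> inv (t j)))"
              using True sub by (intro sum.cong refl) (auto simp: t0)
            also have "\<dots> = of_nat (card V) * entry a b (inv (t j))"
              using inside[of "inv (t j)" a b] ia jb tG by simp
            also have "entry a b (inv (t j)) = (if 0 = j \<and> a = b then 1 else 0)"
              using entry_transversal[OF m_pos jb(1) ia(2) jb(2)] tG[OF jb(1)] by (simp add: t0)
            finally show ?thesis using True by auto
          next
            case False
            have "t i \<otimes> inv (t 0) = t i" using tG[OF ia(1)] by (simp add: t0)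
            then have "t i \<notin> H" using coset_unique[OF ia(1) m_pos] False by auto
            then show ?thesis using outside[of "t i" "inv (t j)" a b] False ia jb tG by simp
          qed
          then show "(w $ (j * d + b) / of_nat (card V)) *
            (\<Sum>v\<in>V. \<kappa> v * entry a b (t i \<otimes> v \<otimes> inv (t j)))
            = w $ (j * d + b) * (if i = 0 \<and> j = 0 \<and> a = b then 1 else 0)"
            using V by auto
        qed
        also have "\<dots> = (if i = 0 then w $ a else 0)"
        proof (cases "i = 0")
          case True
          have "(\<Sum>j<m. \<Sum>b<d. w $ (j * d + b) * (if i = 0 \<and> j = 0 \<and> a = b then 1 else 0))
              = (\<Sum>j<m. if j = 0 then w $ (j * d + a) else 0)"
            using True ia by (intro sum.cong refl) (simp add: if_distrib cong: if_cong)
          then show ?thesis using True m_pos by simp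
        qed simp
        finally show "?p $ (i * d + a) = emb (vec d (\<lambda>a. w $ a)) $ (i * d + a)"
          using ia by (simp add: emb_index)
      qed (simp_all add: emb_carrier)
      finally show ?thesis .
    qed
    \<comment> \<open>Translation by \<open>t j\<close> moves the block with index \<open>j\<close> to the front.\<close>
    have block: "emb (vec d (\<lambda>a. w $ (j * d + a))) \<in> W" if w: "w \<in> W" and j: "j < m" for w j
    proof -
      have wc: "w \<in> carrier_vec (m * d)" using Wc[OF w] .
      have "(block_rep (t j) *\<^sub>v w) $ a = w $ (j * d + a)" if a: "a < d" for a
      proof -
        have "(block_rep (t j) *\<^sub>v w) $ a = (\<Sum>i<m. \<Sum>b<d. entry a b (t j \<otimes> inv (t i)) * w $ (i * d + b))"
          using block_rep_action[OF wc m_pos a, of "t j"] tG[OF j] by (simp add: t0)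
        also have "\<dots> = (\<Sum>i<m. if i = j then \<Sum>b<d. (if b = a then 1 else 0) * w $ (i * d + b) else 0)"
          using a j by (intro sum.cong refl) (auto simp: entry_transversal intro!: sum.cong)
        also have "\<dots> = w $ (j * d + a)"
          using a j by (simp add: if_distrib[where f = "\<lambda>x. x * _"] cong: if_cong)
        finally show ?thesis .
      qed
      then have "vec d (\<lambda>a. (block_rep (t j) *\<^sub>v w) $ a) = vec d (\<lambda>a. w $ (j * d + a))"
        by (intro eq_vecI) auto
      with project[OF stable[OF tG[OF j] w]] show ?thesis by simp
    qed
    define W0 where "W0 = {u \<in> carrier_vec d. emb u \<in> W}"
    have emb_zero: "emb (0\<^sub>v d) = 0\<^sub>v (m * d)"
      by (intro vec_eqI) (auto simp: emb_carrier emb_index block_index_less)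
    have "VectorSpace.subspace class_ring W0 (module_vec TYPE(complex) d)"
      unfolding subspace_module_vec_iff using Wp
      by (auto simp: W0_def emb_add emb_smult emb_zero)
    moreover have "\<rho> h *\<^sub>v u \<in> W0" if h: "h \<in> H" and u: "u \<in> W0" for h u
    proof -
      have uc: "u \<in> carrier_vec d" using u by (simp add: W0_def)
      have "emb (\<rho> h *\<^sub>v u) = block_rep h *\<^sub>v emb u"
      proof (rule vec_eqI)
        fix i a assume ia: "i < m" "a < d"
        have "t i \<otimes> h \<in> H \<longleftrightarrow> i = 0"
        proof -
          have "t i \<in> H \<longleftrightarrow> i = 0"
            using coset_unique[OF ia(1) m_pos] tG[OF ia(1)] subgroup.one_closed[OF H]
            by (auto simp: t0)
          then show ?thesis using subgroup_mult_iff(2)[OF H h tG[OF ia(1)]] by simp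
        qed
        then show "emb (\<rho> h *\<^sub>v u) $ (i * d + a) = (block_rep h *\<^sub>v emb u) $ (i * d + a)"
          using ia uc h HG[OF h] rep_props(1)[OF h]
          by (auto simp: emb_index emb_action entry_def extend_zero_def t0
              index_mult_mat_vec_sum[of _ d d] simp del: index_mult_mat_vec)
      qed (auto simp: emb_carrier intro!: mult_mat_vec_carrier[OF block_rep_carrier])
      then show ?thesis
        using u uc stable[OF HG[OF h], of "emb u"] rep_props(1)[OF h] by (simp add: W0_def)
    qed
    ultimately have W0: "W0 = {0\<^sub>v d} \<or> W0 = carrier_vec d" by (rule minimal)
    show "W = {0\<^sub>v (m * d)}"
    proof (rule ccontr)
      assume "W \<noteq> {0\<^sub>v (m * d)}"
      then obtain w where w: "w \<in> W" "w \<noteq> 0\<^sub>v (m * d)" using Wp by blast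
      have "\<exists>j a. j < m \<and> a < d \<and> w $ (j * d + a) \<noteq> 0"
      proof (rule ccontr)
        assume "\<not> ?thesis"
        then have "w = 0\<^sub>v (m * d)"
          using Wc[OF w(1)] by (intro vec_eqI) (auto simp: block_index_less)
        with w show False by simp
      qed
      then obtain j a where ja: "j < m" "a < d" "w $ (j * d + a) \<noteq> 0" by blast
      have "vec d (\<lambda>a. w $ (j * d + a)) \<in> W0"
        using block[OF w(1) ja(1)] by (simp add: W0_def)
      moreover have "vec d (\<lambda>a. w $ (j * d + a)) \<noteq> 0\<^sub>v d"
        using ja by (metis index_vec index_zero_vec(1))
      ultimately have all: "W0 = carrier_vec d" using W0 by auto
      \<comment> \<open>Any vector is the sum of its blocks, each of which is a translate of a leading block.\<close>
      have "x \<in> W" if x: "x \<in> carrier_vec (m * d)" for x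
      proof -
        define u where "u j = vec d (\<lambda>a. x $ (j * d + a))" for j
        have "emb (u j) \<in> W" for j
        proof -
          have "u j \<in> W0" unfolding all by (simp add: u_def)
          then show ?thesis by (simp add: W0_def)
        qed
        then have "vec (m * d) (\<lambda>k. \<Sum>j<m. 1 * (block_rep (inv (t j)) *\<^sub>v emb (u j)) $ k) \<in> W" (is "?s \<in> W")
          using stable tG by (intro subspace_linear_combination[OF W]) auto
        also have "?s = x"
        proof (rule vec_eqI)
          fix i a assume ia: "i < m" "a < d"
          have "?s $ (i * d + a) = (\<Sum>j<m. \<Sum>b<d. entry a b (t i \<otimes> inv (t j)) * x $ (j * d + b))"
            using ia tG by (simp add: block_index_less emb_action u_def)
          also have "\<dots> = (\<Sum>j<m. if j = i then \<Sum>b<d. (if b = a then 1 else 0) * x $ (j * d + b) else 0)"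
            using ia by (intro sum.cong refl) (auto simp: entry_transversal intro!: sum.cong)
          also have "\<dots> = x $ (i * d + a)"
            using ia by (simp add: if_distrib[where f = "\<lambda>x. x * _"] cong: if_cong)
          finally show "?s $ (i * d + a) = x $ (i * d + a)" .
        qed (use x in simp_all)
        finally show ?thesis .
      qed
      then have "W = carrier_vec (m * d)" using Wp by blast
      with \<open>W \<noteq> carrier_vec (m * d)\<close> show False ..
    qed
  qed
  show ?thesis
    unfolding irreducible_representation_def
    using block_rep_representation m_pos d whole by auto
qed

context separated_linear_character
begin

lemma induced_irreducible:
  assumes irr: "irreducible_representation GH d \<rho>"
    and scalar: "\<And>v. v \<in> V \<Longrightarrow> \<rho> v = lam v \<cdot>\<^sub>m 1\<^sub>m d"
  shows "induced G H (character_of GH d \<rho>) \<in> Irr G"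
proof -
  obtain t :: "nat \<Rightarrow> 'a" and m where t: "m > 0" "t 0 = \<one>" "\<And>i. i < m \<Longrightarrow> t i \<in> carrier G"
    "\<And>x. x \<in> carrier G \<Longrightarrow> \<exists>!i. i < m \<and> x \<otimes> inv (t i) \<in> H"
    using transversal_exists[OF H fin] by metis
  have rep: "representation GH d \<rho>"
    using irr by (simp add: irreducible_representation_def)
  interpret block_induction G H m t d \<rho>
    by unfold_locales (use t rep in auto)
  have F: "\<rho> (z \<otimes> y) $$ (a, b) = lam z * \<rho> y $$ (a, b)"
    if "z \<in> V" "y \<in> H" "a < d" "b < d" for z y a b
  proof -
    have "\<rho> (z \<otimes> y) = (lam z \<cdot>\<^sub>m 1\<^sub>m d) * \<rho> y"
      using that VH by (simp add: rep_props subsetD flip: scalar)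
    also have "\<dots> = lam z \<cdot>\<^sub>m \<rho> y"
      using left_mult_one_mat[OF rep_props(1)[OF that(2)]]
        mult_smult_assoc_mat[OF one_carrier_mat rep_props(1)[OF that(2)]] by simp
    finally show ?thesis using rep_props(1)[OF that(2)] that by simp
  qed
  have "irreducible_representation G (m * d) block_rep"
  proof (rule irreducible_representation_block_rep[OF irr, of V "\<lambda>v. inverse (lam v)"])
    show "(\<Sum>v\<in>V. inverse (lam v) * entry a b (x \<otimes> v \<otimes> w)) = 0"
      if "x \<in> carrier G" "x \<notin> H" "w \<in> carrier G" "a < d" "b < d" for x a b w
      unfolding entry_def using that F by (intro twisted_sum_outside) auto
    show "(\<Sum>v\<in>V. inverse (lam v) * entry a b (v \<otimes> w)) = of_nat (card V) * entry a b w"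
      if "w \<in> carrier G" "a < d" "b < d" for a b w
    proof -
      have "(\<Sum>v\<in>V. inverse (lam v) * entry a b (\<one> \<otimes> v \<otimes> w)) = of_nat (card V) * entry a b (\<one> \<otimes> w)"
        unfolding entry_def using that F subgroup.one_closed[OF H] by (intro twisted_sum_inside) auto
      then show ?thesis using that VG by simp
    qed
  qed (use VG finite_V card_V in auto)
  then have "character_of G (m * d) block_rep \<in> Irr G"
    by (auto simp: Irr_def)
  then show ?thesis by (simp add: character_of_block_rep)
qed

text \<open>
  Up to the factor \<open>card V\<close>, both sides are traces on the induced representation, of the action of \<open>h\<close> followed by the projection
  onto the original module. The proof stays with class functions: in the formula for the induced
  character only the conjugating elements of \<open>H\<close> survive the weighted sum over \<open>V\<close>.
\<close>

lemma character_recovered_from_induced: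
  assumes rep: "representation GH d \<rho>" and scalar: "\<And>v. v \<in> V \<Longrightarrow> \<rho> v = lam v \<cdot>\<^sub>m 1\<^sub>m d"
    and h: "h \<in> H"
  shows "(\<Sum>v\<in>V. inverse (lam v) * induced G H (character_of GH d \<rho>) (v \<otimes> h))
    = of_nat (card V) * character_of GH d \<rho> h"
proof -
  let ?\<chi> = "character_of GH d \<rho>"
  note r = group.representation_iff[OF GH_group, THEN iffD1, OF rep]
  have F: "?\<chi> (z \<otimes> y) = lam z * ?\<chi> y" if z: "z \<in> V" and y: "y \<in> H" for z y
  proof -
    have zH: "z \<in> H" using z VH by blast
    have yc: "\<rho> y \<in> carrier_mat d d" using r y by simp
    have "\<rho> (z \<otimes> y) = lam z \<cdot>\<^sub>m \<rho> y"
      using r zH y left_mult_one_mat[OF yc] mult_smult_assoc_mat[OF one_carrier_mat yc]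
      by (simp add: scalar[OF z])
    then show ?thesis
      using yc y zH subgroup.m_closed[OF H zH y] by (simp add: character_of_def sum_distrib_left)
  qed
  have conj: "extend_zero H ?\<chi> (x \<otimes> (h \<otimes> inv x)) = ?\<chi> h" if x: "x \<in> H" for x
  proof -
    have "x \<otimes> h \<otimes> inv x \<in> H"
      using x h subgroup.m_closed[OF H] subgroup.m_inv_closed[OF H] by blast
    then show ?thesis
      using group.character_of_conjugate[OF GH_group rep, of x h] x h HG
      by (simp add: extend_zero_def inv_GH m_assoc)
  qed
  have hG: "h \<in> carrier G" using HG[OF h] .
  have "(\<Sum>v\<in>V. inverse (lam v) * induced G H ?\<chi> (v \<otimes> h))
      = (\<Sum>v\<in>V. \<Sum>x\<in>carrier G. inverse (lam v) * extend_zero H ?\<chi> (x \<otimes> v \<otimes> (h \<otimes> inv x)) / of_nat (card H))"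
    using VG hG by (intro sum.cong refl) (simp add: induced_eq sum_distrib_left sum_divide_distrib m_assoc)
  also have "\<dots> = (\<Sum>x\<in>carrier G. \<Sum>v\<in>V. inverse (lam v) * extend_zero H ?\<chi> (x \<otimes> v \<otimes> (h \<otimes> inv x)) / of_nat (card H))"
    by (rule sum.swap)
  also have "\<dots> = (\<Sum>x\<in>carrier G. (\<Sum>v\<in>V. inverse (lam v) * extend_zero H ?\<chi> (x \<otimes> v \<otimes> (h \<otimes> inv x)))) / of_nat (card H)"
    by (simp add: sum_divide_distrib)
  also have "(\<Sum>x\<in>carrier G. (\<Sum>v\<in>V. inverse (lam v) * extend_zero H ?\<chi> (x \<otimes> v \<otimes> (h \<otimes> inv x))))
      = (\<Sum>x\<in>H. of_nat (card V) * ?\<chi> h)"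
  proof (rule sum.mono_neutral_cong_right[OF fin])
    show "H \<subseteq> carrier G" using HG by blast
    show "\<forall>x\<in>carrier G - H. (\<Sum>v\<in>V. inverse (lam v) * extend_zero H ?\<chi> (x \<otimes> v \<otimes> (h \<otimes> inv x))) = 0"
      using hG by (auto intro!: twisted_sum_outside F)
    show "(\<Sum>v\<in>V. inverse (lam v) * extend_zero H ?\<chi> (x \<otimes> v \<otimes> (h \<otimes> inv x))) = of_nat (card V) * ?\<chi> h"
      if x: "x \<in> H" for x
      using twisted_sum_inside[of ?\<chi>, OF F x, of "h \<otimes> inv x"] hG HG[OF x] conj[OF x] by simp
  qed
  finally show ?thesis
    using card_H by simp
qed

theorem induced_Irr_over:
  assumes "\<chi> \<in> Irr_over GH V lam"
  shows "induced G H \<chi> \<in> Irr G"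
  using Irr_over_acts_by_scalars[OF assms] induced_irreducible by metis

theorem induced_Irr_over_inj:
  assumes "\<chi>1 \<in> Irr_over GH V lam" "\<chi>2 \<in> Irr_over GH V lam"
    and eq: "induced G H \<chi>1 = induced G H \<chi>2"
  shows "\<chi>1 = \<chi>2"
proof
  fix h
  obtain d1 \<rho>1 where 1: "irreducible_representation GH d1 \<rho>1" "\<chi>1 = character_of GH d1 \<rho>1"
    "\<And>v. v \<in> V \<Longrightarrow> \<rho>1 v = lam v \<cdot>\<^sub>m 1\<^sub>m d1"
    using Irr_over_acts_by_scalars[OF assms(1)] by metis
  obtain d2 \<rho>2 where 2: "irreducible_representation GH d2 \<rho>2" "\<chi>2 = character_of GH d2 \<rho>2"
    "\<And>v. v \<in> V \<Longrightarrow> \<rho>2 v = lam v \<cdot>\<^sub>m 1\<^sub>m d2"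
    using Irr_over_acts_by_scalars[OF assms(2)] by metis
  show "\<chi>1 h = \<chi>2 h"
  proof (cases "h \<in> H")
    case True
    have "of_nat (card V) * \<chi>1 h = of_nat (card V) * \<chi>2 h"
      using character_recovered_from_induced[OF _ 1(3) True] character_recovered_from_induced[OF _ 2(3) True]
        1(1) 2(1) eq unfolding irreducible_representation_def 1(2) 2(2) by metis
    then show ?thesis using card_V by simp
  qed (simp add: 1(2) 2(2) character_of_def)
qed

text \<open>
  Inducing a decomposition of \<open>lam\<^sup>H\<close> into irreducible characters term by term gives one of \<open>lam\<^sup>G\<close>, since
  every term stays irreducible.
\<close>

theorem induced_Irr_over_constituent:
  assumes "\<chi> \<in> Irr_over GH V lam"
  shows "induced G H \<chi> \<in> Irr_constituents G (induced G V lam)"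
proof -
  obtain M where M: "set_mset M \<subseteq> Irr GH" "induced GH V lam = (\<lambda>g. \<Sum>\<eta>\<in>#M. \<eta> g)" "\<chi> \<in># M"
    using assms by (auto simp: Irr_over_def Irr_constituents_def)
  have over: "\<eta> \<in> Irr_over GH V lam" if "\<eta> \<in># M" for \<eta>
    using M that by (auto simp: Irr_over_def Irr_constituents_def)
  have add: "induced G H (\<lambda>g. \<Sum>\<eta>\<in>#N. \<eta> g) g = (\<Sum>\<eta>\<in>#N. induced G H \<eta> g)" for N g
  proof (induction N)
    case empty
    then show ?case by (simp add: induced_eq extend_zero_def)
  next
    case (add \<eta> N)
    have "induced G H (\<lambda>g. \<eta> g + (\<Sum>\<eta>\<in>#N. \<eta> g)) g = induced G H \<eta> g + induced G H (\<lambda>g. \<Sum>\<eta>\<in>#N. \<eta> g) g"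
    proof -
      have e: "extend_zero H (\<lambda>g. \<eta> g + (\<Sum>\<eta>\<in>#N. \<eta> g)) y
          = extend_zero H \<eta> y + extend_zero H (\<lambda>g. \<Sum>\<eta>\<in>#N. \<eta> g) y" for y
        by (simp add: extend_zero_def)
      show ?thesis
        by (simp add: induced_eq e sum.distrib add_divide_distrib)
    qed
    with add show ?case by simp
  qed
  have "induced G V lam = (\<lambda>g. \<Sum>\<eta>\<in>#image_mset (induced G H) M. \<eta> g)"
    using induced_transitive[OF H fin VH, of lam] by (simp add: M(2) add fun_eq_iff image_mset.compositionality comp_def)
  moreover have "set_mset (image_mset (induced G H) M) \<subseteq> Irr G"
    using over induced_Irr_over by auto
  moreover have "induced G H \<chi> \<in># image_mset (induced G H) M"
    using M(3) by simp
  ultimately show ?thesis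
    unfolding Irr_constituents_def by blast
qed

end

section \<open>Pattern subgroups of the unitriangular group\<close>

lemma unitri_simps [simp]:
  "mult (unitri n) = (*)" "one (unitri n) = 1\<^sub>m n"
  by (simp_all add: unitri_def)

lemma mem_unitri_iff:
  "A \<in> carrier (unitri n) \<longleftrightarrow>
     A \<in> carrier_mat n n \<and> (\<forall>i<n. \<forall>j<i. A $$ (i, j) = 0) \<and> (\<forall>i<n. A $$ (i, i) = 1)"
  by (auto simp: unitri_def upper_triangular_def)

lemma unitriD:
  assumes "A \<in> carrier (unitri n)"
  shows "A \<in> carrier_mat n n" "\<And>i j. i < n \<Longrightarrow> j < i \<Longrightarrow> A $$ (i, j) = 0"
    "\<And>i. i < n \<Longrightarrow> A $$ (i, i) = 1"
  using assms by (auto simp: mem_unitri_iff)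

lemma unitri_mult_closed:
  fixes A B :: "'q :: field mat"
  assumes A: "A \<in> carrier (unitri n)" and B: "B \<in> carrier (unitri n)"
  shows "A * B \<in> carrier (unitri n)"
proof -
  note a = unitriD[OF A] and b = unitriD[OF B]
  have "(A * B) $$ (i, j) = 0" if "i < n" "j < i" for i j
  proof -
    have "A $$ (i, k) * B $$ (k, j) = 0" if "k < n" for k
      using a(2)[of i k] b(2)[of k j] \<open>i < n\<close> \<open>j < i\<close> that by (cases "k < i") auto
    then have "(\<Sum>k<n. A $$ (i, k) * B $$ (k, j)) = 0" by (intro sum.neutral) blast
    then show ?thesis using that by (simp add: index_mult_mat_sum[OF a(1) b(1)])
  qed
  moreover have "(A * B) $$ (i, i) = 1" if "i < n" for i
  proof -
    have "A $$ (i, k) * B $$ (k, i) = (if k = i then 1 else 0)" if "k < n" for k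
      using a(2)[of i k] b(2)[of k i] a(3)[of i] b(3)[of i] \<open>i < n\<close> that
      by (cases k i rule: linorder_cases) auto
    then have "(\<Sum>k<n. A $$ (i, k) * B $$ (k, i)) = (\<Sum>k<n. if k = i then 1 else 0)"
      by (intro sum.cong) auto
    then show ?thesis using that by (simp add: index_mult_mat_sum[OF a(1) b(1)])
  qed
  ultimately show ?thesis
    using a(1) b(1) by (simp add: mem_unitri_iff)
qed

lemma finite_unitri: "finite (carrier (unitri n :: 'q :: {field, finite} mat monoid))"
proof -
  let ?F = "PiE ({..<n} \<times> {..<n}) (\<lambda>_. UNIV :: 'q set)"
  have "carrier (unitri n :: 'q mat monoid) \<subseteq> mat n n ` ?F"
  proof
    fix A :: "'q mat" assume "A \<in> carrier (unitri n)"
    then have A: "A \<in> carrier_mat n n" by (simp add: mem_unitri_iff)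
    have "A = mat n n (restrict (\<lambda>ij. A $$ ij) ({..<n} \<times> {..<n}))"
      using A by (intro eq_matI) auto
    then show "A \<in> mat n n ` ?F" by (rule image_eqI[where f = "mat n n"]) auto
  qed
  then show ?thesis
    by (rule finite_subset) (intro finite_imageI finite_PiE; simp)
qed

lemma unitri_group: "group (unitri n :: 'q :: {field, finite} mat monoid)"
proof (rule groupI)
  fix A :: "'q mat" assume A: "A \<in> carrier (unitri n)"
  let ?U = "carrier (unitri n) :: 'q mat set"
  note a = unitriD[OF A]
  have "det A = prod_list (diag_mat A)"
    using a by (intro det_upper_triangular) auto
  also have "diag_mat A = map (\<lambda>_. 1) [0..<n]"
    using a by (auto simp: diag_mat_def)
  also have "prod_list \<dots> = (1 :: 'q)" by (induction n) auto
  finally have "A \<in> Units (ring_mat TYPE('q) n ())"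
    using a(1) by (intro det_non_zero_imp_unit) auto
  then obtain A' where A': "A' \<in> carrier_mat n n" "A * A' = 1\<^sub>m n"
    by (auto simp: Units_def ring_mat_simps)
  \<comment> \<open>Right multiplication by an invertible matrix is injective, hence onto the finite set.\<close>
  have "inj_on (\<lambda>B. B * A) ?U"
  proof (rule inj_onI)
    fix B C assume B: "B \<in> ?U" and C: "C \<in> ?U" and e: "B * A = C * A"
    have "M = M * A * A'" if "M \<in> ?U" for M
      using unitriD(1)[OF that] a(1) A' by (simp add: assoc_mult_mat[of _ n n _ n _ n])
    then show "B = C" using B C e by metis
  qed
  moreover have "(\<lambda>B. B * A) ` ?U \<subseteq> ?U" using A unitri_mult_closed by blast
  ultimately have "(\<lambda>B. B * A) ` ?U = ?U" using finite_unitri endo_inj_surj by blast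
  moreover have "1\<^sub>m n \<in> ?U" by (auto simp: mem_unitri_iff)
  ultimately obtain B where "B \<in> ?U" "B * A = 1\<^sub>m n" by (metis imageE)
  then show "\<exists>B\<in>?U. B \<otimes>\<^bsub>unitri n\<^esub> A = \<one>\<^bsub>unitri n\<^esub>" by auto
next
  fix A B C :: "'q mat" assume "A \<in> carrier (unitri n)" "B \<in> carrier (unitri n)" "C \<in> carrier (unitri n)"
  then show "A \<otimes>\<^bsub>unitri n\<^esub> B \<otimes>\<^bsub>unitri n\<^esub> C = A \<otimes>\<^bsub>unitri n\<^esub> (B \<otimes>\<^bsub>unitri n\<^esub> C)"
    using unitriD(1)[of A n] unitriD(1)[of B n] unitriD(1)[of C n]
    by (simp add: assoc_mult_mat[of _ n n _ n _ n])
next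
  fix A :: "'q mat" assume "A \<in> carrier (unitri n)"
  then show "\<one>\<^bsub>unitri n\<^esub> \<otimes>\<^bsub>unitri n\<^esub> A = A"
    using unitriD(1)[of A n] by simp
next
  show "\<one>\<^bsub>unitri n\<^esub> \<in> carrier (unitri n)" by (auto simp: mem_unitri_iff)
qed (simp add: unitri_mult_closed)

text \<open>
  Row and column of the matrix entry of a root, in indices that start at \<open>0\<close>. In these coordinates the
  arm of \<open>\<alpha>\<close> consists of the entries of row \<open>rw \<alpha>\<close> strictly between the diagonal and column \<open>cl \<alpha>\<close>.
\<close>

definition rw :: "root \<Rightarrow> nat" where "rw \<alpha> = row_of \<alpha> - 1"

definition cl :: "root \<Rightarrow> nat" where "cl \<alpha> = col_of \<alpha> - 1"

definition pos :: "root \<Rightarrow> nat \<times> nat" where "pos \<alpha> = (rw \<alpha>, cl \<alpha>)"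

lemmas pos_defs = pos_def rw_def cl_def row_of_def col_of_def

lemma pos_less:
  assumes "\<alpha> \<in> pos_roots n" "pos \<alpha> = (r, j)"
  shows "r < j" "j < n" "r < n"
  using assms by (auto simp: pos_defs pos_roots_def)

lemma pos_inj: "\<alpha> \<in> pos_roots n \<Longrightarrow> \<beta> \<in> pos_roots n \<Longrightarrow> pos \<alpha> = pos \<beta> \<longleftrightarrow> \<alpha> = \<beta>"
  by (auto simp: pos_defs pos_roots_def)

lemma pos_surj:
  assumes "r < j" "j < n"
  shows "(r + 1, j) \<in> pos_roots n" "pos (r + 1, j) = (r, j)"
  using assms by (auto simp: pos_defs pos_roots_def)

lemma root_elt_carrier [simp]: "root_elt n \<alpha> c \<in> carrier_mat n n"
  by (simp add: root_elt_def)

lemma root_elt_index: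
  assumes "k < n" "l < n"
  shows "root_elt n \<alpha> c $$ (k, l) = (if k = l then 1 else 0) + (if (k, l) = pos \<alpha> then c else 0)"
  using assms by (auto simp: root_elt_def pos_def rw_def cl_def)

lemma root_elt_mult_index:
  assumes A: "A \<in> carrier_mat n n" and kl: "k < n" "l < n" and \<alpha>: "\<alpha> \<in> pos_roots n"
    and p: "pos \<alpha> = (r, j)"
  shows "(root_elt n \<alpha> c * A) $$ (k, l) = A $$ (k, l) + (if k = r then c * A $$ (j, l) else 0)"
proof -
  note lt = pos_less[OF \<alpha> p]
  have "(root_elt n \<alpha> c * A) $$ (k, l) = (\<Sum>i<n. root_elt n \<alpha> c $$ (k, i) * A $$ (i, l))"
    by (rule index_mult_mat_sum[OF root_elt_carrier A kl])
  also have "\<dots> = (\<Sum>i<n. (if i = k then A $$ (i, l) else 0)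
      + (if i = j then (if k = r then c * A $$ (i, l) else 0) else 0))"
    by (rule sum.cong) (use kl lt in \<open>auto simp: root_elt_index p distrib_right\<close>)
  also have "\<dots> = A $$ (k, l) + (if k = r then c * A $$ (j, l) else 0)"
    using kl lt by (simp add: sum.distrib)
  finally show ?thesis .
qed

lemma root_elt_unitri:
  assumes "\<alpha> \<in> pos_roots n"
  shows "root_elt n \<alpha> c \<in> carrier (unitri n)"
proof -
  obtain r j where p: "pos \<alpha> = (r, j)" by force
  then show ?thesis
    using pos_less[OF assms p] by (auto simp: mem_unitri_iff root_elt_index)
qed

lemma root_elt_mult:
  assumes \<alpha>: "\<alpha> \<in> pos_roots n"
  shows "root_elt n \<alpha> c * root_elt n \<alpha> d = root_elt n \<alpha> (c + d)"
proof (rule eq_matI)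
  obtain r j where p: "pos \<alpha> = (r, j)" by force
  note lt = pos_less[OF \<alpha> p]
  fix k l assume "k < dim_row (root_elt n \<alpha> (c + d))" "l < dim_col (root_elt n \<alpha> (c + d))"
  then have "k < n" "l < n" by (simp_all add: root_elt_def)
  then show "(root_elt n \<alpha> c * root_elt n \<alpha> d) $$ (k, l) = root_elt n \<alpha> (c + d) $$ (k, l)"
    using lt by (simp add: root_elt_mult_index[OF root_elt_carrier _ _ \<alpha> p] root_elt_index p)
qed (simp_all add: root_elt_def)

lemma root_elt_zero: "root_elt n \<alpha> 0 = 1\<^sub>m n"
  by (rule eq_matI) (auto simp: root_elt_index, auto simp: root_elt_def)

lemma inv_root_elt:
  fixes c :: "'q :: {field, finite}"
  assumes "\<alpha> \<in> pos_roots n"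
  shows "inv\<^bsub>unitri n\<^esub> (root_elt n \<alpha> c) = root_elt n \<alpha> (- c)"
  using root_elt_mult[OF assms, of "- c" c] root_elt_unitri[OF assms]
  by (intro group.inv_equality[OF unitri_group]) (auto simp: root_elt_zero)

definition pattern :: "nat \<Rightarrow> (nat \<times> nat) set \<Rightarrow> 'q :: field mat set" where
  "pattern n T = {A \<in> carrier (unitri n). \<forall>i j. i < j \<longrightarrow> j < n \<longrightarrow> A $$ (i, j) \<noteq> 0 \<longrightarrow> (i, j) \<in> T}"

definition closed_pattern :: "(nat \<times> nat) set \<Rightarrow> bool" where
  "closed_pattern T \<longleftrightarrow> (\<forall>i j k. (i, j) \<in> T \<longrightarrow> (j, k) \<in> T \<longrightarrow> (i, k) \<in> T)"

lemma patternD: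
  assumes "A \<in> pattern n T"
  shows "A \<in> carrier (unitri n)" "\<And>i j. i < j \<Longrightarrow> j < n \<Longrightarrow> (i, j) \<notin> T \<Longrightarrow> A $$ (i, j) = 0"
  using assms by (auto simp: pattern_def)

lemma patternI:
  assumes "A \<in> carrier (unitri n)" "\<And>i j. i < j \<Longrightarrow> j < n \<Longrightarrow> (i, j) \<notin> T \<Longrightarrow> A $$ (i, j) = 0"
  shows "A \<in> pattern n T"
  using assms by (auto simp: pattern_def)

lemma pattern_mono: "S \<subseteq> T \<Longrightarrow> pattern n S \<subseteq> pattern n T"
  by (auto simp: pattern_def)

lemma pattern_mult_closed:
  assumes T: "closed_pattern T" and A: "A \<in> pattern n T" and B: "B \<in> pattern n T"
  shows "A * B \<in> pattern n T"
proof (rule patternI)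
  note a = patternD[OF A] and b = patternD[OF B]
  note a' = unitriD[OF a(1)] and b' = unitriD[OF b(1)]
  show "A * B \<in> carrier (unitri n)" using a(1) b(1) by (rule unitri_mult_closed)
  fix i j assume ij: "i < j" "j < n" "(i, j) \<notin> T"
  have "A $$ (i, k) * B $$ (k, j) = 0" if k: "k < n" for k
  proof -
    consider "k < i" | "k = i" | "k = j" | "k > j" | "i < k" "k < j" by linarith
    then show ?thesis
    proof cases
      case 5
      then have "(i, k) \<notin> T \<or> (k, j) \<notin> T" using T ij by (auto simp: closed_pattern_def)
      then show ?thesis using 5 a(2)[of i k] b(2)[of k j] ij by auto
    qed (use a(2)[of i k] a'(2)[of i k] b(2)[of k j] b'(2)[of k j] a(2)[of i j] b(2)[of i j] ij k in auto)
  qed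
  then have "(\<Sum>k<n. A $$ (i, k) * B $$ (k, j)) = 0" by (intro sum.neutral) blast
  then show "(A * B) $$ (i, j) = 0"
    using ij by (simp add: index_mult_mat_sum[OF a'(1) b'(1)])
qed

text \<open>
  Gaussian elimination from the bottom row upwards, by induction on the number of nonzero entries
  above the diagonal. Each step is a multiplication by an element of a root subgroup of the pattern.
\<close>

lemma pattern_in_generate:
  fixes A :: "'q :: {field, finite} mat"
  assumes S: "S \<subseteq> pos_roots n" and A: "A \<in> pattern n (pos ` S)"
  shows "A \<in> gen_by_roots n S"
  using A
proof (induction "card {(i, j). i < j \<and> j < n \<and> A $$ (i, j) \<noteq> 0}" arbitrary: A rule: less_induct)
  case less
  note a = patternD[OF less.prems] and a' = unitriD[OF patternD(1)[OF less.prems]]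
  let ?N = "\<lambda>A :: 'q mat. {(i, j). i < j \<and> j < n \<and> A $$ (i, j) \<noteq> 0}"
  have finN: "finite (?N B)" for B
    by (rule finite_subset[of _ "{..<n} \<times> {..<n}"]) auto
  show ?case
  proof (cases "?N A = {}")
    case True
    have "A = 1\<^sub>m n"
    proof (rule eq_matI)
      fix i j assume "i < dim_row (1\<^sub>m n :: 'q mat)" "j < dim_col (1\<^sub>m n :: 'q mat)"
      then show "A $$ (i, j) = 1\<^sub>m n $$ (i, j)"
        using True a'(2)[of i j] a'(3)[of i] by (cases i j rule: linorder_cases) auto
    qed (use a'(1) in auto)
    then show ?thesis
      using generate.one[of "unitri n"] by (simp add: gen_by_roots_def)
  next
    case False
    \<comment> \<open>In the lowest row with a nonzero entry off the diagonal, clear one entry. The row that is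
      added is then a row of the identity matrix, so no other entry changes.\<close>
    let ?R = "fst ` ?N A"
    define r where "r = Max ?R"
    have "r \<in> ?R" unfolding r_def using False finN by (intro Max_in) auto
    then obtain c where rc: "r < c" "c < n" "A $$ (r, c) \<noteq> 0" by auto
    have low: "A $$ (i, j) = 0" if "r < i" "i < j" "j < n" for i j
    proof (rule ccontr)
      assume "A $$ (i, j) \<noteq> 0"
      then have "i \<in> ?R" using that by force
      then have "i \<le> r" unfolding r_def using finN by (intro Max_ge) auto
      with that show False by simp
    qed
    have row_c: "A $$ (c, l) = (if l = c then 1 else 0)" if "l < n" for l
      using low[of c l] a'(2)[of c l] a'(3)[of c] rc that by (cases c l rule: linorder_cases) auto
    have "(r, c) \<in> pos ` S" using a(2) rc by blast
    then obtain \<alpha> where \<alpha>: "\<alpha> \<in> S" "pos \<alpha> = (r, c)" by auto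
    then have \<alpha>r: "\<alpha> \<in> pos_roots n" using S by blast
    define x where "x = A $$ (r, c)"
    define B where "B = root_elt n \<alpha> (- x) * A"
    have B: "B $$ (k, l) = (if (k, l) = (r, c) then 0 else A $$ (k, l))" if "k < n" "l < n" for k l
      using that by (auto simp: B_def root_elt_mult_index[OF a'(1) _ _ \<alpha>r \<alpha>(2)] row_c x_def)
    have BU: "B \<in> carrier (unitri n)"
      unfolding B_def by (intro unitri_mult_closed root_elt_unitri \<alpha>r a(1))
    have "B \<in> pattern n (pos ` S)"
      using BU a(2) by (intro patternI) (auto simp: B)
    moreover have "?N B \<subset> ?N A"
    proof
      show "?N B \<subseteq> ?N A" by (auto simp: B split: if_splits)
      show "?N B \<noteq> ?N A" using rc B[of r c] by force
    qed
    then have "card (?N B) < card (?N A)" by (intro psubset_card_mono finN)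
    ultimately have Bg: "B \<in> gen_by_roots n S" by (intro less.hyps) auto
    have "A = root_elt n \<alpha> x * B"
      unfolding B_def using a'(1) root_elt_mult[OF \<alpha>r, of x "- x"]
      by (simp add: root_elt_zero flip: assoc_mult_mat[of _ n n _ n _ n])
    moreover have "root_elt n \<alpha> x \<in> gen_by_roots n S"
      unfolding gen_by_roots_def using \<alpha> by (intro generate.incl) (auto simp: root_subgroup_def)
    ultimately show ?thesis
      using Bg generate.eng[of _ "unitri n"] by (simp add: gen_by_roots_def)
  qed
qed

text \<open>
  All groups of the statement are built from groups generated by root subgroups, so this turns
  membership in them into a condition on matrix entries.
\<close>

theorem gen_by_roots_eq_pattern:
  assumes S: "S \<subseteq> pos_roots n" and closed: "closed_pattern (pos ` S)"
  shows "(gen_by_roots n S :: 'q :: {field, finite} mat set) = pattern n (pos ` S)"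
proof
  have elt: "root_elt n \<alpha> c \<in> pattern n (pos ` S)" if "\<alpha> \<in> S" for \<alpha> and c :: 'q
    using that S by (intro patternI root_elt_unitri) (auto simp: root_elt_index)
  show "(gen_by_roots n S :: 'q mat set) \<subseteq> pattern n (pos ` S)"
  proof
    fix A :: "'q mat" assume "A \<in> gen_by_roots n S"
    then show "A \<in> pattern n (pos ` S)"
      unfolding gen_by_roots_def
    proof (induction rule: generate.induct)
      case one
      show ?case by (rule patternI) (auto simp: mem_unitri_iff)
    next
      case (incl h)
      then show ?case using elt by (auto simp: root_subgroup_def)
    next
      case (inv h)
      then obtain \<alpha> c where \<alpha>: "\<alpha> \<in> S" "h = root_elt n \<alpha> c" by (auto simp: root_subgroup_def)
      then have "\<alpha> \<in> pos_roots n" using S by blast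
      then show ?case using elt \<alpha> by (simp add: inv_root_elt)
    next
      case (eng h1 h2)
      then show ?case using pattern_mult_closed[OF closed] by simp
    qed
  qed
  show "pattern n (pos ` S) \<subseteq> (gen_by_roots n S :: 'q mat set)"
    using pattern_in_generate[OF S] by blast
qed

text \<open>
  Closure under inverses comes for free from the description by generators.
\<close>

lemma pattern_subgroup:
  assumes T: "closed_pattern T" "T \<subseteq> {(i, j). i < j \<and> j < n}"
  shows "subgroup (pattern n T :: 'q :: {field, finite} mat set) (unitri n)"
proof -
  define S where "S = (\<lambda>(i, j). (i + 1, j)) ` T"
  have pS: "pos ` S = T"
  proof -
    have "pos ` S = (\<lambda>p. p) ` T"
      unfolding S_def image_image using T(2) pos_surj(2) by (intro image_cong) auto
    then show ?thesis by simp
  qed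
  have S: "S \<subseteq> pos_roots n"
    using T(2) pos_surj(1) unfolding S_def by auto
  have "(\<Union>\<beta>\<in>S. root_subgroup n \<beta>) \<subseteq> (carrier (unitri n) :: 'q mat set)"
    using S by (auto simp: root_subgroup_def intro!: root_elt_unitri)
  then have "subgroup (gen_by_roots n S :: 'q mat set) (unitri n)"
    unfolding gen_by_roots_def by (rule group.generate_is_subgroup[OF unitri_group])
  then show ?thesis
    using gen_by_roots_eq_pattern[OF S] T(1) pS by metis
qed

section \<open>The arms of a set of roots\<close>

text \<open>
  Gives the uniqueness that makes the definite description in \<open>lam\<close> meaningful.
\<close>

lemma (in group) linear_character_generate_eqI:
  assumes K: "K \<subseteq> carrier G"
    and \<mu>: "linear_character (G\<lparr>carrier := generate G K\<rparr>) \<mu>"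
    and \<nu>: "linear_character (G\<lparr>carrier := generate G K\<rparr>) \<nu>"
    and eq: "\<And>k. k \<in> K \<Longrightarrow> \<mu> k = \<nu> k"
  shows "\<mu> = \<nu>"
proof
  fix g
  have one: "\<xi> \<one> = 1" and inv: "h \<in> K \<Longrightarrow> \<xi> (inv h) = inverse (\<xi> h)"
    if \<xi>: "linear_character (G\<lparr>carrier := generate G K\<rparr>) \<xi>" for \<xi> h
  proof -
    have mult: "\<xi> (x \<otimes> y) = \<xi> x * \<xi> y" and nz: "\<xi> x \<noteq> 0"
      if "x \<in> generate G K" "y \<in> generate G K" for x y
      using \<xi> that by (auto simp: linear_character_def)
    show one: "\<xi> \<one> = 1"
      using mult[OF generate.one generate.one] nz[OF generate.one generate.one] by simp
    show "\<xi> (inv h) = inverse (\<xi> h)" if h: "h \<in> K"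
    proof -
      have "\<xi> (inv h) * \<xi> h = 1"
        using mult[OF generate.inv[OF h] generate.incl[OF h]] K h one by (simp add: subsetD)
      then show ?thesis by (metis inverse_unique mult.commute)
    qed
  qed
  show "\<mu> g = \<nu> g"
  proof (cases "g \<in> generate G K")
    case True
    then show ?thesis
    proof (induction rule: generate.induct)
      case (eng h1 h2)
      then show ?case using \<mu> \<nu> by (simp add: linear_character_def)
    qed (simp_all add: eq one[OF \<mu>] one[OF \<nu>] inv[OF \<mu>] inv[OF \<nu>])
  next
    case False
    then show ?thesis using \<mu> \<nu> by (simp add: linear_character_def)
  qed
qed

text \<open>
  The patterns of \<open>V_basic n D\<close>, \<open>R_basic n D\<close> and \<open>VR_basic n D\<close>. In the last one an entry on the arm of \<open>\<alpha>\<close>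
  is admitted if its column \<open>j\<close> is the row of a root \<open>\<beta>\<close> of \<open>D\<close> in a column beyond that of \<open>\<alpha>\<close>. Such an
  entry does no harm: left multiplication adds with it a multiple of row \<open>j\<close> to row \<open>rw \<alpha>\<close>, and in \<open>v - 1\<close>
  with \<open>v\<close> in \<open>V_basic n D\<close> row \<open>j\<close> is zero up to and including column \<open>cl \<alpha>\<close>, as \<open>cl \<alpha> < cl \<beta>\<close>.
\<close>

definition V_pattern :: "nat \<Rightarrow> root set \<Rightarrow> (nat \<times> nat) set" where
  "V_pattern n D = {(i, j). i < j \<and> j < n \<and> (\<forall>\<alpha>\<in>D. i = rw \<alpha> \<longrightarrow> cl \<alpha> \<le> j)}"

definition R_pattern :: "root set \<Rightarrow> (nat \<times> nat) set" where
  "R_pattern D = {(rw \<sigma>, rw \<tau>) | \<sigma> \<tau>. \<sigma> \<in> D \<and> \<tau> \<in> D \<and> rw \<sigma> < rw \<tau> \<and> cl \<sigma> < cl \<tau>}"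

definition VR_pattern :: "nat \<Rightarrow> root set \<Rightarrow> (nat \<times> nat) set" where
  "VR_pattern n D = {(i, j). i < j \<and> j < n \<and>
     (\<forall>\<alpha>\<in>D. i = rw \<alpha> \<longrightarrow> j < cl \<alpha> \<longrightarrow> (\<exists>\<beta>\<in>D. rw \<beta> = j \<and> cl \<alpha> < cl \<beta>))}"

lemma V_pattern_subset_VR_pattern: "V_pattern n D \<subseteq> VR_pattern n D"
proof (rule subrelI)
  fix i j assume ij: "(i, j) \<in> V_pattern n D"
  then have "\<not> j < cl \<alpha>" if "\<alpha> \<in> D" "i = rw \<alpha>" for \<alpha>
    using that by (simp add: V_pattern_def not_less)
  with ij show "(i, j) \<in> VR_pattern n D"
    unfolding VR_pattern_def V_pattern_def by blast
qed

lemma VR_patternD: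
  assumes "(rw \<alpha>, k) \<in> VR_pattern n D" "\<alpha> \<in> D" "k < cl \<alpha>"
  shows "\<exists>\<beta>\<in>D. rw \<beta> = k \<and> cl \<alpha> < cl \<beta>"
  using assms by (simp add: VR_pattern_def)

lemma closed_V_pattern: "closed_pattern (V_pattern n D)"
  by (fastforce simp: closed_pattern_def V_pattern_def)

lemma closed_VR_pattern: "closed_pattern (VR_pattern n D)"
  unfolding closed_pattern_def
proof (intro allI impI)
  fix i j k assume ij: "(i, j) \<in> VR_pattern n D" and jk: "(j, k) \<in> VR_pattern n D"
  have "\<exists>\<beta>\<in>D. rw \<beta> = k \<and> cl \<alpha> < cl \<beta>" if \<alpha>: "\<alpha> \<in> D" "i = rw \<alpha>" "k < cl \<alpha>" for \<alpha>
  proof -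
    have "j < k" using jk by (simp add: VR_pattern_def)
    then obtain \<beta> where \<beta>: "\<beta> \<in> D" "rw \<beta> = j" "cl \<alpha> < cl \<beta>"
      using ij \<alpha> by (force simp: VR_pattern_def)
    then obtain \<gamma> where "\<gamma> \<in> D" "rw \<gamma> = k" "cl \<beta> < cl \<gamma>"
      using jk \<alpha> by (force simp: VR_pattern_def)
    then show ?thesis using \<beta> by force
  qed
  then show "(i, k) \<in> VR_pattern n D"
    using ij jk by (auto simp: VR_pattern_def)
qed

lemma V_root_eq_pattern:
  assumes \<alpha>: "\<alpha> \<in> pos_roots n"
  shows "(V_root n \<alpha> :: 'q :: {field, finite} mat set) = pattern n (V_pattern n {\<alpha>})"
proof -
  have "pos ` (pos_roots n - arm \<alpha>) = V_pattern n {\<alpha>}"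
  proof (intro equalityI subsetI)
    fix p assume "p \<in> pos ` (pos_roots n - arm \<alpha>)"
    then show "p \<in> V_pattern n {\<alpha>}"
      using \<alpha> by (auto simp: V_pattern_def pos_defs pos_roots_def arm_def)
  next
    fix p assume p: "p \<in> V_pattern n {\<alpha>}"
    obtain i j where ij: "p = (i, j)" by force
    then have "p = pos (i + 1, j)" "(i + 1, j) \<in> pos_roots n - arm \<alpha>"
      using p \<alpha> by (auto simp: V_pattern_def pos_defs pos_roots_def arm_def)
    then show "p \<in> pos ` (pos_roots n - arm \<alpha>)" by blast
  qed
  then show ?thesis
    unfolding V_root_def
    using gen_by_roots_eq_pattern[of "pos_roots n - arm \<alpha>" n] closed_V_pattern[of n "{\<alpha>}"] by auto
qed

lemma pattern_V_insert:
  "pattern n (V_pattern n (insert \<alpha> D)) = pattern n (V_pattern n {\<alpha>}) \<inter> pattern n (V_pattern n D)"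
  by (auto simp: pattern_def V_pattern_def)

lemma V_basic_eq_pattern:
  assumes "D \<subseteq> pos_roots n" "D \<noteq> {}"
  shows "(V_basic n D :: 'q :: {field, finite} mat set) = pattern n (V_pattern n D)"
proof -
  have "(V_basic n D :: 'q mat set) = (\<Inter>\<alpha>\<in>D. pattern n (V_pattern n {\<alpha>}))"
    unfolding V_basic_def using assms(1) by (intro INF_cong refl V_root_eq_pattern) auto
  also have "\<dots> = pattern n (V_pattern n D)"
    using assms(2) by (auto simp: pattern_def V_pattern_def)
  finally show ?thesis .
qed

lemma V_row_zero:
  assumes A: "A \<in> pattern n (V_pattern n D)" and \<alpha>: "\<alpha> \<in> D" and c: "rw \<alpha> < c" "c < cl \<alpha>" "cl \<alpha> < n"
  shows "A $$ (rw \<alpha>, c) = 0"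
proof (rule patternD(2)[OF A])
  show "(rw \<alpha>, c) \<notin> V_pattern n D"
    using \<alpha> c(2) by (auto simp: V_pattern_def not_le)
qed (use c in auto)

text \<open>
  This additivity makes \<open>A \<mapsto> \<theta> (A $$ pos \<alpha> * s)\<close> a linear character: the arm of \<open>\<alpha>\<close> has been cleared, so
  no product of two entries off the diagonal reaches the position of \<open>\<alpha>\<close>.
\<close>

lemma V_entry_mult:
  fixes A B :: "'q :: field mat"
  assumes A: "A \<in> pattern n (V_pattern n D)" and B: "B \<in> carrier (unitri n)"
    and \<alpha>: "\<alpha> \<in> D" "\<alpha> \<in> pos_roots n"
  shows "(A * B) $$ pos \<alpha> = A $$ pos \<alpha> + B $$ pos \<alpha>"
proof -
  obtain r j where p: "pos \<alpha> = (r, j)" by force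
  note lt = pos_less[OF \<alpha>(2) p]
  note a = unitriD[OF patternD(1)[OF A]] and b = unitriD[OF B]
  have "A $$ (r, k) * B $$ (k, j) = (if k = r then B $$ (r, j) else 0) + (if k = j then A $$ (r, j) else 0)"
    if k: "k < n" for k
  proof -
    consider "k < r" | "k = r" | "r < k" "k < j" | "k = j" | "j < k" by linarith
    then show ?thesis
      using a(2)[of r k] a(3)[of r] b(3)[of j] b(2)[of k j] lt k V_row_zero[OF A \<alpha>(1), of k] p[unfolded pos_def]
      by cases auto
  qed
  then have "(\<Sum>k<n. A $$ (r, k) * B $$ (k, j)) = A $$ (r, j) + B $$ (r, j)"
    using lt by (simp add: sum.distrib)
  then show ?thesis
    using lt by (simp add: p index_mult_mat_sum[OF a(1) b(1)])
qed

lemma nontrivial_additive_characterD: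
  fixes \<theta> :: "'q :: field \<Rightarrow> complex"
  assumes "nontrivial_additive_character \<theta>"
  shows "\<And>a b. \<theta> (a + b) = \<theta> a * \<theta> b" "\<And>a. \<theta> a \<noteq> 0" "\<theta> 0 = 1" "\<exists>c. \<theta> c \<noteq> 1"
proof -
  show m: "\<theta> (a + b) = \<theta> a * \<theta> b" and nz: "\<theta> a \<noteq> 0" for a b
    using assms by (auto simp: nontrivial_additive_character_def linear_character_def)
  show "\<theta> 0 = 1" using m[of 0 0] nz[of 0] by simp
  show "\<exists>c. \<theta> c \<noteq> 1" using assms by (simp add: nontrivial_additive_character_def)
qed

lemma lam_eq:
  fixes \<theta> :: "'q :: {field, finite} \<Rightarrow> complex"
  assumes \<theta>: "nontrivial_additive_character \<theta>" and \<alpha>: "\<alpha> \<in> pos_roots n"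
  shows "lam \<theta> n \<alpha> s = (\<lambda>A. if A \<in> V_root n \<alpha> then \<theta> (A $$ pos \<alpha> * s) else 0)" (is "_ = ?\<mu>")
proof -
  interpret group "unitri n :: 'q mat monoid" by (rule unitri_group)
  note th = nontrivial_additive_characterD[OF \<theta>]
  let ?S = "pos_roots n - arm \<alpha>"
  let ?K = "(\<Union>\<beta>\<in>?S. root_subgroup n \<beta>) :: 'q mat set"
  have V: "V_root n \<alpha> = generate (unitri n) ?K" by (simp add: V_root_def gen_by_roots_def)
  have K: "?K \<subseteq> carrier (unitri n)"
    by (auto simp: root_subgroup_def intro!: root_elt_unitri)
  note VP = V_root_eq_pattern[OF \<alpha>, where 'q = 'q]
  have inV: "root_subgroup n \<beta> \<subseteq> (V_root n \<alpha> :: 'q mat set)" if "\<beta> \<in> ?S" for \<beta>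
    unfolding V using that by (auto intro: generate.incl)
  have \<alpha>S: "\<alpha> \<in> ?S" using \<alpha> by (cases \<alpha>) (simp add: arm_def)
  have mu_lin: "linear_character (unitri_subgroup n (V_root n \<alpha>)) ?\<mu>"
  proof -
    have "A * B \<in> V_root n \<alpha> \<and> (A * B) $$ pos \<alpha> = A $$ pos \<alpha> + B $$ pos \<alpha>"
      if "A \<in> V_root n \<alpha>" "B \<in> V_root n \<alpha>" for A B :: "'q mat"
      using that \<alpha> unfolding VP
      by (auto intro!: pattern_mult_closed closed_V_pattern V_entry_mult[of A n "{\<alpha>}"] dest: patternD(1))
    then show ?thesis
      by (auto simp: linear_character_def th distrib_right)
  qed
  have mu_root: "?\<mu> (root_elt n \<beta> c) = (if \<beta> = \<alpha> then \<theta> (c * s) else 1)"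
    if "\<beta> \<in> pos_roots n" "root_elt n \<beta> c \<in> V_root n \<alpha>" for \<beta> and c
  proof -
    obtain r j where p: "pos \<alpha> = (r, j)" by force
    note lt = pos_less[OF \<alpha> p]
    have "pos \<beta> = pos \<alpha> \<longleftrightarrow> \<beta> = \<alpha>" using that(1) \<alpha> by (rule pos_inj)
    then show ?thesis
      using that(2) lt by (auto simp: root_elt_index p th)
  qed
  show ?thesis
    unfolding lam_def
  proof (rule the_equality, intro conjI allI ballI impI)
    show "linear_character (unitri_subgroup n (V_root n \<alpha>)) ?\<mu>" by (rule mu_lin)
    show "?\<mu> (root_elt n \<alpha> d) = \<theta> (d * s)" for d
      using mu_root[OF \<alpha>, of d] inV[OF \<alpha>S] by (auto simp: root_subgroup_def)
    fix \<beta> and g :: "'q mat" assume \<beta>: "\<beta> \<in> pos_roots n"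
      "\<beta> \<noteq> \<alpha> \<and> root_subgroup n \<beta> \<subseteq> (V_root n \<alpha> :: 'q mat set)" "g \<in> root_subgroup n \<beta>"
    then obtain c where "g = root_elt n \<beta> c" by (auto simp: root_subgroup_def)
    then show "?\<mu> g = 1" using mu_root[OF \<beta>(1), of c] \<beta> by auto
  next
    fix \<mu> :: "'q mat \<Rightarrow> complex"
    assume \<mu>: "linear_character (unitri_subgroup n (V_root n \<alpha>)) \<mu> \<and>
        (\<forall>d. \<mu> (root_elt n \<alpha> d) = \<theta> (d * s)) \<and>
        (\<forall>\<beta>\<in>pos_roots n. \<beta> \<noteq> \<alpha> \<and> root_subgroup n \<beta> \<subseteq> (V_root n \<alpha> :: 'q mat set) \<longrightarrow>
           (\<forall>g\<in>root_subgroup n \<beta>. \<mu> g = 1))"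
    show "\<mu> = ?\<mu>"
    proof (rule linear_character_generate_eqI[OF K])
      show "linear_character (unitri_subgroup n (generate (unitri n) ?K)) \<mu>"
        using \<mu> by (simp add: V)
      show "linear_character (unitri_subgroup n (generate (unitri n) ?K)) ?\<mu>"
        using mu_lin by (simp add: V)
      fix g assume "g \<in> ?K"
      then obtain \<beta> c where \<beta>: "\<beta> \<in> ?S" "g = root_elt n \<beta> c" by (auto simp: root_subgroup_def)
      then have "\<mu> g = (if \<beta> = \<alpha> then \<theta> (c * s) else 1)"
        using \<mu> inV[OF \<beta>(1)] by (auto simp: root_subgroup_def)
      then show "\<mu> g = ?\<mu> g"
        using mu_root[of \<beta> c] \<beta> inV[OF \<beta>(1)] by (auto simp: root_subgroup_def)
    qed
  qed
qed

text \<open>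
  If a row of \<open>X\<close> vanishes before column \<open>j\<close>, right multiplication by a unitriangular matrix, which adds
  columns to columns further to the right, keeps these zeros and the entry in column \<open>j\<close>.
\<close>

lemma row_mult_unitri:
  fixes X :: "'q :: field mat"
  assumes X: "X \<in> carrier_mat n n" and u: "u \<in> carrier (unitri n)" and r: "r < n" and j: "j < n" "k \<le> j"
    and zero: "\<And>c. c < j \<Longrightarrow> X $$ (r, c) = 0"
  shows "(X * u) $$ (r, k) = (if k = j then X $$ (r, j) else 0)"
proof -
  note b = unitriD[OF u]
  have "X $$ (r, i) * u $$ (i, k) = (if i = j then if k = j then X $$ (r, j) else 0 else 0)" if i: "i < n" for i
    using zero[of i] b(2)[of i k] b(3)[of j] i j by (cases i j rule: linorder_cases) auto
  then have "(\<Sum>i<n. X $$ (r, i) * u $$ (i, k)) = (\<Sum>i<n. if i = j then if k = j then X $$ (r, j) else 0 else 0)"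
    by (intro sum.cong) auto
  then show ?thesis
    using r j by (simp add: index_mult_mat_sum[OF X b(1)])
qed

text \<open>
  Let \<open>X = y - 1\<close>. Then \<open>g * y * inv g = 1 + (g * X) * inv g\<close>, and by the previous lemma the last factor
  is invisible in the relevant entries. Conjugation thus becomes left multiplication of \<open>X\<close> by \<open>g\<close>.
\<close>

lemma conjugate_row:
  fixes g y :: "'q :: {field, finite} mat"
  assumes g: "g \<in> carrier (unitri n)" and y: "y \<in> carrier (unitri n)" and r: "r < j" "j < n"
    and zero: "\<And>c. c < j \<Longrightarrow> (g * (y - 1\<^sub>m n)) $$ (r, c) = 0" and k: "k \<le> j"
  shows "(g * y * inv\<^bsub>unitri n\<^esub> g) $$ (r, k)
     = (if k = r then 1 else 0) + (if k = j then (g * (y - 1\<^sub>m n)) $$ (r, j) else 0)"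
proof -
  interpret group "unitri n :: 'q mat monoid" by (rule unitri_group)
  let ?i = "inv\<^bsub>unitri n\<^esub> g"
  have i: "?i \<in> carrier (unitri n)" using g by simp
  note gc = unitriD(1)[OF g] and yc = unitriD(1)[OF y] and ic = unitriD(1)[OF i]
  have gi: "g * ?i = 1\<^sub>m n" using r_inv[OF g] by simp
  have "g * (y - 1\<^sub>m n) = g * y - g"
    using gc yc by (simp add: mult_minus_distrib_mat[of _ n n _ n])
  then have "g * (y - 1\<^sub>m n) * ?i = g * y * ?i - 1\<^sub>m n"
    using gc yc ic gi by (simp add: minus_mult_distrib_mat[of _ n n _ _ n])
  then have "(g * (y - 1\<^sub>m n) * ?i) $$ (r, k) = (g * y * ?i) $$ (r, k) - 1\<^sub>m n $$ (r, k)"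
    using r k gc yc ic by simp
  moreover have "(g * (y - 1\<^sub>m n) * ?i) $$ (r, k) = (if k = j then (g * (y - 1\<^sub>m n)) $$ (r, j) else 0)"
    using gc yc r k zero by (intro row_mult_unitri[OF _ i]) auto
  ultimately show ?thesis
    using r k by (auto simp: algebra_simps)
qed

section \<open>The supercharacter of a basic set\<close>

locale basic_root_set =
  fixes n :: nat and D :: "root set" and \<theta> :: "'q :: {field, finite} \<Rightarrow> complex" and s :: "root \<Rightarrow> 'q"
  assumes basic: "basic_set n D" and \<theta>: "nontrivial_additive_character \<theta>"
    and s: "\<And>\<alpha>. \<alpha> \<in> D \<Longrightarrow> s \<alpha> \<noteq> 0"
begin

sublocale group "unitri n :: 'q mat monoid"
  by (rule unitri_group)

abbreviation U :: "'q mat set" where "U \<equiv> carrier (unitri n)"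

abbreviation V :: "'q mat set" where "V \<equiv> pattern n (V_pattern n D)"

abbreviation VR :: "'q mat set" where "VR \<equiv> pattern n (VR_pattern n D)"

definition lam_prod :: "root set \<Rightarrow> 'q mat \<Rightarrow> complex" where
  "lam_prod E A = (\<Prod>\<alpha>\<in>E. \<theta> (A $$ pos \<alpha> * s \<alpha>))"

lemmas th = nontrivial_additive_characterD[OF \<theta>]

lemma D_roots: "D \<subseteq> pos_roots n" and D_nonempty: "D \<noteq> {}"
  using basic by (auto simp: basic_set_def)

lemma finite_D: "finite D"
proof (rule finite_subset[OF D_roots])
  have "pos_roots n \<subseteq> {..n} \<times> {..n}" by (auto simp: pos_roots_def)
  then show "finite (pos_roots n)" by (rule finite_subset) auto
qed

lemma D_less:
  assumes "\<alpha> \<in> D"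
  shows "rw \<alpha> < cl \<alpha>" "cl \<alpha> < n" "rw \<alpha> < n"
  using pos_less[of \<alpha> n "rw \<alpha>" "cl \<alpha>"] assms D_roots by (auto simp: pos_def)

lemma row_of_eq: "\<alpha> \<in> D \<Longrightarrow> row_of \<alpha> = rw \<alpha> + 1"
  and col_of_eq: "\<alpha> \<in> D \<Longrightarrow> col_of \<alpha> = cl \<alpha> + 1"
  using D_roots by (auto simp: pos_roots_def pos_defs)

lemma rows_distinct: "\<alpha> \<in> D \<Longrightarrow> \<beta> \<in> D \<Longrightarrow> rw \<alpha> = rw \<beta> \<Longrightarrow> \<alpha> = \<beta>"
  and columns_distinct: "\<alpha> \<in> D \<Longrightarrow> \<beta> \<in> D \<Longrightarrow> cl \<alpha> = cl \<beta> \<Longrightarrow> \<alpha> = \<beta>"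
  using basic row_of_eq col_of_eq unfolding basic_set_def by metis+

lemma V_pattern_subset: "V_pattern n E \<subseteq> {(i, j). i < j \<and> j < n}"
  by (auto simp: V_pattern_def)

lemma V_subgroup: "subgroup (pattern n (V_pattern n E) :: 'q mat set) (unitri n)"
  by (rule pattern_subgroup[OF closed_V_pattern V_pattern_subset])

lemma VR_subgroup: "subgroup VR (unitri n)"
  by (rule pattern_subgroup[OF closed_VR_pattern]) (auto simp: VR_pattern_def)

lemma lam_prod_mult:
  assumes "E \<subseteq> D" "A \<in> pattern n (V_pattern n E)" "B \<in> U"
  shows "lam_prod E (A * B) = lam_prod E A * lam_prod E B"
proof -
  have "(A * B) $$ pos \<alpha> = A $$ pos \<alpha> + B $$ pos \<alpha>" if "\<alpha> \<in> E" for \<alpha>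
    using V_entry_mult[OF assms(2,3) that] that assms(1) D_roots by blast
  then show ?thesis
    unfolding lam_prod_def prod.distrib[symmetric]
    by (intro prod.cong refl) (simp add: distrib_right th)
qed

lemma lam_prod_nonzero: "E \<subseteq> D \<Longrightarrow> lam_prod E A \<noteq> 0"
  using finite_subset[OF _ finite_D] by (simp add: lam_prod_def th)

lemma lam_prod_conjugate:
  assumes E: "E \<subseteq> D" and h: "h \<in> pattern n (V_pattern n E)" and y: "y \<in> pattern n (V_pattern n E)"
  shows "lam_prod E (h * y * inv\<^bsub>unitri n\<^esub> h) = lam_prod E y"
proof -
  have U: "h \<in> U" "y \<in> U" using h y patternD(1) by auto
  have "h * y * inv\<^bsub>unitri n\<^esub> h \<in> pattern n (V_pattern n E)"
    using subgroup.m_closed[OF V_subgroup] subgroup.m_inv_closed[OF V_subgroup] h y by (metis unitri_simps(1))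
  then have "lam_prod E (h * y * inv\<^bsub>unitri n\<^esub> h * h)
      = lam_prod E (h * y * inv\<^bsub>unitri n\<^esub> h) * lam_prod E h"
    using lam_prod_mult[OF E] U by blast
  moreover have "h * y * inv\<^bsub>unitri n\<^esub> h * h = h * y"
    using m_assoc[of "h * y" "inv\<^bsub>unitri n\<^esub> h" h] U l_inv[OF U(1)] r_one[of "h * y"] unitri_mult_closed[OF U]
    by simp
  ultimately show ?thesis
    using lam_prod_mult[OF E h U(2)] lam_prod_nonzero[OF E, of h] by simp
qed

text \<open>
  The matrices supported on the arm of \<open>\<alpha>\<close> form a complement of \<open>V_root n \<alpha>\<close>. The arm of row \<open>rw \<alpha>\<close> in \<open>x\<close>
  equals that of the factor \<open>a\<close>, so it determines \<open>a\<close> and may be prescribed.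
\<close>

lemma arm_complement:
  assumes \<alpha>: "\<alpha> \<in> D" and x: "x \<in> U"
  shows "\<exists>!a. a \<in> pattern n {(i, j). i = rw \<alpha> \<and> j < cl \<alpha>}
     \<and> x * inv\<^bsub>unitri n\<^esub> a \<in> pattern n (V_pattern n {\<alpha>})" (is "\<exists>!a. a \<in> ?A \<and> _ \<in> ?V")
proof -
  let ?r = "rw \<alpha>" and ?j = "cl \<alpha>"
  note lt = D_less[OF \<alpha>]
  have key: "x * inv\<^bsub>unitri n\<^esub> a \<in> ?V \<longleftrightarrow> (\<forall>c. ?r < c \<longrightarrow> c < ?j \<longrightarrow> a $$ (?r, c) = x $$ (?r, c))"
    if a: "a \<in> ?A" for a
  proof -
    have aU: "a \<in> U" using a patternD(1) by blast
    define z where "z = x * inv\<^bsub>unitri n\<^esub> a"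
    have zU: "z \<in> U" unfolding z_def using x aU by (intro unitri_mult_closed) auto
    have "z * a = x"
      unfolding z_def using m_assoc[of x "inv\<^bsub>unitri n\<^esub> a" a] x aU l_inv[OF aU] r_one[OF x] by simp
    note z' = unitriD[OF zU] and a' = unitriD[OF aU]
    have e: "x $$ (?r, c) = a $$ (?r, c) + z $$ (?r, c)" if c: "?r < c" "c < ?j" for c
    proof -
      have "z $$ (?r, k) * a $$ (k, c) = (if k = ?r then a $$ (?r, c) else 0) + (if k = c then z $$ (?r, c) else 0)"
        if k: "k < n" for k
      proof -
        have "a $$ (k, c) = 0" if "k < c" "k \<noteq> ?r"
          using patternD(2)[OF a, of k c] that c lt by auto
        then show ?thesis
          using z'(3)[of ?r] a'(3)[of c] a'(2)[of k c] c lt k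
          by (cases k c rule: linorder_cases) auto
      qed
      then have "(\<Sum>k<n. z $$ (?r, k) * a $$ (k, c)) = a $$ (?r, c) + z $$ (?r, c)"
        using c lt by (simp add: sum.distrib)
      then show ?thesis
        using index_mult_mat_sum[OF z'(1) a'(1), of ?r c] \<open>z * a = x\<close> c lt by simp
    qed
    have "z \<in> ?V \<longleftrightarrow> (\<forall>c. ?r < c \<longrightarrow> c < ?j \<longrightarrow> z $$ (?r, c) = 0)"
    proof
      assume "z \<in> ?V"
      then show "\<forall>c. ?r < c \<longrightarrow> c < ?j \<longrightarrow> z $$ (?r, c) = 0"
        using V_row_zero[of z n "{\<alpha>}" \<alpha>] lt by simp
    next
      assume "\<forall>c. ?r < c \<longrightarrow> c < ?j \<longrightarrow> z $$ (?r, c) = 0"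
      then show "z \<in> ?V"
        using zU by (intro patternI) (auto simp: V_pattern_def not_le)
    qed
    then show ?thesis unfolding z_def[symmetric] using e by auto
  qed
  define a where "a = mat n n (\<lambda>(i, j). if i = j then 1 else if i = ?r \<and> i < j \<and> j < ?j then x $$ (i, j) else 0)"
  have aA: "a \<in> ?A"
    by (rule patternI) (auto simp: a_def mem_unitri_iff)
  show ?thesis
  proof (rule ex1I[of _ a])
    have "a $$ (?r, c) = x $$ (?r, c)" if "?r < c" "c < ?j" for c
      using that lt by (simp add: a_def)
    then show "a \<in> ?A \<and> x * inv\<^bsub>unitri n\<^esub> a \<in> ?V" using key[OF aA] aA by blast
  next
    fix b assume b: "b \<in> ?A \<and> x * inv\<^bsub>unitri n\<^esub> b \<in> ?V"
    then have row: "b $$ (?r, c) = x $$ (?r, c)" if "?r < c" "c < ?j" for c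
      using key[of b] that by blast
    have bA: "b \<in> ?A" using b by blast
    note b' = unitriD[OF patternD(1)[OF bA]]
    show "b = a"
    proof (rule eq_matI)
      fix i j assume "i < dim_row a" "j < dim_col a"
      then have ij: "i < n" "j < n" by (simp_all add: a_def)
      show "b $$ (i, j) = a $$ (i, j)"
        using ij b'(2)[of i j] b'(3)[of i] row[of j] patternD(2)[OF bA, of i j]
        by (cases i j rule: linorder_cases) (auto simp: a_def)
    qed (use b'(1) in \<open>auto simp: a_def\<close>)
  qed
qed

text \<open>
  The arm subgroup of a root is contained in the groups of all other roots of \<open>D\<close>, as these only
  constrain other rows. Hence the product formula applies to one root after the other.
\<close>

lemma prod_induced_V_root:
  assumes "E \<subseteq> D" and g: "g \<in> U"
  shows "(\<Prod>\<alpha>\<in>E. induced (unitri n) (pattern n (V_pattern n {\<alpha>})) (lam_prod {\<alpha>}) g)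
    = induced (unitri n) (pattern n (V_pattern n E)) (lam_prod E) g"
  using finite_subset[OF assms(1) finite_D] assms(1)
proof (induction E rule: finite_induct)
  case empty
  have e: "pattern n (V_pattern n {}) = U"
    by (auto simp: pattern_def V_pattern_def)
  have "card U \<noteq> 0" using finite_unitri one_closed by (metis card_eq_0_iff empty_iff)
  then show ?case
    using g by (simp add: e induced_eq lam_prod_def extend_zero_def sum.If_cases Int_absorb2 subset_iff
        flip: unitri_simps)
next
  case (insert \<alpha> E)
  let ?W = "\<lambda>E. pattern n (V_pattern n E) :: 'q mat set"
  have \<alpha>: "\<alpha> \<in> D" and E: "E \<subseteq> D" using insert.prems by auto
  define A where "A = (pattern n {(i, j). i = rw \<alpha> \<and> j < cl \<alpha>} :: 'q mat set)"
  have A_sub: "A \<subseteq> ?W E"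
  proof
    fix a assume "a \<in> A"
    then have a: "a \<in> pattern n {(i, j). i = rw \<alpha> \<and> j < cl \<alpha>}" by (simp only: A_def)
    show "a \<in> ?W E"
    proof (rule patternI[OF patternD(1)[OF a]])
      fix i j assume ij: "i < j" "j < n" "(i, j) \<notin> V_pattern n E"
      then obtain \<beta> where \<beta>: "\<beta> \<in> E" "i = rw \<beta>" by (auto simp: V_pattern_def)
      then have "\<beta> \<noteq> \<alpha>" "\<beta> \<in> D" using insert.hyps(2) E by auto
      then have "i \<noteq> rw \<alpha>" using rows_distinct[of \<beta> \<alpha>] \<alpha> \<beta>(2) by metis
      then show "a $$ (i, j) = 0" using patternD(2)[OF a ij(1,2)] by simp
    qed
  qed
  have A_cover: "\<exists>!a. a \<in> A \<and> x \<otimes>\<^bsub>unitri n\<^esub> inv\<^bsub>unitri n\<^esub> a \<in> ?W {\<alpha>}" if "x \<in> U" for x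
    using arm_complement[OF \<alpha> that] by (simp only: A_def unitri_simps)
  have class_fun: "lam_prod F (h \<otimes>\<^bsub>unitri n\<^esub> y \<otimes>\<^bsub>unitri n\<^esub> inv\<^bsub>unitri n\<^esub> h) = lam_prod F y"
    if "F \<subseteq> D" "h \<in> ?W F" "y \<in> ?W F" for F h y
    using lam_prod_conjugate[OF that] by simp
  have "induced (unitri n) (?W {\<alpha>}) (lam_prod {\<alpha>}) g * induced (unitri n) (?W E) (lam_prod E) g
      = induced (unitri n) (?W {\<alpha>} \<inter> ?W E) (\<lambda>y. lam_prod {\<alpha>} y * lam_prod E y) g"
  proof (rule induced_mult_of_complemented[OF V_subgroup V_subgroup A_sub finite_unitri A_cover])
    show "lam_prod {\<alpha>} (h \<otimes>\<^bsub>unitri n\<^esub> y \<otimes>\<^bsub>unitri n\<^esub> inv\<^bsub>unitri n\<^esub> h) = lam_prod {\<alpha>} y"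
      if "h \<in> ?W {\<alpha>}" "y \<in> ?W {\<alpha>}" for h y
      using class_fun[of "{\<alpha>}" h y] \<alpha> that by simp
    show "lam_prod E (h \<otimes>\<^bsub>unitri n\<^esub> y \<otimes>\<^bsub>unitri n\<^esub> inv\<^bsub>unitri n\<^esub> h) = lam_prod E y"
      if "h \<in> ?W E" "y \<in> ?W E" for h y
      using class_fun[OF E that] .
  qed
  also have "\<dots> = induced (unitri n) (?W (insert \<alpha> E)) (lam_prod (insert \<alpha> E)) g"
  proof -
    have "(\<lambda>y. lam_prod {\<alpha>} y * lam_prod E y) = lam_prod (insert \<alpha> E)"
      using insert.hyps by (auto simp: lam_prod_def)
    then show ?thesis by (simp add: pattern_V_insert[of n \<alpha> E])
  qed
  finally show ?case
    using insert by simp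
qed

text \<open>
  Left multiplication by \<open>h\<close> adds to row \<open>rw \<alpha>\<close> of \<open>v - 1\<close> multiples of rows \<open>k\<close>. For \<open>rw \<alpha> < k < c\<close> the
  pattern of \<open>h\<close> forces \<open>k\<close> to be the row of some \<open>\<beta> \<in> D\<close> with \<open>cl \<alpha> < cl \<beta>\<close>, and column \<open>c\<close> of that row lies on
  the arm of \<open>\<beta>\<close>. Rows further down have a zero in column \<open>c\<close> anyway, so nothing changes.
\<close>

lemma VR_rows:
  assumes h: "h \<in> VR" and v: "v \<in> V" and \<alpha>: "\<alpha> \<in> D" and c: "c \<le> cl \<alpha>"
  shows "(h * (v - 1\<^sub>m n)) $$ (rw \<alpha>, c) = (if c = cl \<alpha> then v $$ (rw \<alpha>, cl \<alpha>) else 0)"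
proof -
  let ?r = "rw \<alpha>"
  note lt = D_less[OF \<alpha>]
  note h' = unitriD[OF patternD(1)[OF h]] and v' = unitriD[OF patternD(1)[OF v]]
  have term0: "h $$ (?r, k) * (v - 1\<^sub>m n) $$ (k, c) = 0" if k: "k < n" "k \<noteq> ?r" for k
  proof (cases "?r < k \<and> k < c \<and> h $$ (?r, k) \<noteq> 0")
    case True
    then have "(?r, k) \<in> VR_pattern n D"
      using patternD(2)[OF h _ k(1), of ?r] by (cases "(?r, k) \<in> VR_pattern n D") simp_all
    moreover have "k < cl \<alpha>" using True c by simp
    ultimately obtain \<beta> where \<beta>: "\<beta> \<in> D" "rw \<beta> = k" "cl \<alpha> < cl \<beta>"
      using VR_patternD[OF _ \<alpha>] by blast
    have "v $$ (k, c) = 0"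
      using V_row_zero[OF v \<beta>(1), of c] \<beta> True c D_less[OF \<beta>(1)] by simp
    then show ?thesis using True k c lt v'(1) by simp
  next
    case False
    then consider "k < ?r" | "c < k" | "k = c" | "h $$ (?r, k) = 0" using k(2) by linarith
    then show ?thesis
      using h'(2)[of ?r k] v'(2)[of k c] v'(3)[of c] v'(1) k c lt by cases auto
  qed
  have "(\<Sum>k<n. h $$ (?r, k) * (v - 1\<^sub>m n) $$ (k, c)) = (\<Sum>k\<in>{?r}. h $$ (?r, k) * (v - 1\<^sub>m n) $$ (k, c))"
    using lt term0 by (intro sum.mono_neutral_right) auto
  also have "\<dots> = (v - 1\<^sub>m n) $$ (?r, c)" using h'(3)[of ?r] lt by simp
  also have "\<dots> = (if c = cl \<alpha> then v $$ (?r, cl \<alpha>) else 0)"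
    using v'(1) v'(2)[of ?r c] v'(3)[of c] V_row_zero[OF v \<alpha>, of c] c lt
    by (cases c ?r rule: linorder_cases) auto
  finally show ?thesis
    using h'(1) v'(1) lt c by (subst index_mult_mat_sum[of _ n n _ n]) auto
qed

lemma VR_normalizes:
  assumes h: "h \<in> VR" and v: "v \<in> V"
  shows "h * v * inv\<^bsub>unitri n\<^esub> h \<in> V" "lam_prod D (h * v * inv\<^bsub>unitri n\<^esub> h) = lam_prod D v"
proof -
  let ?w = "h * v * inv\<^bsub>unitri n\<^esub> h"
  have hU: "h \<in> U" and vU: "v \<in> U" using h v patternD(1) by auto
  have row: "?w $$ (rw \<alpha>, k) = (if k = rw \<alpha> then 1 else 0) + (if k = cl \<alpha> then v $$ (rw \<alpha>, cl \<alpha>) else 0)"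
    if \<alpha>: "\<alpha> \<in> D" and k: "k \<le> cl \<alpha>" for \<alpha> k
    using conjugate_row[OF hU vU D_less(1,2)[OF \<alpha>] _ k] VR_rows[OF h v \<alpha>] by simp
  show "?w \<in> V"
  proof (rule patternI)
    show "?w \<in> U" using hU vU by (intro unitri_mult_closed) auto
    fix i j assume ij: "i < j" "j < n" "(i, j) \<notin> V_pattern n D"
    then obtain \<alpha> where "\<alpha> \<in> D" "i = rw \<alpha>" "j < cl \<alpha>" by (auto simp: V_pattern_def not_le)
    then show "?w $$ (i, j) = 0" using row[of \<alpha> j] ij by auto
  qed
  have "?w $$ pos \<alpha> = v $$ pos \<alpha>" if "\<alpha> \<in> D" for \<alpha>
    using row[OF that order_refl] D_less[OF that] by (simp add: pos_def)
  then show "lam_prod D ?w = lam_prod D v"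
    unfolding lam_prod_def by (intro prod.cong) auto
qed

text \<open>
  Outside \<open>VR\<close> some entry \<open>(rw \<alpha>, k)\<close> of \<open>g\<close> is nonzero although it lies on the arm of \<open>\<alpha>\<close> and is not admitted
  by the pattern of \<open>VR\<close>. Choose such an entry with \<open>cl \<alpha>\<close> maximal and take for \<open>y\<close> a root element at
  \<open>(k, cl \<alpha>)\<close>. Then \<open>g * (y - 1)\<close> is a multiple of column \<open>k\<close> of \<open>g\<close>, placed in column \<open>cl \<alpha>\<close>. It vanishes
  on the arms of all roots further to the right, on row \<open>k\<close> because \<open>(rw \<alpha>, k)\<close> is not admitted and on
  the other rows by maximality. So the conjugate of \<open>y\<close> stays in \<open>V\<close>, while at the position of \<open>\<alpha>\<close> it has the
  nonzero entry \<open>g $$ (rw \<alpha>, k) * t\<close>, which \<open>lam_prod D\<close> detects.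
\<close>

lemma separated_outside_VR:
  assumes g: "g \<in> U" "g \<notin> VR"
  shows "\<exists>y\<in>V. g * y * inv\<^bsub>unitri n\<^esub> g \<in> V \<and> lam_prod D (g * y * inv\<^bsub>unitri n\<^esub> g) \<noteq> lam_prod D y"
proof -
  note g' = unitriD[OF g(1)]
  define bad where "bad \<alpha> k \<longleftrightarrow> \<alpha> \<in> D \<and> rw \<alpha> < k \<and> k < cl \<alpha> \<and> g $$ (rw \<alpha>, k) \<noteq> 0 \<and>
    \<not> (\<exists>\<beta>\<in>D. rw \<beta> = k \<and> cl \<alpha> < cl \<beta>)" for \<alpha> k
  obtain \<alpha>0 k0 where bad0: "bad \<alpha>0 k0"
    using g by (auto simp: pattern_def VR_pattern_def bad_def)
  define B where "B = {\<alpha>. \<exists>k. bad \<alpha> k}"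
  have "B \<subseteq> D" by (auto simp: B_def bad_def)
  then have finB: "finite (cl ` B)" using finite_subset finite_D by blast
  have "cl ` B \<noteq> {}" using bad0 unfolding B_def by blast
  then obtain \<alpha> where \<alpha>B: "\<alpha> \<in> B" "cl \<alpha> = Max (cl ` B)"
    using Max_in[OF finB] by (metis imageE)
  then have max: "cl \<gamma> \<le> cl \<alpha>" if "\<gamma> \<in> B" for \<gamma>
    using Max_ge[OF finB] that by simp
  obtain k where bad: "bad \<alpha> k" using \<alpha>B(1) unfolding B_def by blast
  then have \<alpha>: "\<alpha> \<in> D" and k: "rw \<alpha> < k" "k < cl \<alpha>" and gk: "g $$ (rw \<alpha>, k) \<noteq> 0"
    and no: "\<And>\<beta>. \<beta> \<in> D \<Longrightarrow> rw \<beta> = k \<Longrightarrow> cl \<beta> \<le> cl \<alpha>"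
    by (auto simp: bad_def not_less)
  note lt = D_less[OF \<alpha>]
  obtain c0 where c0: "\<theta> c0 \<noteq> 1" using th(4) by blast
  \<comment> \<open>The scalar is chosen so that the conjugate of \<open>y\<close> has the value \<open>\<theta> c0 \<noteq> 1\<close>.\<close>
  define t where "t = c0 / (g $$ (rw \<alpha>, k) * s \<alpha>)"
  have ts: "g $$ (rw \<alpha>, k) * t * s \<alpha> = c0" using gk s[OF \<alpha>] by (simp add: t_def)
  define \<beta> where "\<beta> = (k + 1, cl \<alpha>)"
  have \<beta>: "\<beta> \<in> pos_roots n" "pos \<beta> = (k, cl \<alpha>)"
    using pos_surj[of k "cl \<alpha>" n] k lt by (simp_all add: \<beta>_def)
  define y where "y = root_elt n \<beta> t"
  have yU: "y \<in> U" unfolding y_def by (rule root_elt_unitri[OF \<beta>(1)])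
  have y_index: "y $$ (i, j) = (if i = j then 1 else 0) + (if i = k \<and> j = cl \<alpha> then t else 0)" if "i < n" "j < n" for i j
    using that by (simp add: y_def root_elt_index \<beta>)
  have yV: "y \<in> V"
  proof (rule patternI[OF yU])
    fix i j assume ij: "i < j" "j < n" "(i, j) \<notin> V_pattern n D"
    then show "y $$ (i, j) = 0"
      using no by (auto simp: y_index V_pattern_def)
  qed
  have gX: "(g * (y - 1\<^sub>m n)) $$ (i, c) = (if c = cl \<alpha> then g $$ (i, k) * t else 0)" if ic: "i < n" "c < n" for i c
  proof -
    have "(g * (y - 1\<^sub>m n)) $$ (i, c) = (\<Sum>l<n. g $$ (i, l) * (y - 1\<^sub>m n) $$ (l, c))"
      using g'(1) unitriD(1)[OF yU] ic by (intro index_mult_mat_sum[of _ n n _ n]) auto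
    also have "\<dots> = (\<Sum>l<n. if l = k then (if c = cl \<alpha> then g $$ (i, k) * t else 0) else 0)"
      using unitriD(1)[OF yU] ic by (intro sum.cong) (auto simp: y_index)
    finally show ?thesis using k lt by simp
  qed
  have zero: "(g * (y - 1\<^sub>m n)) $$ (rw \<gamma>, c) = 0" if \<gamma>: "\<gamma> \<in> D" and c: "c < cl \<gamma>" for \<gamma> c
  proof (cases "c = cl \<alpha>")
    case True
    have "g $$ (rw \<gamma>, k) = 0"
    proof (rule ccontr)
      assume nz: "g $$ (rw \<gamma>, k) \<noteq> 0"
      have "k \<noteq> rw \<gamma>" using no[OF \<gamma>] True c by auto
      moreover have "\<not> k < rw \<gamma>" using g'(2)[of "rw \<gamma>" k] D_less[OF \<gamma>] nz by blast
      ultimately have "rw \<gamma> < k" by simp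
      moreover have "\<not> (\<exists>\<beta>\<in>D. rw \<beta> = k \<and> cl \<gamma> < cl \<beta>)"
        using no True c by fastforce
      ultimately have "bad \<gamma> k"
        using \<gamma> nz k True c by (simp add: bad_def)
      then have "\<gamma> \<in> B" unfolding B_def by blast
      then have "cl \<gamma> \<le> cl \<alpha>" by (rule max)
      then show False using True c by simp
    qed
    then show ?thesis using gX[of "rw \<gamma>" c] D_less[OF \<gamma>] c by simp
  next
    case False
    then show ?thesis using gX[of "rw \<gamma>" c] D_less[OF \<gamma>] c by simp
  qed
  let ?w = "g * y * inv\<^bsub>unitri n\<^esub> g"
  have row: "?w $$ (rw \<gamma>, j) = (if j = rw \<gamma> then 1 else 0) + (if j = cl \<gamma> then (if \<gamma> = \<alpha> then g $$ (rw \<alpha>, k) * t else 0) else 0)"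
    if \<gamma>: "\<gamma> \<in> D" and j: "j \<le> cl \<gamma>" for \<gamma> j
    using conjugate_row[OF g(1) yU D_less(1,2)[OF \<gamma>] zero[OF \<gamma>] j] gX[of "rw \<gamma>" "cl \<gamma>"] D_less[OF \<gamma>]
      columns_distinct[OF \<gamma> \<alpha>] by auto
  have wV: "?w \<in> V"
  proof (rule patternI)
    show "?w \<in> U" using g(1) yU by (intro unitri_mult_closed) auto
    fix i j assume ij: "i < j" "j < n" "(i, j) \<notin> V_pattern n D"
    then obtain \<gamma> where "\<gamma> \<in> D" "i = rw \<gamma>" "j < cl \<gamma>" by (auto simp: V_pattern_def not_le)
    then show "?w $$ (i, j) = 0" using row[of \<gamma> j] ij by auto
  qed
  have w_pos: "?w $$ pos \<gamma> = (if \<gamma> = \<alpha> then g $$ (rw \<alpha>, k) * t else 0)" if "\<gamma> \<in> D" for \<gamma>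
    using row[OF that order_refl] D_less[OF that] by (simp add: pos_def)
  have "lam_prod D ?w = (\<Prod>\<gamma>\<in>D. if \<gamma> = \<alpha> then \<theta> c0 else 1)"
    unfolding lam_prod_def by (intro prod.cong refl) (simp add: w_pos ts th)
  also have "\<dots> = \<theta> c0" using \<alpha> finite_D by simp
  finally have w_val: "lam_prod D ?w = \<theta> c0" .
  have y_pos: "y $$ pos \<gamma> = 0" if "\<gamma> \<in> D" for \<gamma>
  proof -
    have "\<not> (rw \<gamma> = k \<and> cl \<gamma> = cl \<alpha>)" using columns_distinct[OF that \<alpha>] k by auto
    then show ?thesis using y_index[of "rw \<gamma>" "cl \<gamma>"] D_less[OF that] by (auto simp: pos_def)
  qed
  have "lam_prod D y = 1"
    unfolding lam_prod_def by (intro prod.neutral ballI) (simp add: y_pos th)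
  then show ?thesis
    using yV wV w_val c0 by metis
qed

text \<open>
  A matrix of the pattern is factored by keeping its entries at positions of \<open>R_pattern D\<close> as the
  factor \<open>r\<close>. The rest \<open>A - r\<close> vanishes on the arms, hence so does \<open>(A - r) * inv r\<close>, and
  \<open>1 + (A - r) * inv r = A * inv r\<close> is the factor in \<open>V\<close>.
\<close>

lemma VR_basic_eq: "VR_basic n D = VR"
proof -
  have Gamma: "pos ` Gamma_basic D = R_pattern D" and Gamma_roots: "Gamma_basic D \<subseteq> pos_roots n"
  proof -
    have less: "less_r \<sigma> \<tau> \<longleftrightarrow> cl \<sigma> < cl \<tau>" "less_b \<sigma> \<tau> \<longleftrightarrow> rw \<sigma> < rw \<tau>"
      "pos (row_of \<sigma>, row_of \<tau> - 1) = (rw \<sigma>, rw \<tau>)" "row_of \<sigma> = rw \<sigma> + 1" "row_of \<tau> = rw \<tau> + 1"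
      if "\<sigma> \<in> D" "\<tau> \<in> D" for \<sigma> \<tau>
    proof -
      have "fst \<sigma> \<ge> 1" "fst \<tau> \<ge> 1" using that D_roots by (auto simp: pos_roots_def)
      then show "less_r \<sigma> \<tau> \<longleftrightarrow> cl \<sigma> < cl \<tau>" "less_b \<sigma> \<tau> \<longleftrightarrow> rw \<sigma> < rw \<tau>"
        "pos (row_of \<sigma>, row_of \<tau> - 1) = (rw \<sigma>, rw \<tau>)" "row_of \<sigma> = rw \<sigma> + 1" "row_of \<tau> = rw \<tau> + 1"
        by (auto simp: less_r_def less_b_def pos_defs)
    qed
    show "pos ` Gamma_basic D = R_pattern D"
    proof (intro equalityI subsetI)
      fix p assume "p \<in> pos ` Gamma_basic D"
      then obtain \<sigma> \<tau> where "p = pos (row_of \<sigma>, row_of \<tau> - 1)" "\<sigma> \<in> D" "\<tau> \<in> D" "less_r \<sigma> \<tau>" "less_b \<sigma> \<tau>"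
        by (auto simp: Gamma_basic_def)
      then show "p \<in> R_pattern D" using less[of \<sigma> \<tau>] unfolding R_pattern_def by blast
    next
      fix p assume "p \<in> R_pattern D"
      then obtain \<sigma> \<tau> where st: "p = (rw \<sigma>, rw \<tau>)" "\<sigma> \<in> D" "\<tau> \<in> D" "rw \<sigma> < rw \<tau>" "cl \<sigma> < cl \<tau>"
        by (auto simp: R_pattern_def)
      then have "(row_of \<sigma>, row_of \<tau> - 1) \<in> Gamma_basic D"
        using less[of \<sigma> \<tau>] unfolding Gamma_basic_def by blast
      then show "p \<in> pos ` Gamma_basic D" using less(3)[of \<sigma> \<tau>] st by (metis image_eqI)
    qed
    show "Gamma_basic D \<subseteq> pos_roots n"
    proof
      fix \<gamma> assume "\<gamma> \<in> Gamma_basic D"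
      then obtain \<sigma> \<tau> where st: "\<gamma> = (row_of \<sigma>, row_of \<tau> - 1)" "\<sigma> \<in> D" "\<tau> \<in> D" "less_r \<sigma> \<tau>" "less_b \<sigma> \<tau>"
        by (auto simp: Gamma_basic_def)
      then show "\<gamma> \<in> pos_roots n"
        using less[of \<sigma> \<tau>] D_less[of \<tau>] by (auto simp: pos_roots_def)
    qed
  qed
  have closedR: "closed_pattern (R_pattern D)"
    unfolding closed_pattern_def R_pattern_def by (smt (verit) mem_Collect_eq order.strict_trans prod.inject rows_distinct)
  have R: "(R_basic n D :: 'q mat set) = pattern n (R_pattern D)"
    unfolding R_basic_def using gen_by_roots_eq_pattern[OF Gamma_roots] closedR Gamma by simp
  have R_sub: "subgroup (pattern n (R_pattern D) :: 'q mat set) (unitri n)"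
    using closedR D_less by (intro pattern_subgroup) (fastforce simp: R_pattern_def)+
  have V: "(V_basic n D :: 'q mat set) = V"
    by (rule V_basic_eq_pattern[OF D_roots D_nonempty])
  have "V \<subseteq> VR" by (rule pattern_mono[OF V_pattern_subset_VR_pattern])
  moreover have "pattern n (R_pattern D) \<subseteq> VR"
  proof -
    have "R_pattern D \<subseteq> VR_pattern n D"
      using D_less rows_distinct by (fastforce simp: R_pattern_def VR_pattern_def)
    then show ?thesis by (rule pattern_mono)
  qed
  ultimately have sub: "V <#>\<^bsub>unitri n\<^esub> pattern n (R_pattern D) \<subseteq> VR"
    using pattern_mult_closed[OF closed_VR_pattern] by (fastforce simp: set_mult_def)
  have sup: "VR \<subseteq> V <#>\<^bsub>unitri n\<^esub> pattern n (R_pattern D)"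
  proof
    fix A assume A: "A \<in> VR"
    note a = patternD[OF A] and a' = unitriD[OF patternD(1)[OF A]]
    define r where "r = mat n n (\<lambda>(i, j). if i = j then 1 else if (i, j) \<in> R_pattern D then A $$ (i, j) else 0)"
    have rc: "r \<in> carrier_mat n n" by (simp add: r_def)
    have rR: "r \<in> pattern n (R_pattern D)"
      by (rule patternI) (auto simp: r_def mem_unitri_iff R_pattern_def)
    then have rU: "r \<in> U" by (rule patternD)
    let ?i = "inv\<^bsub>unitri n\<^esub> r"
    have iU: "?i \<in> U" using rU by simp
    have ic: "?i \<in> carrier_mat n n" by (rule unitriD(1)[OF iU])
    define v where "v = A * ?i"
    have vU: "v \<in> U" unfolding v_def using a(1) iU by (rule unitri_mult_closed)
    have "r * ?i = 1\<^sub>m n" using r_inv[OF rU] by simp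
    then have diff: "(A - r) * ?i = v - 1\<^sub>m n"
      unfolding v_def using a'(1) rc ic by (simp add: minus_mult_distrib_mat[of _ n n _ _ n])
    have "v \<in> V"
    proof (rule patternI[OF vU])
      fix i j assume ij: "i < j" "j < n" "(i, j) \<notin> V_pattern n D"
      then obtain \<alpha> where \<alpha>: "\<alpha> \<in> D" "i = rw \<alpha>" "j < cl \<alpha>" by (auto simp: V_pattern_def not_le)
      note lt = D_less[OF \<alpha>(1)]
      have "(A - r) $$ (i, c) = 0" if c: "c < cl \<alpha>" for c
      proof (cases c i rule: linorder_cases)
        case greater
        have "(i, c) \<in> R_pattern D" if "A $$ (i, c) \<noteq> 0"
        proof -
          have "(i, c) \<in> VR_pattern n D" using a(2)[of i c] that greater c lt by auto
          then obtain \<beta> where "\<beta> \<in> D" "rw \<beta> = c" "cl \<alpha> < cl \<beta>"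
            using \<alpha> c by (auto simp: VR_pattern_def)
          then show ?thesis using \<alpha> greater unfolding R_pattern_def by blast
        qed
        then show ?thesis using greater c lt \<alpha> a'(1) rc by (auto simp: r_def)
      next
        case less
        then show ?thesis using a'(1) a'(2)[of i c] c lt \<alpha> D_less(1) by (auto simp: r_def R_pattern_def)
      qed (use a'(1) a'(3)[of i] c lt \<alpha> in \<open>auto simp: r_def\<close>)
      then have "((A - r) * ?i) $$ (i, j) = 0"
        using row_mult_unitri[of "A - r" n ?i i "cl \<alpha>" j] minus_carrier_mat[OF rc, of A] iU \<alpha> lt by auto
      then show "v $$ (i, j) = 0" using ij unitriD(1)[OF vU] by (simp add: diff)
    qed
    moreover have "v * r = A"
      unfolding v_def using m_assoc[of A ?i r] a(1) rU l_inv[OF rU] r_one[OF a(1)] by simp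
    ultimately show "A \<in> V <#>\<^bsub>unitri n\<^esub> pattern n (R_pattern D)"
      using rR by (auto simp: set_mult_def)
  qed
  show ?thesis
    unfolding VR_basic_def R V using sub sup by blast
qed

sublocale separated_linear_character "unitri n :: 'q mat monoid" VR V "lam_prod D"
proof (intro separated_linear_character.intro subgroup_of_finite_group.intro
    subgroup_of_finite_group_axioms.intro separated_linear_character_axioms.intro)
  show "V \<subseteq> VR" by (rule pattern_mono[OF V_pattern_subset_VR_pattern])
  show "lam_prod D (u \<otimes>\<^bsub>unitri n\<^esub> v) = lam_prod D u * lam_prod D v" if "u \<in> V" "v \<in> V" for u v
    using that lam_prod_mult[of D u v] patternD(1)[OF that(2)] by simp
qed (simp_all add: unitri_group finite_unitri VR_subgroup V_subgroup lam_prod_nonzero VR_normalizes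
    separated_outside_VR)

end

theorem theorem2p8:
  fixes n :: nat
    and \<theta> :: "'q :: {field, finite} \<Rightarrow> complex"
    and D :: "root set"
    and \<phi> :: "root \<Rightarrow> 'q mat \<Rightarrow> complex"
  assumes "n \<ge> 2"
    and "nontrivial_additive_character \<theta>"
    and "basic_set n D"
    and "\<phi> \<in> E_basic \<theta> n D"
  shows
    "supercharacter n D \<phi> =
       induced (unitri n) (VR_basic n D)
         (induced (unitri_subgroup n (VR_basic n D)) (V_basic n D) (lam_basic n D \<phi>))
     \<and>
     (\<forall>\<chi> \<in> Irr_over (unitri_subgroup n (VR_basic n D)) (V_basic n D) (lam_basic n D \<phi>).
        induced (unitri n) (VR_basic n D) \<chi> \<in> Irr (unitri n) \<and>
        induced (unitri n) (VR_basic n D) \<chi> \<in> Irr_constituents (unitri n) (supercharacter n D \<phi>))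
     \<and>
     (\<forall>\<chi>1 \<in> Irr_over (unitri_subgroup n (VR_basic n D)) (V_basic n D) (lam_basic n D \<phi>).
      \<forall>\<chi>2 \<in> Irr_over (unitri_subgroup n (VR_basic n D)) (V_basic n D) (lam_basic n D \<phi>).
        \<chi>1 \<noteq> \<chi>2 \<longrightarrow>
        induced (unitri n) (VR_basic n D) \<chi>1 \<noteq> induced (unitri n) (VR_basic n D) \<chi>2)"
proof -
  have "\<forall>\<alpha>\<in>D. \<exists>s. s \<noteq> 0 \<and> \<phi> \<alpha> = lam \<theta> n \<alpha> s"
    using assms(4) by (fastforce simp: E_basic_def PiE_iff)
  then obtain s where \<phi>_lam: "\<And>\<alpha>. \<alpha> \<in> D \<Longrightarrow> s \<alpha> \<noteq> 0 \<and> \<phi> \<alpha> = lam \<theta> n \<alpha> (s \<alpha>)"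
    by metis
  interpret basic_root_set n D \<theta> s
    by unfold_locales (use assms \<phi>_lam in auto)
  have V: "(V_basic n D :: 'q mat set) = V"
    by (rule V_basic_eq_pattern[OF D_roots D_nonempty])
  have \<phi>: "\<phi> \<alpha> A = lam_prod {\<alpha>} A" if "\<alpha> \<in> D" "A \<in> V_root n \<alpha>" for \<alpha> A
  proof -
    have "\<alpha> \<in> pos_roots n" using that(1) D_roots by blast
    then show ?thesis
      using \<phi>_lam[OF that(1)] lam_eq[OF \<theta>, of \<alpha> n "s \<alpha>"] that(2) by (simp add: lam_prod_def)
  qed
  have "induced G V (lam_basic n D \<phi>) = induced G V (lam_prod D)" for G :: "'q mat monoid"
  proof (rule induced_cong)
    fix y :: "'q mat" assume y: "y \<in> V"
    then have "y \<in> V_root n \<alpha>" if "\<alpha> \<in> D" for \<alpha>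
      unfolding V[symmetric] V_basic_def using that by blast
    then have "(\<Prod>\<alpha>\<in>D. \<phi> \<alpha> y) = (\<Prod>\<alpha>\<in>D. lam_prod {\<alpha>} y)"
      by (intro prod.cong refl \<phi>)
    then show "lam_basic n D \<phi> y = lam_prod D y"
      using y by (simp add: lam_basic_def V lam_prod_def)
  qed
  then have over: "Irr_over (unitri_subgroup n VR) V (lam_basic n D \<phi>) = Irr_over GH V (lam_prod D)"
    and ind: "induced (unitri_subgroup n VR) V (lam_basic n D \<phi>) = induced GH V (lam_prod D)"
    by (simp_all add: Irr_over_def)
  have super: "supercharacter n D \<phi> = induced (unitri n) V (lam_prod D)"
  proof
    fix g :: "'q mat"
    show "supercharacter n D \<phi> g = induced (unitri n) V (lam_prod D) g"
    proof (cases "g \<in> U")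
      case True
      have "supercharacter n D \<phi> g
          = (\<Prod>\<alpha>\<in>D. induced (unitri n) (pattern n (V_pattern n {\<alpha>})) (lam_prod {\<alpha>}) g)"
        unfolding supercharacter_def
      proof (rule prod.cong[OF refl])
        fix \<alpha> assume \<alpha>: "\<alpha> \<in> D"
        then have VP: "(V_root n \<alpha> :: 'q mat set) = pattern n (V_pattern n {\<alpha>})"
          using D_roots by (intro V_root_eq_pattern) auto
        then show "induced (unitri n) (V_root n \<alpha>) (\<phi> \<alpha>) g
            = induced (unitri n) (pattern n (V_pattern n {\<alpha>})) (lam_prod {\<alpha>}) g"
          using \<phi>[OF \<alpha>] induced_cong[of "V_root n \<alpha>" "\<phi> \<alpha>" "lam_prod {\<alpha>}" "unitri n"] by simp
      qed
      then show ?thesis using prod_induced_V_root[OF order_refl True] by simp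
    next
      case False
      then show ?thesis
        using D_nonempty finite_D by (simp add: supercharacter_def induced_eq card_gt_0_iff)
    qed
  qed
  show ?thesis
    unfolding VR_basic_eq V over ind super
    using induced_transitive[OF H fin VH] induced_Irr_over induced_Irr_over_constituent induced_Irr_over_inj
    by auto
qed

end
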